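(* For $u\in\mathbb{R}$, let $$\Phi(u)=\frac{1}{\Gamma(e^{iu}+1)}\prod_p\left(1-\frac1p\right)^{e^{iu}}\left(1+\frac{e^{iu}}{p-1}\right),$$ the product being over all prime numbers $p$. This Euler product is absolutely and locally uniformly convergent. Moreover, for any $u\in\mathbb{R}$, $$\lim_{N\to+\infty}\frac{(\log N)^{1-e^{iu}}}{N}\sum_{2\le n\le N}e^{iu\omega'(n)}=\Phi(u),$$ and the convergence is locally uniform in $u$.
   Context: For an integer $n\ge2$, $\omega(n)$ is the number of distinct prime divisors of $n$ and $\omega'(n)=\omega(n)-1$. The function $1/\Gamma$ is understood as an entire function (so it equals $0$ at $0$). For $x>0$ and $z\in\mathbb{C}$, $x^z=\exp(z\log x)$. *)

theory Defs
  imports "HOL-Complex_Analysis.Complex_Analysis" "HOL-Computational_Algebra.Primes"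
begin

definition omega :: "nat \<Rightarrow> nat" where
  "omega n = card (prime_factors n)"

definition omega' :: "nat \<Rightarrow> int" where
  "omega' n = int (omega n) - 1"

text \<open>The product over all primes is an infinite product over all natural numbers in
  increasing order, the factors at non-primes being \<open>1\<close>. The bases of the complex powers here
  and below are positive reals, where \<^term>\<open>x powr z\<close> is \<open>exp (z * ln x)\<close>.\<close>

definition euler_factor :: "nat \<Rightarrow> real \<Rightarrow> complex" where
  "euler_factor p u =
     (if prime p
      then of_real (1 - 1 / real p) powr exp (\<i> * of_real u)
             * (1 + exp (\<i> * of_real u) / (of_nat p - 1))
      else 1)"

definition Phi :: "real \<Rightarrow> complex" where
  "Phi u = rGamma (exp (\<i> * of_real u) + 1) * (\<Prod>p. euler_factor p u)"

definition normalized_sum :: "nat \<Rightarrow> real \<Rightarrow> complex" where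
  "normalized_sum N u =
     of_real (ln (real N)) powr (1 - exp (\<i> * of_real u)) / of_nat N
       * (\<Sum>n = 2..N. exp (\<i> * of_real u * of_int (omega' n)))"

definition locally_uniform_limit ::
  "('b \<Rightarrow> 'a::topological_space \<Rightarrow> 'c::metric_space) \<Rightarrow> ('a \<Rightarrow> 'c) \<Rightarrow> 'b filter \<Rightarrow> bool" where
  "locally_uniform_limit f l F \<longleftrightarrow>
     (\<forall>x. \<exists>U. open U \<and> x \<in> U \<and> uniform_limit U f l F)"

end

theory Submission
  imports Defs "HOL-Probability.Characteristic_Functions" "HOL-Probability.Sinc_Integral" "HOL-Real_Asymp.Real_Asymp"
begin

text \<open>
  Write \<open>z = exp (\<i> u)\<close>, so \<open>\<bar>z\<bar> = 1\<close>, and \<open>S v = (\<Sum>n \<le> exp v. z ^ \<omega>(n))\<close>. The Dirichlet series of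
  \<open>z ^ \<omega>(n)\<close> is \<open>\<zeta>(s) ^ z * G(s)\<close> with \<open>G\<close> bounded and holomorphic to the left of \<open>Re s = 1\<close>, and
  the Laplace transform of \<open>S\<close> is \<open>H(s) = \<zeta>(s) ^ z * G(s) / s\<close>. No contour is moved: with \<open>l = ln N\<close>
  and \<open>c = G(1) / \<Gamma>(z)\<close>, the function
  \<open>exp (- v / l) * v ^ 20 * (exp (- v) * S v - c * v powr (z - 1))\<close> has as Fourier transform the
  difference of the 20th derivatives of \<open>H(s)\<close> and of \<open>G(1) * (s - 1) powr (- z)\<close> on the line
  \<open>Re s = 1 + 1 / l\<close>. By Cauchy's estimates, that difference is small near \<open>s = 1\<close>, where
  \<open>(s - 1) * \<zeta>(s)\<close> is regular, and is \<open>O(l * (\<bar>t\<bar> + 5))\<close> elsewhere, where the 3-4-1 inequality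
  yields a zero-free disc around \<open>s\<close> of radius a small negative power of \<open>\<bar>t\<bar>\<close>. Damping by a
  Gaussian at scale \<open>1 / l ^ 3\<close> turns this into a pointwise bound at \<open>v = l\<close>, because \<open>S\<close> has
  bounded summands and therefore varies slowly; the factor \<open>v ^ 20\<close> makes the main term dominate
  the power of \<open>l\<close> lost in the smoothing, uniformly in \<open>z\<close>, including \<open>z = -1\<close>, where \<open>c = 0\<close>.\<close>

section \<open>Euler products of multiplicative functions\<close>

text \<open>The bound for the 20th derivative grows with the height, so it does not justify Fourier
  inversion directly, and the smoothing that replaces inversion costs fixed powers of
  \<open>l\<close>. Without the factor \<open>v ^ 20\<close> the normalizing power at
  \<open>v = l\<close> would be \<open>l powr (Re z - 1)\<close>, only \<open>l powr (-2)\<close> at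
  \<open>z = -1\<close>; with it, the power is at least \<open>l ^ 18\<close>, more than the
  smoothing costs. The price is that Cauchy's estimate takes the 20th power of the reciprocal radius
  of the zero-free disc. For growth linear in \<open>\<bar>t\<bar>\<close> the radius may shrink
  only like \<open>(\<bar>t\<bar> + 5) powr (-1/20)\<close>, which calls for a bound for zeta left
  of \<open>Re s = 1\<close> with a very small exponent; interpolating between two elementary bounds
  for the summands of \<open>zeta_reg\<close> gives the exponent 1/100. As the error claimed is only
  of order \<open>1 / l\<close> relative to the normalizing power, a zero-free region of power type
  is enough.\<close>

definition factored_over :: "nat set \<Rightarrow> nat set" where
  "factored_over A = {n. n \<noteq> 0 \<and> prime_factors n \<subseteq> A}"

text \<open>Unique factorization: the exponent \<open>k\<close> is recovered from
  \<open>m * p ^ k\<close> as the multiplicity of \<open>p\<close>, since \<open>p\<close> divides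
  no member of \<open>factored_over A\<close>.\<close>

lemma bij_betw_factored_over_insert:
  assumes "prime p" "p \<notin> A"
  shows "bij_betw (\<lambda>(m, k). m * p ^ k) (factored_over A \<times> UNIV) (factored_over (insert p A))"
proof (rule bij_betwI')
  have ndvd: "\<not> p dvd m" if "m \<in> factored_over A" for m
    using that assms by (auto simp: factored_over_def prime_factors_dvd)
  fix x y assume x: "x \<in> factored_over A \<times> (UNIV :: nat set)" and y: "y \<in> factored_over A \<times> (UNIV :: nat set)"
  obtain m k where [simp]: "x = (m, k)" by (cases x)
  obtain m' k' where [simp]: "y = (m', k')" by (cases y)
  have mult: "multiplicity p (m * p ^ k) = k" if "m \<in> factored_over A" for m k
    using ndvd[OF that] that assms
    by (subst prime_elem_multiplicity_mult_distrib)
       (auto simp: factored_over_def not_dvd_imp_multiplicity_0)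
  show "((case x of (m, k) \<Rightarrow> m * p ^ k) = (case y of (m, k) \<Rightarrow> m * p ^ k)) = (x = y)"
  proof
    assume eq: "(case x of (m, k) \<Rightarrow> m * p ^ k) = (case y of (m, k) \<Rightarrow> m * p ^ k)"
    have "k = k'" using eq mult[of m k] mult[of m' k'] x y by simp
    thus "x = y" using eq assms by (auto simp: prime_gt_0_nat)
  qed simp
  show "(case x of (m, k) \<Rightarrow> m * p ^ k) \<in> factored_over (insert p A)"
  proof -
    have "q \<in> insert p A" if "q \<in> prime_factors (m * p ^ k)" for q
    proof -
      have "prime q" "q dvd m \<or> q dvd p ^ k" using that by (auto simp: prime_dvd_mult_iff in_prime_factors_iff)
      thus ?thesis using x assms prime_dvd_power[of q p k] primes_dvd_imp_eq[of q p]
        by (auto simp: factored_over_def in_prime_factors_iff)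
    qed
    thus ?thesis using x assms by (auto simp: factored_over_def prime_gt_0_nat)
  qed
next
  fix n assume n: "n \<in> factored_over (insert p A)"
  hence n0: "n \<noteq> 0" by (simp add: factored_over_def)
  have "n \<noteq> 0" "\<not> is_unit p" using n0 assms by auto
  then obtain m where m: "n = p ^ multiplicity p n * m" "\<not> p dvd m"
    using multiplicity_decompose' by blast
  have "m \<in> factored_over A"
  proof -
    have "m \<noteq> 0" using m(2) by (metis dvd_0_right)
    moreover have "prime_factors m \<subseteq> prime_factors n"
      using m n0 by (metis dvd_prime_factors dvd_triv_right)
    moreover have "p \<notin> prime_factors m" using m by auto
    ultimately show ?thesis using n unfolding factored_over_def by blast
  qed
  thus "\<exists>x\<in>factored_over A \<times> UNIV. n = (case x of (m, k) \<Rightarrow> m * p ^ k)"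
    using m(1) by (intro bexI[of _ "(m, multiplicity p n)"]) (simp_all add: mult.commute[of m])
qed

text \<open>Primes are adjoined one at a time: the bijection above turns the sum over the larger set
  into a double sum, in which multiplicativity separates the two variables. Unordered sums are used
  because this rearrangement ignores the order of the integers.\<close>

lemma infsum_factored_over:
  fixes a :: "nat \<Rightarrow> complex"
  assumes one: "a 1 = 1"
  assumes mult: "\<And>m n. coprime m n \<Longrightarrow> a (m * n) = a m * a n"
  assumes abs: "(\<lambda>n. norm (a n)) summable_on {1..}"
  assumes "finite A" "\<And>p. p \<in> A \<Longrightarrow> prime p"
  shows "infsum a (factored_over A) = (\<Prod>p\<in>A. \<Sum>\<^sub>\<infinity>k. a (p ^ k))"
  using assms(4,5)
proof (induction A rule: finite_induct)
  case empty
  have "n = 1" if "n \<noteq> 0" "prime_factors n = {}" for n :: nat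
    using that by (auto simp: prime_factorization_empty_iff)
  hence "factored_over {} = {1}" by (auto simp: factored_over_def)
  thus ?case using one by simp
next
  case (insert p A)
  have p: "prime p" using insert by auto
  let ?h = "\<lambda>(m, k). m * p ^ k"
  have sub: "factored_over B \<subseteq> {1..}" for B by (auto simp: factored_over_def)
  have bij: "bij_betw ?h (factored_over A \<times> UNIV) (factored_over (insert p A))"
    using bij_betw_factored_over_insert p insert by blast
  have smb: "a summable_on factored_over (insert p A)"
    by (rule abs_summable_summable, rule summable_on_subset_banach[OF abs sub])
  have cop: "a (m * p ^ k) = a m * a (p ^ k)" if "m \<in> factored_over A" for m k
  proof -
    have "\<not> p dvd m" using that insert.hyps(2) p unfolding factored_over_def
      by (auto simp: prime_factors_dvd)
    hence "coprime p m" using p prime_imp_coprime by blast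
    hence "coprime m (p ^ k)" by (simp add: coprime_commute)
    thus ?thesis by (rule mult)
  qed
  have "infsum a (factored_over (insert p A)) = infsum (\<lambda>x. a (?h x)) (factored_over A \<times> UNIV)"
    using infsum_reindex_bij_betw[OF bij] by metis
  also have "\<dots> = infsum (\<lambda>x. infsum (\<lambda>y. a (?h (x, y))) UNIV) (factored_over A)"
    by (subst infsum_Sigma_banach) (use summable_on_reindex_bij_betw[OF bij, of a] smb in auto)
  also have "\<dots> = infsum (\<lambda>m. a m * infsum (\<lambda>k. a (p ^ k)) UNIV) (factored_over A)"
    by (intro infsum_cong) (simp add: cop infsum_cmult_right')
  also have "\<dots> = infsum a (factored_over A) * infsum (\<lambda>k. a (p ^ k)) UNIV"
    by (simp add: infsum_cmult_left')
  also have "\<dots> = (\<Prod>p\<in>insert p A. \<Sum>\<^sub>\<infinity>k. a (p ^ k))"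
    using insert by (simp add: mult.commute)
  finally show ?case .
qed

text \<open>The partial product over the primes up to \<open>N\<close> is the sum over the integers
  composed of such primes. These include all integers from 1 to \<open>N\<close>, so the error is
  bounded by a tail of the absolutely convergent series.\<close>

lemma euler_product:
  fixes a :: "nat \<Rightarrow> complex"
  assumes one: "a 1 = 1"
  assumes mult: "\<And>m n. coprime m n \<Longrightarrow> a (m * n) = a m * a n"
  assumes abs: "summable (\<lambda>n. norm (a (Suc n)))"
  shows "(\<lambda>N. \<Prod>p\<in>{p. prime p \<and> p \<le> N}. \<Sum>k. a (p ^ k)) \<longlonglongrightarrow> (\<Sum>n. a (Suc n))"
proof -
  have bij: "bij_betw Suc UNIV {1..}"
    by (rule bij_betwI[of _ _ _ "\<lambda>n. n - 1"]) auto
  have abs': "(\<lambda>n. norm (a n)) summable_on {1..}"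
    using abs summable_on_reindex_bij_betw[OF bij, of "\<lambda>n. norm (a n)"]
    by (simp add: norm_summable_imp_summable_on)
  have eqsum: "(\<Sum>n. a (Suc n)) = infsum a {1..}"
    using infsum_reindex_bij_betw[OF bij, of a] abs
    by (metis norm_summable_imp_has_sum has_sum_infsum infsumI sums_iff summable_norm_cancel summable_sums)
  define P where "P N = {p::nat. prime p \<and> p \<le> N}" for N
  define n0 where "n0 N = infsum (\<lambda>n. norm (a n)) {N..}" for N :: nat
  have fin: "finite (P N)" for N unfolding P_def by (rule finite_subset[of _ "{..N}"]) auto
  have ksum: "(\<Sum>k. a (p ^ k)) = (\<Sum>\<^sub>\<infinity>k. a (p ^ k))" if "prime p" for p
  proof -
    have inj: "inj (\<lambda>k. p ^ k)" using prime_gt_1_nat[OF that] by (auto simp: inj_on_def)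
    have "(\<lambda>n. norm (a n)) summable_on range (\<lambda>k. p ^ k)"
      by (rule summable_on_subset_banach[OF abs']) (use prime_gt_0_nat[OF that] in auto)
    hence s: "(\<lambda>k. norm (a (p ^ k))) summable_on UNIV"
      using summable_on_reindex[OF inj, of "\<lambda>n. norm (a n)"] by (simp add: o_def)
    hence "(\<lambda>k. a (p ^ k)) summable_on UNIV" by (rule abs_summable_summable)
    thus ?thesis by (meson has_sum_imp_sums has_sum_infsum sums_unique[symmetric])
  qed
  have eq: "(\<Prod>p\<in>P N. \<Sum>k. a (p ^ k)) = infsum a (factored_over (P N))" for N
    by (subst infsum_factored_over[OF one mult abs' fin]) (auto simp: P_def ksum intro!: prod.cong)
  have smab: "a summable_on B" "(\<lambda>n. norm (a n)) summable_on B" if "B \<subseteq> {1..}" for B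
    using abs_summable_summable summable_on_subset_banach[OF abs' that] by blast+
  have bnd: "norm ((\<Prod>p\<in>P N. \<Sum>k. a (p ^ k)) - (\<Sum>n. a (Suc n))) \<le> (\<Sum>n. norm (a (Suc (n + N))))" for N
  proof -
    have sub: "factored_over (P N) \<subseteq> {1..}" by (auto simp: factored_over_def)
    have "infsum a ({1..} - factored_over (P N)) = infsum a {1..} - infsum a (factored_over (P N))"
      by (rule infsum_Diff) (use smab sub in auto)
    hence "norm ((\<Prod>p\<in>P N. \<Sum>k. a (p ^ k)) - (\<Sum>n. a (Suc n))) =
       norm (infsum a ({1..} - factored_over (P N)))"
      by (simp add: eq eqsum norm_minus_commute)
    also have "\<dots> \<le> infsum (\<lambda>n. norm (a n)) ({1..} - factored_over (P N))"
      by (rule norm_infsum_bound) (use smab in auto)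
    also have "\<dots> \<le> infsum (\<lambda>n. norm (a n)) {Suc N..}"
    proof (rule infsum_mono2)
      have *: "n \<in> factored_over (P N)" if "0 < n" "n \<le> N" for n
      proof -
        have "p \<le> N" if "p \<in> prime_factors n" for p
          using that \<open>0 < n\<close> \<open>n \<le> N\<close> by (meson dvd_imp_le in_prime_factors_imp_dvd order_trans)
        thus ?thesis using that by (auto simp: factored_over_def P_def)
      qed
      show "{1..} - factored_over (P N) \<subseteq> {Suc N..}"
      proof
        fix n assume "n \<in> {1..} - factored_over (P N)"
        hence "\<not> n \<le> N" using *[of n] by auto
        thus "n \<in> {Suc N..}" by simp
      qed
    qed (use smab in auto)
    also have "\<dots> = (\<Sum>n. norm (a (Suc (n + N))))"
    proof -
      have bij: "bij_betw (\<lambda>n. Suc (n + N)) UNIV {Suc N..}"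
        by (rule bij_betwI[of _ _ _ "\<lambda>n. n - Suc N"]) auto
      have "summable (\<lambda>n. norm (a (Suc (n + N))))"
        using abs summable_ignore_initial_segment by blast
      hence "(\<lambda>n. norm (a (Suc (n + N)))) summable_on UNIV"
        by (intro norm_summable_imp_summable_on) auto
      thus ?thesis
        using infsum_reindex_bij_betw[OF bij, of "\<lambda>n. norm (a n)"]
        by (metis has_sum_imp_sums has_sum_infsum sums_unique)
    qed
    finally show ?thesis .
  qed
  have "(\<lambda>N. (\<Sum>n. norm (a (Suc (n + N))))) = (\<lambda>N. (\<Sum>n. norm (a (Suc n))) - (\<Sum>i<N. norm (a (Suc i))))"
    using suminf_minus_initial_segment[OF abs] by auto
  moreover have "\<dots> \<longlonglongrightarrow> (\<Sum>n. norm (a (Suc n))) - (\<Sum>n. norm (a (Suc n)))"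
    by (intro tendsto_intros summable_LIMSEQ abs)
  ultimately have "(\<lambda>N. (\<Sum>n. norm (a (Suc (n + N))))) \<longlonglongrightarrow> 0" by simp
  hence "(\<lambda>N. (\<Prod>p\<in>P N. \<Sum>k. a (p ^ k)) - (\<Sum>n. a (Suc n))) \<longlonglongrightarrow> 0"
    by (rule Lim_null_comparison[rotated]) (use bnd in auto)
  thus ?thesis unfolding P_def by (rule LIM_zero_cancel)
qed

section \<open>Analytic continuation of the zeta function\<close>

text \<open>With \<open>m = Suc n\<close> this is \<open>s - 1\<close> times the difference between
  \<open>m powr (-s)\<close> and the integral of \<open>x powr (-s)\<close> from \<open>m\<close> to
  \<open>m + 1\<close>, the integral being multiplied out. Comparison with the integral is what
  carries the series past \<open>Re s = 1\<close>.\<close>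

definition zeta_term :: "nat \<Rightarrow> complex \<Rightarrow> complex" where
  "zeta_term n s = (let m = of_nat (Suc n) in (s - 1) * m powr (-s) + (m + 1) powr (1 - s) - m powr (1 - s))"

text \<open>The function \<open>(s - 1) * \<zeta>(s)\<close>, as an analytic function on \<open>Re s > 0\<close>.\<close>

definition zeta_reg :: "complex \<Rightarrow> complex" where
  "zeta_reg s = 1 + (\<Sum>n. zeta_term n s)"

lemma norm_powr_diff_le:
  fixes x y :: real and s :: complex
  assumes "0 < x" "x \<le> y" "Re s \<ge> 0"
  shows "norm (of_real y powr (-s) - of_real x powr (-s)) \<le> norm s * x powr (- Re s - 1) * (y - x)"
proof -
  have "norm ((\<lambda>t. of_real t powr (-s)) y - (\<lambda>t. of_real t powr (-s)) x) \<le> norm s * x powr (- Re s - 1) * norm (y - x)"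
  proof (rule differentiable_bound[where S = "{x..y}" and f' = "\<lambda>t h. h *\<^sub>R (- s * of_real t powr (- s - 1))"])
    fix t assume t: "t \<in> {x..y}"
    have "((\<lambda>t. of_real t powr (-s)) has_vector_derivative (- s * of_real t powr (- s - 1))) (at t within {x..y})"
      using t assms by (auto intro!: derivative_eq_intros has_vector_derivative_real_field)
    thus "((\<lambda>t. of_real t powr (-s)) has_derivative (\<lambda>h. h *\<^sub>R (- s * of_real t powr (- s - 1)))) (at t within {x..y})"
      by (simp add: has_vector_derivative_def)
    have "norm (- s * of_real t powr (- s - 1)) \<le> norm s * x powr (- Re s - 1)"
      using t assms by (auto simp: norm_mult norm_powr_real_powr intro!: mult_left_mono powr_mono2')
    thus "onorm (\<lambda>h. h *\<^sub>R (- s * of_real t powr (- s - 1))) \<le> norm s * x powr (- Re s - 1)"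
      by (intro onorm_le) (simp add: mult.commute mult_left_mono)
  qed (use assms in auto)
  thus ?thesis using assms by simp
qed

text \<open>Two views of the same difference: the mean value inequality gains a factor
  \<open>1 / Suc n\<close> at the cost of a factor \<open>norm s\<close>, while the triangle
  inequality costs nothing and gains nothing.\<close>

lemma zeta_term_bounds:
  assumes s: "Re s \<ge> 0"
  shows "norm (zeta_term n s) \<le> norm (s - 1) * (norm s * real (Suc n) powr (- Re s - 1))"
    and "norm (zeta_term n s) \<le> norm (s - 1) * (2 * real (Suc n) powr (- Re s))"
proof -
  define m where "m = real (Suc n)"
  have m: "m \<ge> 1" by (simp add: m_def)
  \<comment> \<open>The derivative of \<open>g\<close> is
    \<open>(s - 1) * (m powr (-s) - (m + x) powr (-s))\<close>, so a bound for this on the unit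
    interval bounds \<open>g 1 - g 0\<close>.\<close>
  define g where "g x = (s - 1) * of_real m powr (-s) * of_real x + of_real (m + x) powr (1 - s)" for x :: real
  have zt: "zeta_term n s = g 1 - g 0"
    by (simp add: zeta_term_def g_def m_def Let_def algebra_simps)
  have gen: "norm (g 1 - g 0) \<le> B * norm (1 - 0 :: real)"
    if B: "\<And>x. x \<in> {0..1} \<Longrightarrow> norm (s - 1) * norm (of_real m powr (-s) - of_real (m + x) powr (- s)) \<le> B" for B
  proof (rule differentiable_bound[where S = "{0..1}" and f' = "\<lambda>x h. h *\<^sub>R ((s - 1) * (of_real m powr (-s) - of_real (m + x) powr (-s)))"])
    fix t :: real assume t: "t \<in> {0..1}"
    have d: "((\<lambda>w. (s - 1) * of_real m powr (-s) * w + (of_real m + w) powr (1 - s)) has_field_derivative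
       ((s - 1) * (of_real m powr (-s) - (of_real m + of_real t) powr (-s)))) (at (of_real t :: complex))"
      using t m by (auto intro!: derivative_eq_intros simp: complex_nonpos_Reals_iff algebra_simps)
    have "(g has_vector_derivative ((s - 1) * (of_real m powr (-s) - of_real (m + t) powr (-s)))) (at t within {0..1})"
      unfolding g_def using has_vector_derivative_real_field[OF d] by simp
    thus "(g has_derivative (\<lambda>h. h *\<^sub>R ((s - 1) * (of_real m powr (-s) - of_real (m + t) powr (-s))))) (at t within {0..1})"
      by (simp add: has_vector_derivative_def)
    show "onorm (\<lambda>h. h *\<^sub>R ((s - 1) * (of_real m powr (-s) - of_real (m + t) powr (-s)))) \<le> B"
      using B[OF t] by (intro onorm_le) (simp add: norm_mult mult.commute[of B] mult_left_mono)
  qed auto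
  have "norm (s - 1) * norm (of_real m powr (-s) - of_real (m + x) powr (- s)) \<le> norm (s - 1) * (norm s * m powr (- Re s - 1))"
    if "x \<in> {0..1}" for x :: real
  proof -
    have "norm (of_real (m + x) powr (- s) - of_real m powr (-s)) \<le> norm s * m powr (- Re s - 1) * (m + x - m)"
      using norm_powr_diff_le[of m "m + x" s] that m s by simp
    also have "\<dots> \<le> norm s * m powr (- Re s - 1) * 1"
      by (intro mult_left_mono) (use that in auto)
    finally show ?thesis by (intro mult_left_mono) (simp_all add: norm_minus_commute)
  qed
  from gen[OF this] show "norm (zeta_term n s) \<le> norm (s - 1) * (norm s * real (Suc n) powr (- Re s - 1))"
    by (simp add: zt m_def)
  have "norm (s - 1) * norm (of_real m powr (-s) - of_real (m + x) powr (- s)) \<le> norm (s - 1) * (2 * m powr (- Re s))"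
    if "x \<in> {0..1}" for x :: real
  proof -
    have "norm (of_real m powr (-s) - of_real (m + x) powr (- s)) \<le> norm (of_real m powr (-s)) + norm (of_real (m + x) powr (- s))"
      by (rule norm_triangle_ineq4)
    also have "\<dots> \<le> m powr (- Re s) + (m + x) powr (- Re s)"
      using that m by (simp add: norm_powr_real_powr)
    also have "(m + x) powr (- Re s) \<le> m powr (- Re s)"
      using that m s by (intro powr_mono2') auto
    finally show ?thesis by (intro mult_left_mono) simp_all
  qed
  from gen[OF this] show "norm (zeta_term n s) \<le> norm (s - 1) * (2 * real (Suc n) powr (- Re s))"
    by (simp add: zt m_def)
qed

text \<open>The two bounds cross at \<open>norm s = Suc n\<close>, and on each side the better one
  is at most their interpolation with weight \<theta>. A small \<theta> already gives summability
  slightly to the left of \<open>Re s = 1\<close>, and apart from \<open>norm (s - 1)\<close>, which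
  division by \<open>s - 1\<close> removes, the growth is only
  \<open>norm s powr \<theta>\<close>.\<close>

lemma zeta_term_bound:
  assumes s: "Re s \<ge> 0" and \<theta>: "0 \<le> \<theta>" "\<theta> \<le> 1"
  shows "norm (zeta_term n s) \<le> 2 * norm (s - 1) * norm s powr \<theta> * real (Suc n) powr (- Re s - \<theta>)"
proof (cases "norm s \<le> real (Suc n)")
  case True
  have m: "real (Suc n) > 0" by simp
  have "norm (zeta_term n s) \<le> norm (s - 1) * (norm s * real (Suc n) powr (- Re s - 1))"
    by (rule zeta_term_bounds) fact
  also have "norm s * real (Suc n) powr (- Re s - 1) \<le> norm s powr \<theta> * real (Suc n) powr (- Re s - \<theta>)"
  proof (cases "norm s = 0")
    case False
    have eq: "x powr (1 - \<theta>) * x powr (- Re s - 1) = x powr (- Re s - \<theta>)" for x :: real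
      unfolding powr_add[symmetric] by (rule arg_cong[where f = "\<lambda>y. _ powr y"]) simp
    have "norm s * real (Suc n) powr (- Re s - 1) = norm s powr \<theta> * (norm s powr (1 - \<theta>) * real (Suc n) powr (- Re s - 1))"
      using False by (simp add: powr_add[symmetric] mult.assoc[symmetric])
    also have "norm s powr (1 - \<theta>) * real (Suc n) powr (- Re s - 1) \<le> real (Suc n) powr (1 - \<theta>) * real (Suc n) powr (- Re s - 1)"
      using True \<theta> by (intro mult_right_mono powr_mono2) auto
    also have "\<dots> = real (Suc n) powr (- Re s - \<theta>)" by (rule eq)
    finally show ?thesis by (simp add: mult_left_mono)
  qed auto
  also have "norm (s - 1) * (norm s powr \<theta> * real (Suc n) powr (- Re s - \<theta>)) \<le> 2 * (norm (s - 1) * (norm s powr \<theta> * real (Suc n) powr (- Re s - \<theta>)))"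
    by simp
  finally show ?thesis by (simp add: mult_left_mono mult.assoc)
next
  case False
  have "norm (zeta_term n s) \<le> norm (s - 1) * (2 * real (Suc n) powr (- Re s))"
    by (rule zeta_term_bounds) fact
  also have "real (Suc n) powr (- Re s) = real (Suc n) powr \<theta> * real (Suc n) powr (- Re s - \<theta>)"
    by (simp add: powr_add[symmetric])
  also have "real (Suc n) powr \<theta> \<le> norm s powr \<theta>"
    using False \<theta> by (intro powr_mono2) auto
  finally show ?thesis by (simp add: mult_left_mono mult_right_mono mult_ac)
qed

lemma norm_nat_powr: "norm (of_nat n powr s :: complex) = real n powr Re s"
  using norm_powr_real_powr[of "of_nat n :: complex" s] by (cases "n = 0") auto

text \<open>The choice \<theta> = 1/100 on \<open>Re s \<ge> 199/200\<close> gives the exponent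
  199/200 + 1/100 = 201/200, just above 1.\<close>

definition zeta_const :: real where
  "zeta_const = 2 * (\<Sum>n. real (Suc n) powr (-(201/200)))"

lemma summable_Suc_powr: "r < -1 \<Longrightarrow> summable (\<lambda>n. real (Suc n) powr r)"
  by (subst summable_Suc_iff) (simp add: summable_real_powr_iff)

lemma zeta_const_pos: "zeta_const > 0"
  unfolding zeta_const_def by (intro mult_pos_pos suminf_pos summable_Suc_powr) auto

lemma zeta_term_bound':
  assumes s: "Re s \<ge> 199/200"
  shows "norm (zeta_term n s) \<le> 2 * norm (s - 1) * norm s powr (1/100) * real (Suc n) powr (-(201/200))"
proof -
  have "norm (zeta_term n s) \<le> 2 * norm (s - 1) * norm s powr (1/100) * real (Suc n) powr (- Re s - 1/100)"
    by (rule zeta_term_bound) (use s in auto)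
  also have "\<dots> \<le> 2 * norm (s - 1) * norm s powr (1/100) * real (Suc n) powr (-(201/200))"
    using s by (intro mult_left_mono powr_mono) auto
  finally show ?thesis .
qed

lemma zeta_reg_bound:
  assumes s: "Re s \<ge> 199/200"
  shows "norm (zeta_reg s - 1) \<le> zeta_const * norm (s - 1) * norm s powr (1/100)"
proof -
  let ?h = "\<lambda>n. 2 * norm (s - 1) * norm s powr (1/100) * real (Suc n) powr (-(201/200))"
  have "norm (\<Sum>n. zeta_term n s) \<le> suminf ?h"
    by (intro norm_suminf_le zeta_term_bound' s summable_mult summable_Suc_powr) auto
  also have "\<dots> = zeta_const * norm (s - 1) * norm s powr (1/100)"
    unfolding zeta_const_def by (subst suminf_mult) (use summable_Suc_powr[of "-(201/200)"] in auto)
  finally show ?thesis by (simp add: zeta_reg_def)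
qed

lemma holomorphic_zeta_reg: "zeta_reg holomorphic_on {s. Re s > 199/200}"
proof (rule holomorphic_uniform_sequence[where f = "\<lambda>N s. 1 + (\<Sum>n<N. zeta_term n s)"])
  show "open {s. Re s > 199/200}" by (rule open_halfspace_Re_gt)
  fix N
  show "(\<lambda>s. 1 + (\<Sum>n<N. zeta_term n s)) holomorphic_on {s. Re s > 199/200}"
    unfolding zeta_term_def Let_def
    by (intro holomorphic_intros) (auto simp: complex_nonpos_Reals_iff)
next
  fix x assume "x \<in> {s. Re s > 199/200}"
  then obtain d where d: "d > 0" "cball x d \<subseteq> {s. Re s > 199/200}"
    using open_contains_cball open_halfspace_Re_gt by metis
  define B where "B = norm x + d + 1"
  have "uniform_limit (cball x d) (\<lambda>N s. \<Sum>n<N. zeta_term n s) (\<lambda>s. \<Sum>n. zeta_term n s) sequentially"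
  proof (rule Weierstrass_m_test)
    fix n s assume s: "s \<in> cball x d"
    have "norm s \<le> norm x + d"
      using s norm_triangle_ineq2[of s x] by (simp add: dist_norm norm_minus_commute)
    hence B: "norm s \<le> B" "norm (s - 1) \<le> B" using norm_triangle_ineq4[of s 1] by (auto simp: B_def)
    have "norm (zeta_term n s) \<le> 2 * norm (s - 1) * norm s powr (1/100) * real (Suc n) powr (-(201/200))"
      by (rule zeta_term_bound') (use s d in \<open>auto dest!: subsetD\<close>)
    also have "\<dots> \<le> 2 * B * B powr (1/100) * real (Suc n) powr (-(201/200))"
      using B by (intro mult_right_mono mult_mono powr_mono2) (auto intro: order_trans[OF norm_ge_zero])
    finally show "norm (zeta_term n s) \<le> 2 * B * B powr (1/100) * real (Suc n) powr (-(201/200))" .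
  qed (intro summable_mult summable_Suc_powr, simp)
  hence "uniform_limit (cball x d) (\<lambda>N s. 1 + (\<Sum>n<N. zeta_term n s)) zeta_reg sequentially"
    unfolding zeta_reg_def[abs_def] by (intro uniform_limit_intros)
  thus "\<exists>d>0. cball x d \<subseteq> {s. 199 / 200 < Re s} \<and>
           uniform_limit (cball x d) (\<lambda>N s. 1 + (\<Sum>n<N. zeta_term n s)) zeta_reg sequentially"
    using d by blast
qed

lemma summable_norm_Suc_powr:
  assumes "Re s > 1"
  shows "summable (\<lambda>n. norm (of_nat (Suc n) powr (-s) :: complex))"
  unfolding norm_nat_powr using assms by (intro summable_Suc_powr) auto

text \<open>To the right of 1 the power differences telescope to -1, which cancels the constant 1 in
  \<open>zeta_reg\<close> and leaves the Dirichlet series.\<close>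

lemma zeta_reg_eq:
  assumes s: "Re s > 1"
  shows "zeta_reg s = (s - 1) * (\<Sum>n. of_nat (Suc n) powr (-s))"
proof -
  have "(\<lambda>n. real n powr (- (Re s - 1))) \<longlonglongrightarrow> 0"
    using tendsto_neg_powr[OF _ filterlim_real_sequentially, of "-(Re s - 1)"] s by simp
  hence "(\<lambda>n. norm (of_nat n powr (1 - s) :: complex)) \<longlonglongrightarrow> 0"
    unfolding norm_nat_powr by simp
  hence "(\<lambda>n. of_nat (Suc n) powr (1 - s) :: complex) \<longlonglongrightarrow> 0"
    by (rule LIMSEQ_Suc[OF tendsto_norm_zero_cancel])
  from telescope_sums[OF this] have "(\<lambda>n. of_nat (Suc (Suc n)) powr (1 - s) - of_nat (Suc n) powr (1 - s) :: complex) sums (- 1)"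
    by simp
  moreover have "(\<lambda>n. (s - 1) * of_nat (Suc n) powr (-s)) sums ((s - 1) * (\<Sum>n. of_nat (Suc n) powr (-s)))"
    by (intro sums_mult summable_sums summable_norm_cancel[OF summable_norm_Suc_powr] s)
  ultimately have "(\<lambda>n. (s - 1) * of_nat (Suc n) powr (-s) + (of_nat (Suc (Suc n)) powr (1 - s) - of_nat (Suc n) powr (1 - s)))
     sums ((s - 1) * (\<Sum>n. of_nat (Suc n) powr (-s)) + - 1)"
    by (intro sums_add)
  also have "(\<lambda>n. (s - 1) * of_nat (Suc n) powr (-s) + (of_nat (Suc (Suc n)) powr (1 - s) - of_nat (Suc n) powr (1 - s))) = (\<lambda>n. zeta_term n s)"
    by (simp add: zeta_term_def Let_def fun_eq_iff add_ac)
  finally show ?thesis by (simp add: zeta_reg_def sums_iff)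
qed

section \<open>Dominated infinite products and local factors\<close>

text \<open>Once the common factors are taken out, the remaining block minus 1 expands into products
  of the numbers \<open>f k - 1\<close>, and replacing each by its majorant only increases the
  bound.\<close>

lemma norm_prod_diff_le:
  fixes f :: "nat \<Rightarrow> complex"
  assumes "m \<le> n" "\<And>k. norm (f k - 1) \<le> M k"
  shows "norm ((\<Prod>k<n. f k) - (\<Prod>k<m. f k)) \<le> (\<Prod>k<n. 1 + M k) - (\<Prod>k<m. 1 + M k)"
proof -
  have M0: "M k \<ge> 0" for k using assms(2)[of k] norm_ge_zero order_trans by blast
  have fM: "norm (f k) \<le> 1 + M k" for k
    using norm_triangle_ineq[of 1 "f k - 1"] assms(2)[of k] by simp
  have split: "(\<Prod>k<n. g k) = (\<Prod>k<m. g k) * (\<Prod>k=m..<n. g k)" for g :: "nat \<Rightarrow> 'a :: comm_monoid_mult"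
    using assms(1) by (metis lessThan_atLeast0 le0 prod.atLeastLessThan_concat)
  have "(\<Prod>k<n. f k) - (\<Prod>k<m. f k) = (\<Prod>k<m. f k) * ((\<Prod>k=m..<n. 1 + (f k - 1)) - 1)"
    by (subst split) (simp add: algebra_simps)
  also have "norm \<dots> \<le> (\<Prod>k<m. 1 + M k) * ((\<Prod>k=m..<n. 1 + norm (f k - 1)) - 1)"
    unfolding norm_mult prod_norm[symmetric]
    by (intro mult_mono prod_mono norm_prod_minus1_le_prod_minus1 conjI fM prod_nonneg)
       (auto simp: add_nonneg_nonneg M0)
  also have "\<dots> \<le> (\<Prod>k<m. 1 + M k) * ((\<Prod>k=m..<n. 1 + M k) - 1)"
    by (intro mult_left_mono diff_right_mono prod_mono prod_nonneg conjI add_left_mono assms(2))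
       (auto simp: add_nonneg_nonneg M0)
  also have "\<dots> = (\<Prod>k<n. 1 + M k) - (\<Prod>k<m. 1 + M k)"
    by (subst split) (simp add: algebra_simps)
  finally show ?thesis .
qed

text \<open>The Weierstrass test for products: the real product over \<open>1 + M k\<close>
  dominates all differences of partial products at once. The parameter type is arbitrary so that it
  can be a pair \<open>(z, s)\<close>, a single \<open>s\<close>, or a one-point type.\<close>

lemma prodinf_dominated:
  fixes f :: "'a \<Rightarrow> nat \<Rightarrow> complex"
  assumes M: "summable M" and fM: "\<And>x k. x \<in> X \<Longrightarrow> norm (f x k - 1) \<le> M k"
  shows "uniform_limit X (\<lambda>n x. \<Prod>k<n. f x k) (\<lambda>x. prodinf (f x)) sequentially"
    and "\<And>x. x \<in> X \<Longrightarrow> norm (prodinf (f x)) \<le> exp (suminf M)"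
proof -
  have conv: "abs_convergent_prod (f x)" if "x \<in> X" for x
    by (rule summable_imp_abs_convergent_prod, rule summable_comparison_test'[OF M, of 0])
       (use fM[OF that] in auto)
  have lim: "(\<lambda>n. \<Prod>k<n. f x k) \<longlonglongrightarrow> prodinf (f x)" if "x \<in> X" for x
    using abs_convergent_prod_imp_convergent_prod[OF conv[OF that]]
      convergent_prod_LIMSEQ LIMSEQ_lessThan_iff_atMost by blast
  have M0: "M k \<ge> 0" if "x \<in> X" for x k using fM[OF that, of k] norm_ge_zero order_trans by blast
  show *: "norm (prodinf (f x)) \<le> exp (suminf M)" if "x \<in> X" for x
  proof (rule Lim_bounded[where M = 0])
    show "(\<lambda>n. norm (\<Prod>k<n. f x k)) \<longlonglongrightarrow> norm (prodinf (f x))" by (intro tendsto_norm lim that)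
    show "\<forall>n\<ge>0. norm (\<Prod>k<n. f x k) \<le> exp (suminf M)"
    proof safe
      fix n :: nat
      have "norm (\<Prod>k<n. f x k) \<le> (\<Prod>k<n. 1 + M k)" unfolding prod_norm[symmetric]
      proof (rule prod_mono)
        fix k
        have "norm (f x k) \<le> 1 + norm (f x k - 1)" using norm_triangle_ineq[of 1 "f x k - 1"] by simp
        thus "0 \<le> norm (f x k) \<and> norm (f x k) \<le> 1 + M k" using fM[OF that, of k] by simp
      qed
      also have "\<dots> \<le> exp (\<Sum>k<n. M k)" by (rule prod_le_exp_sum) (use M0 that in auto)
      also have "\<dots> \<le> exp (suminf M)" using sum_le_suminf[OF M, of "{..<n}"] M0 that by auto
      finally show "norm (\<Prod>k<n. f x k) \<le> exp (suminf M)" .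
    qed
  qed
  show "uniform_limit X (\<lambda>n x. \<Prod>k<n. f x k) (\<lambda>x. prodinf (f x)) sequentially"
  proof (cases "X = {}")
    case False
    then obtain x0 where "x0 \<in> X" by auto
    note M0 = M0[OF this]
    define p where "p n = (\<Prod>k<n. 1 + M k)" for n
    have "abs_convergent_prod (\<lambda>k. 1 + M k)"
      by (rule summable_imp_abs_convergent_prod) (use M M0 in auto)
    hence p: "p \<longlonglongrightarrow> prodinf (\<lambda>k. 1 + M k)" unfolding p_def
      using abs_convergent_prod_imp_convergent_prod convergent_prod_LIMSEQ LIMSEQ_lessThan_iff_atMost by blast
    have bnd: "norm ((\<Prod>k<m. f x k) - prodinf (f x)) \<le> prodinf (\<lambda>k. 1 + M k) - p m" if x: "x \<in> X" for x m
    proof (rule tendsto_le[OF _ tendsto_diff[OF p tendsto_const[of "p m"]]])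
      show "(\<lambda>n. norm ((\<Prod>k<m. f x k) - (\<Prod>k<n. f x k))) \<longlonglongrightarrow> norm ((\<Prod>k<m. f x k) - prodinf (f x))"
        by (intro tendsto_intros lim x)
      show "\<forall>\<^sub>F n in sequentially. norm ((\<Prod>k<m. f x k) - (\<Prod>k<n. f x k)) \<le> p n - p m"
        using eventually_ge_at_top[of m]
      proof eventually_elim
        case (elim n)
        thus ?case using norm_prod_diff_le[OF elim fM[OF x]] by (simp add: p_def norm_minus_commute)
      qed
    qed auto
    show ?thesis
    proof (rule uniform_limitI)
      fix e :: real assume "e > 0"
      have "(\<lambda>m. prodinf (\<lambda>k. 1 + M k) - p m) \<longlonglongrightarrow> prodinf (\<lambda>k. 1 + M k) - prodinf (\<lambda>k. 1 + M k)"
        by (intro tendsto_intros p)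
      hence "eventually (\<lambda>m. prodinf (\<lambda>k. 1 + M k) - p m < e) sequentially"
        using \<open>e > 0\<close> by (intro order_tendstoD(2)) auto
      thus "\<forall>\<^sub>F n in sequentially. \<forall>x\<in>X. dist (\<Prod>k<n. f x k) (prodinf (f x)) < e"
      proof eventually_elim
        case (elim m)
        show ?case
        proof
          fix x assume "x \<in> X"
          from bnd[OF this, of m] elim show "dist (\<Prod>k<m. f x k) (prodinf (f x)) < e" by (simp add: dist_norm)
        qed
      qed
    qed
  qed (auto simp: uniform_limit_iff)
qed

text \<open>The summand at \<open>m = 0\<close> is \<open>1 / 0\<close>, which is 0, so the series
  effectively starts at 1.\<close>

lemma Ln_1_minus_sums:
  fixes w :: complex assumes "norm w < 1"
  shows "(\<lambda>m. w ^ m / of_nat m) sums (- Ln (1 - w))"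
  using sums_minus[OF Ln_series'[of "- w"]] assms by simp

text \<open>All coefficients of the series are nonnegative, so for a given modulus of
  \<open>w\<close> the largest value is on the positive axis.\<close>

lemma norm_Ln_1_minus_le:
  fixes w :: complex assumes "norm w < 1"
  shows "norm (Ln (1 - w)) \<le> - ln (1 - norm w)"
proof -
  have s: "(\<lambda>m. of_real (norm w) ^ m / of_nat m) sums (- Ln (1 - of_real (norm w) :: complex))"
    by (rule Ln_1_minus_sums) (use assms in simp)
  have eq: "Ln (1 - of_real (norm w) :: complex) = of_real (ln (1 - norm w))"
    using assms Ln_of_real[of "1 - norm w"] by simp
  have s': "(\<lambda>m. norm w ^ m / real m) sums (- ln (1 - norm w))"
    using sums_Re[OF s] unfolding eq by simp
  have "norm (- Ln (1 - w)) \<le> (\<Sum>m. norm w ^ m / real m)"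
    unfolding sums_unique[OF Ln_1_minus_sums[OF assms]]
    by (rule norm_suminf_le) (use s' in \<open>auto simp: norm_divide norm_power sums_iff\<close>)
  thus ?thesis using s' by (simp add: sums_iff)
qed

lemma norm_Ln_1_minus_diff_le:
  fixes w :: complex assumes "norm w \<le> 3/5"
  shows "norm (Ln (1 - w) + w) \<le> 5/2 * norm w ^ 2"
proof -
  have "norm (Ln (1 + - w) - (- w)) \<le> norm (- w) ^ 2 / (1 - norm (- w))"
    by (rule Ln_approx_linear) (use assms in auto)
  also have "\<dots> \<le> norm w ^ 2 / (2/5)"
    using assms by (intro frac_le) auto
  also have "\<dots> = 5/2 * norm w ^ 2" by simp
  finally show ?thesis by (simp add: add.commute)
qed

text \<open>For \<open>w = p powr (-s)\<close> the first factor sums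
  \<open>z ^ omega (p ^ k) * w ^ k\<close> over all \<open>k\<close>, and the exponential is
  \<open>1 - w\<close> to the power \<open>z\<close>: this is what remains of the local Dirichlet
  series once the local factor of zeta to the power \<open>z\<close> has been divided out.\<close>

definition local_factor :: "complex \<Rightarrow> complex \<Rightarrow> complex" where
  "local_factor z w = (1 + z * w / (1 - w)) * exp (z * Ln (1 - w))"

text \<open>The linear terms of the two factors are \<open>z * w\<close> and \<open>- z * w\<close>
  and cancel. The error is of second order, so the product over the primes converges beyond
  \<open>Re s = 1\<close>. The radius 3/5 lies just above \<open>2 powr (-3/4)\<close>, the largest
  modulus met for \<open>Re s \<ge> 3/4\<close>.\<close>

lemma local_factor_bound:
  assumes z: "norm z = 1" and w: "norm w \<le> 3/5"
  shows "norm (local_factor z w - 1) \<le> 200 * norm w ^ 2"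
proof -
  define L where "L = Ln (1 - w)"
  define R where "R = exp (z * L) - (1 + z * L)"
  define R1 where "R1 = z * (L + w) + R"
  define R2 where "R2 = z * w ^ 2 / (1 - w)"
  have w1: "w \<noteq> 1" using w by auto
  have w2: "norm w ^ 2 \<le> 3/5 * norm w" using mult_right_mono[OF w norm_ge_zero[of w]] by (simp add: power2_eq_square)
  have Lw: "norm (L + w) \<le> 5/2 * norm w ^ 2" unfolding L_def by (rule norm_Ln_1_minus_diff_le) fact
  have "norm L \<le> norm (L + w) + norm w" by (metis add_diff_cancel_right' norm_triangle_ineq4)
  hence L: "norm L \<le> 5/2 * norm w" using Lw w2 by simp
  have "norm (exp (z * L)) \<le> exp (norm (z * L))" by (rule norm_exp)
  also have "\<dots> \<le> exp 2" using L z w by (simp add: norm_mult)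
  also have "exp 2 = exp 1 * exp (1 :: real)" by (simp add: exp_add[symmetric])
  also have "\<dots> \<le> 3 * 3" by (intro mult_mono exp_le) auto
  finally have E: "norm (exp (z * L)) \<le> 9" by simp
  have "norm (exp (z * L) - (\<Sum>i\<le>1. (z * L) ^ i / fact i)) \<le> exp \<bar>Re (z * L)\<bar> * norm (z * L) ^ Suc 1 / fact 1"
    by (rule Taylor_exp)
  also have "(\<Sum>i\<le>1. (z * L) ^ i / fact i) = 1 + z * L" by simp
  also have "exp \<bar>Re (z * L)\<bar> * norm (z * L) ^ Suc 1 / fact 1 \<le> 9 * norm L ^ 2"
  proof -
    have "\<bar>Re (z * L)\<bar> \<le> norm (z * L)" by (rule abs_Re_le_cmod)
    also have "\<dots> \<le> 2" using L z w by (simp add: norm_mult)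
    finally have "exp \<bar>Re (z * L)\<bar> \<le> exp 2" by simp
    also have "exp 2 = exp 1 * exp (1 :: real)" by (simp add: exp_add[symmetric])
    also have "\<dots> \<le> 3 * 3" by (intro mult_mono exp_le) auto
    finally show ?thesis using z by (simp add: norm_mult power2_eq_square mult_right_mono)
  qed
  also have "9 * norm L ^ 2 \<le> 9 * (5/2 * norm w) ^ 2" using L by (intro mult_left_mono power_mono) auto
  also have "9 * (5/2 * norm w) ^ 2 \<le> 57 * norm w ^ 2" by (simp add: power_mult_distrib power2_eq_square)
  finally have R: "norm R \<le> 57 * norm w ^ 2" by (simp add: R_def)
  have "norm R1 \<le> norm (z * (L + w)) + norm R" unfolding R1_def by (rule norm_triangle_ineq)
  moreover have "norm (z * (L + w)) = norm (L + w)" using z by (simp add: norm_mult)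
  ultimately have R1: "norm R1 \<le> 60 * norm w ^ 2" using R Lw zero_le_power2[of "norm w"] by linarith
  have "norm (1 - w) \<ge> 2/5" using norm_triangle_ineq2[of 1 w] w by simp
  hence "norm w ^ 2 / norm (1 - w) \<le> norm w ^ 2 / (2/5)" by (intro frac_le) auto
  hence R2: "norm R2 \<le> 5/2 * norm w ^ 2" using z by (simp add: R2_def norm_mult norm_divide norm_power)
  have e1: "exp (z * L) = 1 - z * w + R1" by (simp add: R1_def R_def algebra_simps)
  have e2: "1 + z * w / (1 - w) = 1 + z * w + R2"
    using w1 by (simp add: R2_def field_simps power2_eq_square)
  have "local_factor z w - 1 = (1 + z * w) * exp (z * L) + R2 * exp (z * L) - 1"
    unfolding local_factor_def L_def[symmetric] e2 by (simp add: algebra_simps)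
  also have "(1 + z * w) * exp (z * L) = (1 + z * w) * (1 - z * w + R1)" by (simp only: e1)
  also have "(1 + z * w) * (1 - z * w + R1) + R2 * exp (z * L) - 1 = (1 + z * w) * R1 + R2 * exp (z * L) - (z * w) ^ 2"
    by (simp add: algebra_simps power2_eq_square)
  also have "norm \<dots> \<le> norm (1 + z * w) * norm R1 + norm R2 * norm (exp (z * L)) + norm w ^ 2"
    using norm_triangle_ineq4[of "(1 + z * w) * R1 + R2 * exp (z * L)" "(z * w) ^ 2"]
      norm_triangle_ineq[of "(1 + z * w) * R1" "R2 * exp (z * L)"] z
    by (simp add: norm_mult norm_power)
  also have "\<dots> \<le> 2 * (60 * norm w ^ 2) + 5/2 * norm w ^ 2 * 9 + norm w ^ 2"
  proof (intro add_mono mult_mono R1 R2 E)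
    show "norm (1 + z * w) \<le> 2" using norm_triangle_ineq[of 1 "z * w"] z w by (simp add: norm_mult)
  qed auto
  also have "\<dots> \<le> 200 * norm w ^ 2" by simp
  finally show ?thesis .
qed

section \<open>The Dirichlet series of the weights\<close>

abbreviation log_zeta_term :: "complex \<Rightarrow> nat \<Rightarrow> complex" where
  "log_zeta_term s n \<equiv> if prime n then - Ln (1 - of_nat n powr (-s)) else 0"

abbreviation euler_term :: "complex \<Rightarrow> complex \<Rightarrow> nat \<Rightarrow> complex" where
  "euler_term z s n \<equiv> if prime n then local_factor z (of_nat n powr (-s)) else 1"

text \<open>The logarithm of zeta on \<open>Re s > 1\<close> that is real on the real axis. The
  power of zeta with exponent \<open>z\<close> means \<open>exp (z * log_zeta s)\<close>, so
  continuing that power amounts to continuing this branch.\<close>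

definition log_zeta :: "complex \<Rightarrow> complex" where
  "log_zeta s = (\<Sum>n. log_zeta_term s n)"

definition euler_G :: "complex \<Rightarrow> complex \<Rightarrow> complex" where
  "euler_G z s = (\<Prod>n. euler_term z s n)"

definition omega_series :: "complex \<Rightarrow> complex \<Rightarrow> complex" where
  "omega_series z s = (\<Sum>n. z ^ omega (Suc n) * of_nat (Suc n) powr (-s))"

lemma omega_mult: "coprime m n \<Longrightarrow> m \<noteq> 0 \<Longrightarrow> n \<noteq> 0 \<Longrightarrow> omega (m * n) = omega m + omega n"
  unfolding omega_def
  by (subst prime_factors_product)
     (auto intro!: card_Un_disjoint simp: in_prime_factors_iff dest: coprime_common_divisor)

lemma omega_prime_power: "prime p \<Longrightarrow> k > 0 \<Longrightarrow> omega (p ^ k) = 1"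
  by (simp add: omega_def prime_factorization_prime_power)

lemma omega_1 [simp]: "omega (Suc 0) = 0" "omega 1 = 0"
  by (auto simp: omega_def)

lemma norm_prime_powr:
  assumes "prime p" "Re s \<ge> 3/4"
  shows "norm (of_nat p powr (-s) :: complex) \<le> 3/5"
proof -
  have "norm (of_nat p powr (-s) :: complex) = real p powr (- Re s)" by (simp add: norm_nat_powr)
  also have "\<dots> \<le> 2 powr (- Re s)" using prime_ge_2_nat[OF assms(1)] assms(2) by (intro powr_mono2') auto
  also have "\<dots> \<le> 2 powr (-3/4)" using assms(2) by (intro powr_mono) auto
  also have "\<dots> \<le> 3/5"
  proof -
    \<comment> \<open>Fourth powers reduce the claim to 1/8 \<le> 81/625.\<close>
    have "(2 powr (-3/4)) ^ 4 = (2 :: real) powr (-3)" by (simp add: powr_power)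
    also have "\<dots> \<le> (3/5) ^ 4" by (simp add: powr_minus power4_eq_xxxx)
    finally have "(2 powr (-3/4)) ^ Suc 3 \<le> (3/5 :: real) ^ Suc 3" by simp
    thus ?thesis by (rule power_le_imp_le_base) auto
  qed
  finally show ?thesis .
qed

lemma norm_local_factor_bound:
  assumes z: "norm z = 1" and s: "Re s \<ge> 3/4"
  shows "norm ((euler_term z s n) - 1) \<le> 200 * real n powr (-(3/2))"
proof (cases "prime n")
  case True
  have "norm (local_factor z (of_nat n powr (-s)) - 1) \<le> 200 * norm (of_nat n powr (-s) :: complex) ^ 2"
    by (intro local_factor_bound z norm_prime_powr True s)
  also have "norm (of_nat n powr (-s) :: complex) ^ 2 \<le> real n powr (-(3/2))"
  proof -
    have "norm (of_nat n powr (-s) :: complex) ^ 2 = real n powr (2 * (- Re s))"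
      using prime_gt_0_nat[OF True] by (simp add: norm_nat_powr powr_power mult.commute)
    also have "\<dots> \<le> real n powr (-(3/2))" using prime_ge_1_nat[OF True] s by (intro powr_mono) auto
    finally show ?thesis .
  qed
  finally show ?thesis using True by simp
qed auto

lemma summable_local_factor_bound: "summable (\<lambda>n. 200 * real n powr (-(3/2)))"
  by (intro summable_mult) (simp add: summable_real_powr_iff)

text \<open>Uniformity is joint in \<open>z\<close> and \<open>s\<close>: at \<open>s = 1\<close> it
  becomes the uniform convergence in \<open>u\<close> of the Euler product of the statement.\<close>

lemma uniform_limit_euler_G:
  "uniform_limit {(z, s). norm z = 1 \<and> Re s \<ge> 3/4}
     (\<lambda>N (z, s). \<Prod>n<N. euler_term z s n)
     (\<lambda>(z, s). euler_G z s) sequentially"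
proof -
  have "uniform_limit {(z, s). norm z = 1 \<and> Re s \<ge> 3/4}
     (\<lambda>N x. \<Prod>n<N. (\<lambda>(z, s) n. euler_term z s n) x n)
     (\<lambda>x. prodinf ((\<lambda>(z, s) n. euler_term z s n) x)) sequentially"
    by (rule prodinf_dominated(1)[OF summable_local_factor_bound]) (use norm_local_factor_bound in auto)
  thus ?thesis by (simp add: euler_G_def case_prod_unfold)
qed

definition euler_bound :: real where
  "euler_bound = exp (\<Sum>n. 200 * real n powr (-(3/2)))"

lemma norm_euler_G_le:
  assumes "norm z = 1" "Re s \<ge> 3/4"
  shows "norm (euler_G z s) \<le> euler_bound"
  unfolding euler_G_def euler_bound_def
  \<comment> \<open>A one-point parameter space turns the uniform statement into a bound for a
    single product.\<close>
  by (rule prodinf_dominated(2)[OF summable_local_factor_bound, where X = UNIV and x = "()" and f = "\<lambda>_. _"])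
     (use norm_local_factor_bound[OF assms] in auto)

lemma holomorphic_euler_G:
  assumes z: "norm z = 1"
  shows "euler_G z holomorphic_on {s. Re s > 3/4}"
proof (rule holomorphic_uniform_sequence)
  show "open {s. Re s > 3/4}" by (rule open_halfspace_Re_gt)
  fix N
  show "(\<lambda>s. \<Prod>n<N. euler_term z s n) holomorphic_on {s. Re s > 3/4}"
  proof (rule holomorphic_on_prod)
    fix n
    have "1 - complex_of_nat n powr (-s) \<notin> \<real>\<^sub>\<le>\<^sub>0" "complex_of_nat n powr (-s) \<noteq> 1" if "prime n" "Re s > 3/4" for s
    proof -
      have n: "norm (complex_of_nat n powr (-s)) \<le> 3/5" using norm_prime_powr that by simp
      show "complex_of_nat n powr (-s) \<noteq> 1" using n by auto
      have "Re (complex_of_nat n powr (-s)) \<le> norm (complex_of_nat n powr (-s))" by (rule complex_Re_le_cmod)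
      thus "1 - complex_of_nat n powr (-s) \<notin> \<real>\<^sub>\<le>\<^sub>0" using n by (auto simp: complex_nonpos_Reals_iff)
    qed
    thus "(\<lambda>s. euler_term z s n) holomorphic_on {s. Re s > 3/4}"
      unfolding local_factor_def by (cases "prime n") (auto intro!: holomorphic_intros simp: prime_gt_0_nat)
  qed
next
  fix x assume "x \<in> {s. Re s > 3/4}"
  then obtain d where d: "d > 0" "cball x d \<subseteq> {s. Re s > 3/4}"
    using open_contains_cball open_halfspace_Re_gt by metis
  have "uniform_limit (cball x d) (\<lambda>N s. \<Prod>n<N. euler_term z s n)
     (\<lambda>s. prodinf (\<lambda>n. euler_term z s n)) sequentially"
  proof (rule prodinf_dominated(1)[OF summable_local_factor_bound])
    fix y k assume "y \<in> cball x d"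
    hence "Re y \<ge> 3/4" using d by auto
    thus "norm ((euler_term z y k) - 1) \<le> 200 * real k powr (-(3/2))"
      by (rule norm_local_factor_bound[OF z])
  qed
  thus "\<exists>d>0. cball x d \<subseteq> {s. 3/4 < Re s} \<and>
           uniform_limit (cball x d) (\<lambda>N s. \<Prod>n<N. euler_term z s n) (euler_G z) sequentially"
    unfolding euler_G_def[abs_def] using d by blast
qed

lemma log_zeta_term_bound:
  assumes s: "Re s \<ge> \<sigma>" "\<sigma> \<ge> 1"
  shows "norm (log_zeta_term s n) \<le> 5/2 * real n powr (-\<sigma>)"
proof (cases "prime n")
  case True
  let ?w = "of_nat n powr (-s) :: complex"
  have w: "norm ?w \<le> 3/5" using norm_prime_powr True s by simp
  have "norm (Ln (1 - ?w)) \<le> norm (Ln (1 - ?w) + ?w) + norm ?w" by (metis add_diff_cancel_right' norm_triangle_ineq4)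
  also have "norm (Ln (1 - ?w) + ?w) \<le> 5/2 * norm ?w ^ 2" by (rule norm_Ln_1_minus_diff_le[OF w])
  also have "norm ?w ^ 2 \<le> 3/5 * norm ?w" using mult_right_mono[OF w norm_ge_zero[of ?w]] by (simp add: power2_eq_square)
  finally have "norm (Ln (1 - ?w)) \<le> 5/2 * norm ?w" by simp
  also have "norm ?w \<le> real n powr (-\<sigma>)" unfolding norm_nat_powr
    using prime_ge_1_nat[OF True] s by (intro powr_mono) auto
  finally show ?thesis using True by simp
qed auto

lemma summable_log_zeta:
  assumes "Re s > 1"
  shows "summable (\<lambda>n. norm (log_zeta_term s n))"
  by (rule summable_comparison_test'[where g = "\<lambda>n. 5/2 * real n powr (- Re s)" and N = 0])
     (use assms log_zeta_term_bound[of "Re s" s] in \<open>auto simp: summable_real_powr_iff intro!: summable_mult\<close>)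

lemma summable_omega_series:
  assumes "norm z = 1" "Re s > 1"
  shows "summable (\<lambda>n. norm (z ^ omega (Suc n) * of_nat (Suc n) powr (-s)))"
  using summable_norm_Suc_powr[OF assms(2)] assms(1) by (simp add: norm_mult norm_power)

text \<open>The partial Euler products of the Dirichlet series split into those of
  \<open>euler_G\<close> times the exponential of a partial sum of \<open>log_zeta\<close>, and each
  of the two pieces converges by itself.\<close>

theorem omega_series_eq:
  assumes z: "norm z = 1" and s: "Re s > 1"
  shows "omega_series z s = exp (z * log_zeta s) * euler_G z s"
proof -
  define a where "a n = z ^ omega n * of_nat n powr (-s)" for n
  define w where "w n = (of_nat n powr (-s) :: complex)" for n
  have "a (m * n) = a m * a n" if "coprime m n" for m n
  proof (cases "m = 0 \<or> n = 0")
    case False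
    have "(of_nat (m * n) powr (-s) :: complex) = of_nat m powr (-s) * of_nat n powr (-s)"
      using powr_times_real[of "of_nat m" "of_nat n :: complex" "-s"] by simp
    thus ?thesis using False that by (simp add: a_def omega_mult power_add)
  qed (auto simp: a_def)
  hence lim: "(\<lambda>N. \<Prod>p\<in>{p. prime p \<and> p \<le> N}. \<Sum>k. a (p ^ k)) \<longlonglongrightarrow> (\<Sum>n. a (Suc n))"
    using summable_omega_series[OF z s] by (intro euler_product) (auto simp: a_def)
  have w1: "norm (w p) < 1" if "prime p" for p unfolding w_def using norm_prime_powr[OF that, of s] s by simp
  have loc: "(\<Sum>k. a (p ^ k)) = local_factor z (w p) * exp (z * - Ln (1 - w p))" if p: "prime p" for p
  proof -
    have wk: "of_nat (p ^ k) powr (-s) = w p ^ k" for k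
    proof (induction k)
      case (Suc k)
      thus ?case using powr_times_real[of "of_nat p" "of_nat (p ^ k) :: complex" "-s"] by (simp add: w_def)
    qed auto
    have "(\<lambda>k. w p ^ k) sums (1 / (1 - w p))" by (rule geometric_sums) (use w1 p in auto)
    \<comment> \<open>For \<open>k > 0\<close> the coefficient is \<open>z\<close>, so the local
      series is \<open>z\<close> times the geometric series, with the coefficient at
      \<open>k = 0\<close> corrected from \<open>z\<close> to 1.\<close>
    hence "(\<lambda>k. z * w p ^ k + (if k = 0 then 1 - z else 0)) sums (z * (1 / (1 - w p)) + (1 - z))"
      by (intro sums_add sums_mult) (use sums_single[of 0 "\<lambda>_. 1 - z"] in auto)
    also have "(\<lambda>k. z * w p ^ k + (if k = 0 then 1 - z else 0)) = (\<lambda>k. a (p ^ k))"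
    proof
      fix k show "z * w p ^ k + (if k = 0 then 1 - z else 0) = a (p ^ k)"
        using wk[of k] omega_prime_power[OF p, of k] by (cases "k = 0") (auto simp: a_def)
    qed
    also have "z * (1 / (1 - w p)) + (1 - z) = 1 + z * w p / (1 - w p)"
    proof -
      have "w p \<noteq> 1" using w1[OF p] by auto
      thus ?thesis by (simp add: field_simps)
    qed
    finally show ?thesis by (simp add: local_factor_def sums_iff exp_minus)
  qed
  have part: "(\<Prod>p\<in>{p. prime p \<and> p \<le> N}. \<Sum>k. a (p ^ k)) =
     (\<Prod>n<Suc N. if prime n then local_factor z (w n) else 1) * exp (z * (\<Sum>n<Suc N. if prime n then - Ln (1 - w n) else 0))" for N
  proof -
    have "(\<Prod>p\<in>{p. prime p \<and> p \<le> N}. \<Sum>k. a (p ^ k)) =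
      (\<Prod>p\<in>{p. prime p \<and> p \<le> N}. (if prime p then local_factor z (w p) else 1) * exp (if prime p then z * - Ln (1 - w p) else 0))"
      by (intro prod.cong) (auto simp: loc)
    also have "\<dots> = (\<Prod>p<Suc N. (if prime p then local_factor z (w p) else 1) * exp (if prime p then z * - Ln (1 - w p) else 0))"
      by (intro prod.mono_neutral_left) auto
    also have "\<dots> = (\<Prod>p<Suc N. if prime p then local_factor z (w p) else 1) * exp (\<Sum>n<Suc N. if prime n then z * - Ln (1 - w n) else 0)"
      unfolding prod.distrib by (simp only: exp_sum finite_lessThan)
    also have "(\<Sum>n<Suc N. if prime n then z * - Ln (1 - w n) else 0) = z * (\<Sum>n<Suc N. if prime n then - Ln (1 - w n) else 0)"
      unfolding sum_distrib_left by (intro sum.cong) auto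
    finally show ?thesis .
  qed
  have l1: "(\<lambda>N. \<Prod>n<Suc N. if prime n then local_factor z (w n) else 1) \<longlonglongrightarrow> euler_G z s"
    unfolding w_def
    by (rule LIMSEQ_Suc) (use tendsto_uniform_limitI[OF uniform_limit_euler_G, of "(z, s)"] z s in simp)
  have l2: "(\<lambda>N. \<Sum>n<Suc N. if prime n then - Ln (1 - w n) else 0) \<longlonglongrightarrow> log_zeta s"
    unfolding log_zeta_def w_def
    by (rule LIMSEQ_Suc) (rule summable_LIMSEQ[OF summable_norm_cancel[OF summable_log_zeta[OF s]]])
  have "(\<lambda>N. (\<Prod>n<Suc N. if prime n then local_factor z (w n) else 1) * exp (z * (\<Sum>n<Suc N. if prime n then - Ln (1 - w n) else 0)))
    \<longlonglongrightarrow> euler_G z s * exp (z * log_zeta s)"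
    by (intro tendsto_intros l1 l2)
  from LIMSEQ_unique[OF lim[unfolded part] this] show ?thesis
    by (simp only: omega_series_def a_def mult.commute[of "euler_G z s"])
qed

text \<open>The case \<open>z = 1\<close> of the factorization, in which all weights and all local
  factors are 1.\<close>

lemma exp_log_zeta:
  assumes s: "Re s > 1"
  shows "exp (log_zeta s) = (\<Sum>n. of_nat (Suc n) powr (-s))"
proof -
  have "local_factor 1 (of_nat n powr (-s)) = 1" if "prime n" for n
  proof -
    have "complex_of_nat n powr (-s) \<noteq> 1" using norm_prime_powr[OF that, of s] s by auto
    thus ?thesis by (simp add: local_factor_def field_simps)
  qed
  hence "euler_G 1 s = (\<Prod>n. 1)" unfolding euler_G_def by (intro arg_cong[where f = prodinf]) auto
  thus ?thesis using omega_series_eq[of 1 s] s by (simp add: omega_series_def)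
qed

lemma zeta_reg_log_zeta: "Re s > 1 \<Longrightarrow> zeta_reg s = (s - 1) * exp (log_zeta s)"
  by (simp add: exp_log_zeta zeta_reg_eq)

section \<open>Bounds for the zeta function near the line Re s = 1\<close>

text \<open>At \<open>s = 1\<close> the quotient is 0 by the convention for division by zero; the
  statements below stay away from that point.\<close>

definition zeta :: "complex \<Rightarrow> complex" where "zeta s = zeta_reg s / (s - 1)"

lemma zeta_eq_exp: "Re s > 1 \<Longrightarrow> zeta s = exp (log_zeta s)"
  by (auto simp: zeta_def zeta_reg_log_zeta)

lemma holomorphic_zeta: "zeta holomorphic_on {s. Re s > 199/200} - {1}"
  unfolding zeta_def[abs_def]
  by (intro holomorphic_intros holomorphic_on_subset[OF holomorphic_zeta_reg]) auto

text \<open>Separates modulus and phase: in the 3-4-1 inequality the modulus \<open>r\<close> is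
  common to the three points, and the phases are 1, \<open>u\<close> and
  \<open>u ^ 2\<close>.\<close>

lemma prime_powr_split:
  assumes "prime p"
  defines "r \<equiv> \<lambda>s. real p powr (- Re s)" and "u \<equiv> \<lambda>s. of_nat p powr (- \<i> * of_real (Im s)) :: complex"
  shows "of_nat p powr (-s) = of_real (r s) * u s" "norm (u s) = 1" "0 \<le> r s" "Re s \<ge> 1 \<Longrightarrow> r s < 1"
proof -
  have p: "p > 1" using prime_gt_1_nat assms by simp
  have "complex_of_nat p powr (-s) = of_nat p powr (of_real (- Re s) + (- \<i> * of_real (Im s)))"
    by (rule arg_cong[where f = "\<lambda>x. _ powr x"]) (simp add: complex_eq_iff)
  also have "\<dots> = of_nat p powr of_real (- Re s) * u s" unfolding powr_add u_def by simp
  also have "of_nat p powr of_real (- Re s) = complex_of_real (r s)"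
    unfolding r_def using powr_of_real[of "real p" "- Re s"] by simp
  finally show "of_nat p powr (-s) = of_real (r s) * u s" .
  show "norm (u s) = 1" using p by (simp add: u_def norm_nat_powr)
  show "0 \<le> r s" by (simp add: r_def)
  assume "Re s \<ge> 1"
  hence "r s \<le> real p powr (-1)" unfolding r_def using p by (intro powr_mono) auto
  also have "\<dots> < 1" using p by (simp add: powr_minus field_simps)
  finally show "r s < 1" .
qed

lemma Re_log_zeta_sums:
  assumes "Re s > 1"
  shows "(\<lambda>n. Re (log_zeta_term s n)) sums Re (log_zeta s)"
  unfolding log_zeta_def
  by (intro sums_Re summable_sums summable_norm_cancel[OF summable_log_zeta] assms)

text \<open>The full modulus is bounded, not only the real part, because for complex
  \<open>z\<close> the imaginary part of \<open>log_zeta s\<close> also enters the modulus of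
  \<open>exp (z * log_zeta s)\<close>. It holds termwise, since the logarithm of each Euler factor
  has a power series with nonnegative coefficients.\<close>

lemma norm_log_zeta_le:
  assumes s: "Re s > 1"
  shows "norm (log_zeta s) \<le> Re (log_zeta (of_real (Re s)))"
proof -
  let ?\<sigma> = "complex_of_real (Re s)"
  have "norm (log_zeta s) \<le> (\<Sum>n. Re (log_zeta_term ?\<sigma> n))"
    unfolding log_zeta_def
  proof (rule norm_suminf_le)
    show "summable (\<lambda>n. Re (log_zeta_term ?\<sigma> n))"
      using Re_log_zeta_sums[of ?\<sigma>] s by (simp add: sums_iff)
    fix n
    show "norm (log_zeta_term s n) \<le> Re (log_zeta_term ?\<sigma> n)"
    proof (cases "prime n")
      case True
      define r where "r = real n powr (- Re s)"
      have r: "0 \<le> r" "r < 1" using prime_powr_split(3,4)[OF True, of s] s by (auto simp: r_def)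
      have w: "norm (of_nat n powr (-s) :: complex) = r" by (simp add: norm_nat_powr r_def)
      have "of_nat n powr (-?\<sigma>) = of_real r"
        using prime_powr_split(1)[OF True, of ?\<sigma>] prime_gt_0_nat[OF True] by (simp add: r_def)
      moreover have "Ln (1 - of_real r) = of_real (ln (1 - r))" using Ln_of_real[of "1 - r"] r by simp
      ultimately show ?thesis using norm_Ln_1_minus_le[of "of_nat n powr (-s)"] w r True by simp
    qed auto
  qed
  also have "\<dots> = Re (log_zeta ?\<sigma>)" using Re_log_zeta_sums[of ?\<sigma>] s by (simp add: sums_iff)
  finally show ?thesis .
qed

text \<open>Termwise in the power series of the logarithm: for \<open>v\<close> on the unit circle,
  \<open>3 + 4 * Re v + Re (v ^ 2)\<close> equals \<open>2 * (1 + Re v) ^ 2\<close>.\<close>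

lemma three_four_one_Ln:
  fixes u :: complex
  assumes u: "norm u = 1" and r: "0 \<le> r" "r < 1"
  shows "0 \<le> 3 * Re (- Ln (1 - of_real r)) + 4 * Re (- Ln (1 - of_real r * u)) + Re (- Ln (1 - of_real r * u ^ 2))"
proof -
  have S: "(\<lambda>m. Re ((of_real r * v) ^ m / of_nat m)) sums Re (- Ln (1 - of_real r * v))" if "norm v = 1" for v
    by (intro sums_Re Ln_1_minus_sums) (use that r in \<open>simp add: norm_mult\<close>)
  have A: "(\<lambda>m. 3 * Re ((of_real r * 1) ^ m / of_nat m) + 4 * Re ((of_real r * u) ^ m / of_nat m) + Re ((of_real r * u ^ 2) ^ m / of_nat m))
    sums (3 * Re (- Ln (1 - of_real r * 1)) + 4 * Re (- Ln (1 - of_real r * u)) + Re (- Ln (1 - of_real r * u ^ 2)))"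
    by (intro sums_add sums_mult S) (use u in \<open>auto simp: norm_power\<close>)
  have B: "0 \<le> 3 * Re ((of_real r * 1) ^ m / of_nat m) + 4 * Re ((of_real r * u) ^ m / of_nat m) + Re ((of_real r * u ^ 2) ^ m / of_nat m)" for m
  proof -
    have *: "Re ((of_real r * v) ^ m / of_nat m) = r ^ m / real m * Re (v ^ m)" for v
    proof -
      have "(of_real r * v) ^ m / of_nat m = of_real (r ^ m / real m) * v ^ m" by (simp add: power_mult_distrib)
      moreover have "Re (of_real c * x) = c * Re x" for c x by simp
      ultimately show ?thesis by (simp only:)
    qed
    define v where "v = u ^ m"
    have "norm v = 1" using u by (simp add: v_def norm_power)
    hence "Re v ^ 2 + Im v ^ 2 = 1" by (metis cmod_power2 one_power2)
    moreover have "(u\<^sup>2) ^ m = v ^ 2" by (simp add: v_def power_mult[symmetric] mult.commute)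
    moreover have "Re (v ^ 2) = Re v ^ 2 - Im v ^ 2" by (simp add: power2_eq_square)
    ultimately have "3 + 4 * Re v + Re ((u\<^sup>2) ^ m) = 2 * (1 + Re v) ^ 2"
      by (simp add: power2_eq_square algebra_simps)
    hence "0 \<le> r ^ m / real m * (3 + 4 * Re v + Re ((u\<^sup>2) ^ m))" using r by simp
    thus ?thesis unfolding * by (simp add: v_def algebra_simps)
  qed
  from sums_le[OF B sums_zero A] show ?thesis by simp
qed

lemma three_four_one:
  assumes \<sigma>: "\<sigma> > 1"
  shows "1 \<le> norm (zeta (of_real \<sigma>)) ^ 3 * norm (zeta (Complex \<sigma> t)) ^ 4 * norm (zeta (Complex \<sigma> (2 * t)))"
proof -
  have "0 \<le> 3 * Re (log_zeta (of_real \<sigma>)) + 4 * Re (log_zeta (Complex \<sigma> t)) + Re (log_zeta (Complex \<sigma> (2 * t)))"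
  proof (rule sums_le[OF _ sums_zero])
    let ?h = "\<lambda>s n. Re (log_zeta_term s n)"
    show "(\<lambda>n. 3 * ?h (of_real \<sigma>) n + 4 * ?h (Complex \<sigma> t) n + ?h (Complex \<sigma> (2 * t)) n) sums
       (3 * Re (log_zeta (of_real \<sigma>)) + 4 * Re (log_zeta (Complex \<sigma> t)) + Re (log_zeta (Complex \<sigma> (2 * t))))"
      by (intro sums_add sums_mult Re_log_zeta_sums) (use \<sigma> in auto)
    fix n
    show "0 \<le> 3 * ?h (of_real \<sigma>) n + 4 * ?h (Complex \<sigma> t) n + ?h (Complex \<sigma> (2 * t)) n"
    proof (cases "prime n")
      case True
      define r where "r = real n powr (- \<sigma>)"
      define u where "u = (of_nat n powr (- \<i> * of_real t) :: complex)"
      have r: "0 \<le> r" "r < 1" using prime_powr_split(3,4)[OF True, of "of_real \<sigma>"] \<sigma> by (auto simp: r_def)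
      have u: "norm u = 1" using prime_powr_split(2)[OF True, of "Complex \<sigma> t"] by (simp add: u_def)
      have 1: "of_nat n powr (- complex_of_real \<sigma>) = of_real r"
        using prime_powr_split(1)[OF True, of "of_real \<sigma>"] prime_gt_0_nat[OF True] by (simp add: r_def)
      have 2: "of_nat n powr (- Complex \<sigma> t) = of_real r * u"
        using prime_powr_split(1)[OF True, of "Complex \<sigma> t"] by (simp add: r_def u_def)
      have "u ^ 2 = of_nat n powr (- \<i> * of_real t + - \<i> * of_real t)"
        unfolding powr_add u_def by (simp add: power2_eq_square)
      also have "- \<i> * of_real t + - \<i> * of_real t = - \<i> * complex_of_real (2 * t)"
        by (simp add: complex_eq_iff)
      finally have u2: "u ^ 2 = of_nat n powr (- \<i> * complex_of_real (2 * t))" .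
      have 3: "of_nat n powr (- Complex \<sigma> (2 * t)) = of_real r * u ^ 2"
        unfolding u2 using prime_powr_split(1)[OF True, of "Complex \<sigma> (2 * t)"] by (simp only: r_def complex.sel)
      show ?thesis using True three_four_one_Ln[OF u r] by (simp add: 1 2 3)
    qed auto
  qed
  hence "1 \<le> exp (3 * Re (log_zeta (of_real \<sigma>)) + 4 * Re (log_zeta (Complex \<sigma> t)) + Re (log_zeta (Complex \<sigma> (2 * t))))"
    by simp
  also have "\<dots> = norm (zeta (of_real \<sigma>)) ^ 3 * norm (zeta (Complex \<sigma> t)) ^ 4 * norm (zeta (Complex \<sigma> (2 * t)))"
    using \<sigma> by (simp add: zeta_eq_exp exp_add exp_of_nat_mult[of 3, simplified] exp_of_nat_mult[of 4, simplified])
  finally show ?thesis .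
qed

section \<open>Upper bounds for zeta and its derivative\<close>

lemma zeta_real_upper:
  "\<exists>A>0. \<forall>\<sigma>. 1 < \<sigma> \<and> \<sigma> \<le> 3 \<longrightarrow> norm (zeta (of_real \<sigma>)) \<le> A / (\<sigma> - 1)"
proof (intro exI[of _ "1 + zeta_const * 2 * 3 powr (1/100)"] conjI allI impI)
  show "0 < 1 + zeta_const * 2 * 3 powr (1 / 100)" using zeta_const_pos by (intro add_pos_pos) auto
  fix \<sigma> :: real assume \<sigma>: "1 < \<sigma> \<and> \<sigma> \<le> 3"
  have "norm (zeta_reg (of_real \<sigma>) - 1) \<le> zeta_const * norm (of_real \<sigma> - 1 :: complex) * norm (of_real \<sigma> :: complex) powr (1/100)"
    by (rule zeta_reg_bound) (use \<sigma> in auto)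
  also have "norm (of_real \<sigma> - 1 :: complex) = \<sigma> - 1"
    using \<sigma> norm_of_real[of "\<sigma> - 1", where ?'a = complex] by simp
  also have "zeta_const * (\<sigma> - 1) * norm (of_real \<sigma> :: complex) powr (1/100) \<le> zeta_const * 2 * 3 powr (1/100)"
    using \<sigma> zeta_const_pos by (intro mult_mono powr_mono2) auto
  finally have "norm (zeta_reg (of_real \<sigma>)) \<le> 1 + zeta_const * 2 * 3 powr (1/100)"
    using norm_triangle_ineq2[of "zeta_reg (of_real \<sigma>)" 1] by simp
  moreover have "norm (of_real \<sigma> - 1 :: complex) = \<sigma> - 1"
    using \<sigma> norm_of_real[of "\<sigma> - 1", where ?'a = complex] by simp
  ultimately show "norm (zeta (of_real \<sigma>)) \<le> (1 + zeta_const * 2 * 3 powr (1/100)) / (\<sigma> - 1)"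
    using \<sigma> by (simp add: zeta_def norm_divide divide_right_mono)
qed

text \<open>The quantity \<open>im_height t ^ 400 = \<bar>t\<bar> + 5\<close> keeps all exponents below integral.\<close>

definition im_height :: "real \<Rightarrow> real" where "im_height t = (\<bar>t\<bar> + 5) powr (1/400)"

lemma im_height_ge_1: "im_height t \<ge> 1"
  unfolding im_height_def by (intro ge_one_powr_ge_zero) auto

lemma im_height_power: "im_height t ^ n = (\<bar>t\<bar> + 5) powr (real n / 400)"
  by (simp add: im_height_def powr_power)

lemma im_height_le:
  assumes "\<bar>t\<bar> + 5 \<le> 2 * (\<bar>t'\<bar> + 5)"
  shows "im_height t \<le> 2 * im_height t'"
proof -
  have "im_height t \<le> (2 * (\<bar>t'\<bar> + 5)) powr (1/400)"
    unfolding im_height_def using assms by (intro powr_mono2) auto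
  also have "\<dots> = 2 powr (1/400) * im_height t'" unfolding im_height_def by (rule powr_mult)
  also have "\<dots> \<le> 2 powr 1 * im_height t'" using im_height_ge_1[of t'] by (intro mult_right_mono powr_mono) auto
  finally show ?thesis by simp
qed

text \<open>The exponent 1/100 of \<open>zeta_reg_bound\<close> is 4/400, and the 5 in
  \<open>im_height\<close> absorbs \<open>Re s \<le> 4\<close>. The distance \<tau> from the real
  axis keeps \<open>s\<close> off the pole.\<close>

lemma zeta_upper:
  assumes \<tau>: "\<tau> > 0"
  shows "\<exists>C>0. \<forall>s. 199/200 \<le> Re s \<and> Re s \<le> 4 \<and> \<bar>Im s\<bar> \<ge> \<tau> \<longrightarrow> norm (zeta s) \<le> C * im_height (Im s) ^ 4"
proof (intro exI[of _ "1 / \<tau> + zeta_const"] conjI allI impI)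
  show "0 < 1 / \<tau> + zeta_const" using zeta_const_pos \<tau> by (intro add_pos_pos) auto
  fix s assume s: "199/200 \<le> Re s \<and> Re s \<le> 4 \<and> \<bar>Im s\<bar> \<ge> \<tau>"
  have im: "norm (s - 1) \<ge> \<tau>" using s abs_Im_le_cmod[of "s - 1"] by simp
  hence s1: "norm (s - 1) > 0" using \<tau> by linarith
  have "norm (zeta_reg s) \<le> 1 + norm (zeta_reg s - 1)" using norm_triangle_ineq2[of "zeta_reg s" 1] by simp
  also have "\<dots> \<le> 1 + zeta_const * norm (s - 1) * norm s powr (1/100)"
    using zeta_reg_bound s by auto
  finally have "norm (zeta s) \<le> (1 + zeta_const * norm (s - 1) * norm s powr (1/100)) / norm (s - 1)"
    unfolding zeta_def norm_divide by (intro divide_right_mono) auto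
  also have "\<dots> = 1 / norm (s - 1) + zeta_const * norm s powr (1/100)"
    using s1 by (simp add: field_simps)
  also have "\<dots> \<le> 1 / \<tau> * im_height (Im s) ^ 4 + zeta_const * im_height (Im s) ^ 4"
  proof (intro add_mono mult_left_mono)
    have "1 / norm (s - 1) \<le> 1 / \<tau> * 1" using im \<tau> by (simp add: frac_le)
    also have "\<dots> \<le> 1 / \<tau> * im_height (Im s) ^ 4" using \<tau> im_height_ge_1 by (intro mult_left_mono one_le_power) auto
    finally show "1 / norm (s - 1) \<le> 1 / \<tau> * im_height (Im s) ^ 4" .
    have "norm s \<le> \<bar>Re s\<bar> + \<bar>Im s\<bar>" by (rule cmod_le)
    thus "norm s powr (1/100) \<le> im_height (Im s) ^ 4"
      unfolding im_height_power using s by (intro powr_mono2 | simp)+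
  qed (use zeta_const_pos in auto)
  finally show "norm (zeta s) \<le> (1 / \<tau> + zeta_const) * im_height (Im s) ^ 4" by (simp add: algebra_simps)
qed

lemma zeta_deriv_upper:
  assumes \<tau>: "\<tau> > 0"
  shows "\<exists>C>0. \<forall>s. 399/400 \<le> Re s \<and> Re s \<le> 3 \<and> \<bar>Im s\<bar> \<ge> \<tau> \<longrightarrow> norm (deriv zeta s) \<le> C * im_height (Im s) ^ 4"
proof -
  obtain C where C: "C > 0" "\<And>s. 199/200 \<le> Re s \<Longrightarrow> Re s \<le> 4 \<Longrightarrow> \<bar>Im s\<bar> \<ge> \<tau>/2 \<Longrightarrow> norm (zeta s) \<le> C * im_height (Im s) ^ 4"
    using zeta_upper[of "\<tau>/2"] \<tau> by auto
  \<comment> \<open>Discs of radius at most 1/800 about points with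
    \<open>Re s \<ge> 399/400\<close> stay in the half plane of \<open>zeta_upper\<close>, and
    \<tau>/2 keeps them off the real axis.\<close>
  define \<rho> where "\<rho> = min (1/800) (\<tau>/2)"
  have \<rho>: "\<rho> > 0" "\<rho> \<le> 1/800" "\<rho> \<le> \<tau>/2" using \<tau> by (auto simp: \<rho>_def)
  show ?thesis
  proof (intro exI[of _ "16 * C / \<rho>"] conjI allI impI)
    show "16 * C / \<rho> > 0" using C \<rho> by simp
    fix s assume s: "399/400 \<le> Re s \<and> Re s \<le> 3 \<and> \<bar>Im s\<bar> \<ge> \<tau>"
    have near: "199/200 < Re w" "Re w \<le> 4" "\<bar>Im w\<bar> \<ge> \<tau>/2" "im_height (Im w) \<le> 2 * im_height (Im s)" if "w \<in> cball s \<rho>" for w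
    proof -
      have "\<bar>Re (w - s)\<bar> \<le> \<rho>" "\<bar>Im (w - s)\<bar> \<le> \<rho>"
        using that abs_Re_le_cmod[of "w - s"] abs_Im_le_cmod[of "w - s"] by (auto simp: dist_norm norm_minus_commute)
      hence *: "\<bar>Re w - Re s\<bar> \<le> \<rho>" "\<bar>Im w - Im s\<bar> \<le> \<rho>" by auto
      show "199/200 < Re w" "Re w \<le> 4" "\<bar>Im w\<bar> \<ge> \<tau>/2" using * s \<rho> by linarith+
      have "\<bar>Im w\<bar> \<le> \<bar>Im s\<bar> + \<rho>" using *(2) by linarith
      hence "\<bar>Im w\<bar> + 5 \<le> 2 * (\<bar>Im s\<bar> + 5)" using \<rho>(2) abs_ge_zero[of "Im s"] by argo
      thus "im_height (Im w) \<le> 2 * im_height (Im s)" by (rule im_height_le)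
    qed
    have "cball s \<rho> \<subseteq> {s. Re s > 199/200} - {1}"
    proof
      fix w assume "w \<in> cball s \<rho>"
      from near(1,3)[OF this] \<tau> show "w \<in> {s. Re s > 199/200} - {1}" by auto
    qed
    hence hol: "zeta holomorphic_on cball s \<rho>" using holomorphic_zeta holomorphic_on_subset by blast
    have "norm ((deriv ^^ 1) zeta s) \<le> fact 1 * (C * (2 * im_height (Im s)) ^ 4) / \<rho> ^ 1"
    proof (rule Cauchy_inequality)
      show "zeta holomorphic_on ball s \<rho>" using hol holomorphic_on_subset ball_subset_cball by blast
      show "continuous_on (cball s \<rho>) zeta" using hol by (rule holomorphic_on_imp_continuous_on)
      fix w assume "norm (s - w) = \<rho>"
      hence w: "w \<in> cball s \<rho>" by (simp add: dist_norm)
      have "norm (zeta w) \<le> C * im_height (Im w) ^ 4" using C(2) near[OF w] by simp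
      also have "\<dots> \<le> C * (2 * im_height (Im s)) ^ 4"
        using near(4)[OF w] C im_height_ge_1[of "Im w"] by (intro mult_left_mono power_mono) auto
      finally show "norm (zeta w) \<le> C * (2 * im_height (Im s)) ^ 4" .
    qed (use \<rho> in auto)
    thus "norm (deriv zeta s) \<le> 16 * C / \<rho> * im_height (Im s) ^ 4"
      by (simp add: power_mult_distrib mult_ac)
  qed
qed

text \<open>The 3-4-1 inequality solved for its middle factor; doubling the height at most doubles
  \<open>im_height\<close>. Fourth powers are kept and the constant is written \<open>b ^ 4\<close>,
  so that the root is taken only once, in \<open>zeta_lower\<close>.\<close>

lemma zeta_lower_right:
  assumes \<tau>: "\<tau> > 0"
  shows "\<exists>b>0. \<forall>s. 1 < Re s \<and> Re s \<le> 3 \<and> \<bar>Im s\<bar> \<ge> \<tau> \<longrightarrow>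
           b ^ 4 * (Re s - 1) ^ 3 / im_height (Im s) ^ 4 \<le> norm (zeta s) ^ 4"
proof -
  obtain A where A: "A > 0" "\<And>\<sigma>. 1 < \<sigma> \<Longrightarrow> \<sigma> \<le> 3 \<Longrightarrow> norm (zeta (of_real \<sigma>)) \<le> A / (\<sigma> - 1)"
    using zeta_real_upper by auto
  obtain C where C: "C > 0" "\<And>s. 199/200 \<le> Re s \<Longrightarrow> Re s \<le> 4 \<Longrightarrow> \<bar>Im s\<bar> \<ge> \<tau> \<Longrightarrow> norm (zeta s) \<le> C * im_height (Im s) ^ 4"
    using zeta_upper[OF \<tau>] by auto
  define b where "b = (1 / (A ^ 3 * (C * 16))) powr (1/4)"
  have b: "b > 0" using A C by (simp add: b_def)
  have b4: "b ^ 4 = 1 / (A ^ 3 * (C * 16))" using A C by (simp add: b_def powr_power)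
  show ?thesis
  proof (intro exI[of _ b] conjI allI impI b)
    fix s assume s: "1 < Re s \<and> Re s \<le> 3 \<and> \<bar>Im s\<bar> \<ge> \<tau>"
    let ?y = "im_height (Im s)"
    have y: "?y \<ge> 1" by (rule im_height_ge_1)
    have "norm (zeta (Complex (Re s) (2 * Im s))) \<le> C * im_height (2 * Im s) ^ 4"
      using C(2)[of "Complex (Re s) (2 * Im s)"] s by auto
    also have "im_height (2 * Im s) \<le> 2 * ?y" by (rule im_height_le) auto
    hence "C * im_height (2 * Im s) ^ 4 \<le> C * (2 * ?y) ^ 4"
      using C im_height_ge_1[of "2 * Im s"] by (intro mult_left_mono power_mono) auto
    finally have 2: "norm (zeta (Complex (Re s) (2 * Im s))) \<le> C * 16 * ?y ^ 4" by (simp add: power_mult_distrib)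
    have "1 \<le> norm (zeta (of_real (Re s))) ^ 3 * norm (zeta s) ^ 4 * norm (zeta (Complex (Re s) (2 * Im s)))"
      using three_four_one[of "Re s" "Im s"] s by simp
    also have "\<dots> \<le> (A / (Re s - 1)) ^ 3 * norm (zeta s) ^ 4 * (C * 16 * ?y ^ 4)"
      using s A by (intro mult_mono power_mono 2) auto
    finally have "1 \<le> (A / (Re s - 1)) ^ 3 * norm (zeta s) ^ 4 * (C * 16 * ?y ^ 4)" .
    moreover have "(A / (Re s - 1)) ^ 3 * norm (zeta s) ^ 4 * (C * 16 * ?y ^ 4) =
       norm (zeta s) ^ 4 * ((A ^ 3 * (C * 16)) * ?y ^ 4 / (Re s - 1) ^ 3)"
      by (simp add: power_divide)
    ultimately have "1 / ((A ^ 3 * (C * 16)) * ?y ^ 4 / (Re s - 1) ^ 3) \<le> norm (zeta s) ^ 4"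
      using A C y s by (subst pos_divide_le_eq) auto
    thus "b ^ 4 * (Re s - 1) ^ 3 / ?y ^ 4 \<le> norm (zeta s) ^ 4" by (simp add: b4)
  qed
qed

text \<open>On \<open>Re s = 1 + \<kappa>\<close> the 3-4-1 bound has order
  \<open>\<kappa> powr (3/4) / y\<close>, and moving left by at most \<open>2 * \<kappa>\<close>
  changes zeta by order \<open>y ^ 4 * \<kappa>\<close>. The two balance at \<kappa> of order
  \<open>y powr (-20)\<close>, where both have order \<open>y powr (-16)\<close>; a small constant
  then lets the first one win.\<close>

lemma zeta_lower:
  assumes \<tau>: "\<tau> > 0"
  shows "\<exists>d>0. \<exists>c>0. d \<le> 1/400 \<and> (\<forall>s. 1 - d / im_height (Im s) ^ 20 \<le> Re s \<and> Re s \<le> 2 \<and> \<bar>Im s\<bar> \<ge> \<tau> \<longrightarrow>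
           c / im_height (Im s) ^ 16 \<le> norm (zeta s))"
proof -
  obtain b where b: "b > 0" "\<And>s. 1 < Re s \<Longrightarrow> Re s \<le> 3 \<Longrightarrow> \<bar>Im s\<bar> \<ge> \<tau> \<Longrightarrow>
           b ^ 4 * (Re s - 1) ^ 3 / im_height (Im s) ^ 4 \<le> norm (zeta s) ^ 4"
    using zeta_lower_right[OF \<tau>] by auto
  obtain C where C: "C > 0" "\<And>s. 399/400 \<le> Re s \<Longrightarrow> Re s \<le> 3 \<Longrightarrow> \<bar>Im s\<bar> \<ge> \<tau> \<Longrightarrow> norm (deriv zeta s) \<le> C * im_height (Im s) ^ 4"
    using zeta_deriv_upper[OF \<tau>] by auto
  \<comment> \<open>The condition \<open>4 * C * d \<le> b\<close> makes the variation of zeta at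
    most half of the bound on the right. The witness is \<open>d ^ 4\<close>, whose third power has
    the exact fourth root \<open>d ^ 3\<close>.\<close>
  define d where "d = min (b / (4 * C)) (1/400)"
  have d: "d > 0" "d \<le> 1/400" "4 * C * d \<le> b"
    using b C by (auto simp: d_def min_def field_simps)
  have d4: "d ^ 4 \<le> 1/400" "d ^ 4 > 0"
  proof -
    have "d ^ 4 \<le> d ^ 1" using d by (intro power_decreasing) auto
    thus "d ^ 4 \<le> 1/400" using d by simp
  qed (use d in auto)
  define c where "c = b * d ^ 3 / 2"
  have c: "c > 0" using b d by (simp add: c_def)
  show ?thesis
  proof (rule exI[of _ "d ^ 4"], intro conjI exI[of _ c] allI impI c d4)
    fix s assume s: "1 - d ^ 4 / im_height (Im s) ^ 20 \<le> Re s \<and> Re s \<le> 2 \<and> \<bar>Im s\<bar> \<ge> \<tau>"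
    define y where "y = im_height (Im s)"
    have y: "y \<ge> 1" by (simp add: y_def im_height_ge_1)
    define \<kappa> where "\<kappa> = d ^ 4 / y ^ 20"
    have \<kappa>: "\<kappa> > 0" "\<kappa> \<le> 1/400"
    proof -
      show "\<kappa> > 0" using d y by (simp add: \<kappa>_def)
      have "\<kappa> \<le> d ^ 4 / 1" unfolding \<kappa>_def using y d by (intro divide_left_mono one_le_power) auto
      thus "\<kappa> \<le> 1/400" using d4 by simp
    qed
    have right: "2 * c / y ^ 16 \<le> norm (zeta w)" if w: "Re w \<ge> 1 + \<kappa>" "Re w \<le> 3" "Im w = Im s" for w
    proof (rule power_le_imp_le_base[of _ 3])
      have "(2 * c / y ^ 16) ^ Suc 3 = b ^ 4 * \<kappa> ^ 3 / y ^ 4"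
        using y by (simp add: c_def \<kappa>_def power_divide power_mult_distrib power_mult[symmetric] power_add[symmetric] del: power_Suc)
      also have "\<dots> \<le> b ^ 4 * (Re w - 1) ^ 3 / y ^ 4"
        using w y b \<kappa> by (intro divide_right_mono mult_left_mono power_mono) auto
      also have "\<dots> \<le> norm (zeta w) ^ 4" using b(2)[of w] w \<kappa> s by (simp add: y_def)
      finally show "(2 * c / y ^ 16) ^ Suc 3 \<le> norm (zeta w) ^ Suc 3" by simp
    qed simp
    have "c / y ^ 16 \<le> norm (zeta s)"
    proof (cases "Re s \<ge> 1 + \<kappa>")
      case True
      have "c / y ^ 16 \<le> 2 * c / y ^ 16" using c y by (intro divide_right_mono) auto
      also have "\<dots> \<le> norm (zeta s)" by (rule right) (use True s in auto)
      finally show ?thesis .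
    next
      case False
      define w where "w = Complex (1 + \<kappa>) (Im s)"
      have ws: "w - s = of_real (1 + \<kappa> - Re s)" by (simp add: w_def complex_eq_iff)
      have dist: "norm (w - s) \<le> 2 * \<kappa>" unfolding ws norm_of_real using False s by (auto simp: \<kappa>_def y_def)
      have lo: "1 - \<kappa> \<le> Re s" using s by (simp add: \<kappa>_def y_def)
      have seg: "Im x = Im s \<and> 399/400 \<le> Re x \<and> Re x \<le> 3" if x: "x \<in> closed_segment s w" for x
      proof -
        from x obtain u where u: "x = s + u *\<^sub>R (w - s)" "0 \<le> u" "u \<le> 1"
          unfolding closed_segment_def by (auto simp: algebra_simps)
        have Re: "Re x = Re s + u * (1 + \<kappa> - Re s)" and "Im x = Im s" using u by (auto simp: w_def)
        moreover have "0 \<le> u * (1 + \<kappa> - Re s)" using u False by simp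
        moreover have "u * (1 + \<kappa> - Re s) \<le> 1 * (1 + \<kappa> - Re s)" using u False by (intro mult_right_mono) auto
        ultimately show ?thesis using lo \<kappa> by auto
      qed
      have "norm (zeta s - zeta w) \<le> (C * y ^ 4) * norm (s - w)"
      proof (rule field_differentiable_bound[where f' = "deriv zeta" and S = "closed_segment s w"])
        fix x assume x: "x \<in> closed_segment s w"
        have "x \<in> {s. Re s > 199/200} - {1}" using seg[OF x] s \<tau> by auto
        moreover have "open ({s. Re s > 199/200} - {1 :: complex})"
          by (intro open_Diff open_halfspace_Re_gt) auto
        ultimately have "zeta field_differentiable at x"
          using holomorphic_zeta holomorphic_on_imp_differentiable_at by blast
        thus "(zeta has_field_derivative deriv zeta x) (at x within closed_segment s w)"
          by (metis DERIV_deriv_iff_field_differentiable has_field_derivative_at_within)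
        show "norm (deriv zeta x) \<le> C * y ^ 4" using C(2)[of x] seg[OF x] s by (simp add: y_def)
      qed auto
      also have "\<dots> \<le> C * y ^ 4 * (2 * \<kappa>)"
        using dist C y by (intro mult_left_mono) (auto simp: norm_minus_commute)
      also have "\<dots> = (4 * C * d) * d ^ 3 / 2 * (y ^ 4 / y ^ 20)"
        by (simp add: \<kappa>_def power4_eq_xxxx power3_eq_cube)
      also have "\<dots> \<le> b * d ^ 3 / 2 * (y ^ 4 / y ^ 20)"
        using d y by (intro mult_right_mono divide_right_mono) auto
      also have "y ^ 4 / y ^ 20 = 1 / y ^ 16" using y by (simp add: power_diff[symmetric] field_simps power_add[symmetric])
      finally have "norm (zeta s - zeta w) \<le> c / y ^ 16" by (simp add: c_def)
      moreover have "2 * c / y ^ 16 \<le> norm (zeta w)" by (rule right) (use \<kappa> in \<open>auto simp: w_def\<close>)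
      moreover have "norm (zeta w) \<le> norm (zeta s) + norm (zeta s - zeta w)"
        by (metis norm_minus_commute norm_triangle_sub)
      ultimately show ?thesis by linarith
    qed
    thus "c / im_height (Im s) ^ 16 \<le> norm (zeta s)" by (simp add: y_def)
  qed
qed

text \<open>The same \<open>c\<close> scales the radius and, inverted, the bound for the logarithmic
  derivative, so that a logarithm of zeta varies by at most 1 over the disc. The power 20 is 16 from
  the lower bound plus 4 from the derivative.\<close>

lemma zeta_log_deriv_disc:
  assumes \<tau>: "\<tau> > 0"
  shows "\<exists>c>0. c \<le> 1/400 \<and> (\<forall>s w. 1 < Re s \<and> Re s \<le> 3/2 \<and> \<bar>Im s\<bar> \<ge> \<tau> \<and> w \<in> cball s (c / im_height (Im s) ^ 20) \<longrightarrow>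
           Re w > 399/400 \<and> w \<noteq> 1 \<and> zeta w \<noteq> 0 \<and> norm (deriv zeta w / zeta w) \<le> im_height (Im s) ^ 20 / c)"
proof -
  obtain d c where dc: "d > 0" "c > 0" "d \<le> 1/400"
    and lower: "\<And>s. 1 - d / im_height (Im s) ^ 20 \<le> Re s \<Longrightarrow> Re s \<le> 2 \<Longrightarrow> \<bar>Im s\<bar> \<ge> \<tau>/2 \<Longrightarrow>
           c / im_height (Im s) ^ 16 \<le> norm (zeta s)"
    using zeta_lower[of "\<tau>/2"] \<tau> by auto
  obtain C where C: "C > 0" "\<And>s. 399/400 \<le> Re s \<Longrightarrow> Re s \<le> 3 \<Longrightarrow> \<bar>Im s\<bar> \<ge> \<tau>/2 \<Longrightarrow> norm (deriv zeta s) \<le> C * im_height (Im s) ^ 4"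
    using zeta_deriv_upper[of "\<tau>/2"] \<tau> by auto
  \<comment> \<open>On the disc \<open>im_height\<close> is at most twice its value at the centre,
    so 20th powers lose at most \<open>2 ^ 20\<close>; the entries \<tau>/2 and 1/800 keep the disc
    where the bounds for zeta apply.\<close>
  define e where "e = Min {d / 2 ^ 21, \<tau> / 2, c / (C * 2 ^ 20), 1/800}"
  have e: "e > 0" "e \<le> d / 2 ^ 21" "e \<le> \<tau> / 2" "e \<le> c / (C * 2 ^ 20)" "e \<le> 1/800"
    using dc C \<tau> by (auto simp: e_def)
  show ?thesis
  proof (rule exI[of _ e], intro conjI allI impI)
    fix s w assume A: "1 < Re s \<and> Re s \<le> 3/2 \<and> \<bar>Im s\<bar> \<ge> \<tau> \<and> w \<in> cball s (e / im_height (Im s) ^ 20)"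
    define y where "y = im_height (Im s)"
    define v where "v = im_height (Im w)"
    have y: "y \<ge> 1" "v \<ge> 1" by (auto simp: y_def v_def im_height_ge_1)
    have ey: "e / y ^ 20 \<le> e" using divide_left_mono[of 1 "y ^ 20" e] y e by simp
    have "\<bar>Re (w - s)\<bar> \<le> e / y ^ 20" "\<bar>Im (w - s)\<bar> \<le> e / y ^ 20"
      using A abs_Re_le_cmod[of "w - s"] abs_Im_le_cmod[of "w - s"] by (auto simp: dist_norm norm_minus_commute y_def)
    hence *: "\<bar>Re w - Re s\<bar> \<le> e / y ^ 20" "\<bar>Im w - Im s\<bar> \<le> e / y ^ 20" by auto
    have im: "\<bar>Im w\<bar> \<ge> \<tau>/2" using *(2) ey e A by linarith
    have "\<bar>Im w\<bar> \<le> \<bar>Im s\<bar> + e" using *(2) ey by linarith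
    hence "\<bar>Im w\<bar> + 5 \<le> 2 * (\<bar>Im s\<bar> + 5)" using e abs_ge_zero[of "Im s"] by argo
    hence vy: "v \<le> 2 * y" unfolding v_def y_def by (rule im_height_le)
    hence v20: "v ^ 20 \<le> 2 ^ 20 * y ^ 20" using y power_mono[of v "2 * y" 20] by (simp add: power_mult_distrib)
    have "e / y ^ 20 \<le> (d / 2 ^ 20) / y ^ 20" using e dc y by (intro divide_right_mono) auto
    also have "\<dots> = d / (2 ^ 20 * y ^ 20)" by simp
    also have "\<dots> \<le> d / v ^ 20" using v20 y dc by (intro divide_left_mono) auto
    finally have "1 - d / v ^ 20 \<le> Re w" using *(1) A by linarith
    moreover have "Re w \<le> 2" using *(1) ey e A by linarith
    ultimately have low: "c / v ^ 16 \<le> norm (zeta w)" using lower[of w] im unfolding v_def by auto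
    moreover have "c / v ^ 16 > 0" using dc y by simp
    ultimately show nz: "zeta w \<noteq> 0" by auto
    show "w \<noteq> 1" using im \<tau> by auto
    show "Re w > 399/400" using *(1) ey e A by linarith
    have "norm (deriv zeta w) \<le> C * v ^ 4" unfolding v_def by (rule C(2)) (use *(1) ey e A im in linarith)+
    hence "norm (deriv zeta w / zeta w) \<le> C * v ^ 4 / (c / v ^ 16)"
      unfolding norm_divide using low dc y C by (intro frac_le) auto
    also have "\<dots> = (C / c) * v ^ 20" by (simp add: power_add[symmetric])
    also have "\<dots> \<le> (C / c) * (2 ^ 20 * y ^ 20)" using C dc v20 by (intro mult_left_mono) auto
    also have "\<dots> = (C * 2 ^ 20 / c) * y ^ 20" by simp
    also have "\<dots> \<le> (1 / e) * y ^ 20"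
      using e C dc y by (intro mult_right_mono) (auto simp: field_simps)
    finally show "norm (deriv zeta w / zeta w) \<le> im_height (Im s) ^ 20 / e" by (simp add: y_def)
  qed (use e in auto)
qed

section \<open>The Dirichlet series away from s = 1\<close>

lemma holomorphic_log_zeta: "log_zeta holomorphic_on {s. Re s > 1}"
proof (rule holomorphic_uniform_sequence)
  show "open {s. Re s > 1}" by (rule open_halfspace_Re_gt)
  fix N
  show "(\<lambda>s. \<Sum>n<N. log_zeta_term s n) holomorphic_on {s. Re s > 1}"
  proof (rule holomorphic_on_sum)
    fix n
    have "1 - complex_of_nat n powr (-s) \<notin> \<real>\<^sub>\<le>\<^sub>0" if "prime n" "Re s > 1" for s
    proof -
      have "Re (complex_of_nat n powr (-s)) \<le> norm (complex_of_nat n powr (-s))" by (rule complex_Re_le_cmod)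
      also have "\<dots> \<le> 3/5" using norm_prime_powr that by simp
      finally show ?thesis by (auto simp: complex_nonpos_Reals_iff)
    qed
    thus "(\<lambda>s. log_zeta_term s n) holomorphic_on {s. Re s > 1}"
      by (cases "prime n") (auto intro!: holomorphic_intros simp: prime_gt_0_nat)
  qed
next
  fix x :: complex assume x: "x \<in> {s. Re s > 1}"
  define d where "d = (Re x - 1) / 2"
  have near: "Re y \<ge> 1 + d" if "y \<in> cball x d" for y
    using that abs_Re_le_cmod[of "x - y"] by (simp add: dist_norm d_def field_simps)
  have d: "d > 0" using x by (simp add: d_def)
  have "uniform_limit (cball x d) (\<lambda>N s. \<Sum>n<N. log_zeta_term s n) log_zeta sequentially"
    unfolding log_zeta_def[abs_def]
  proof (rule Weierstrass_m_test)
    fix n y assume "y \<in> cball x d"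
    from near[OF this] d show "norm (log_zeta_term y n) \<le> 5/2 * real n powr (-(1 + d))"
      by (intro log_zeta_term_bound) auto
  next
    show "summable (\<lambda>n. 5/2 * real n powr (-(1 + d)))"
      using d by (intro summable_mult) (simp add: summable_real_powr_iff)
  qed
  moreover have "cball x d \<subseteq> {s. Re s > 1}"
  proof
    fix y assume "y \<in> cball x d"
    from near[OF this] d show "y \<in> {s. Re s > 1}" by simp
  qed
  ultimately show "\<exists>d>0. cball x d \<subseteq> {s. 1 < Re s} \<and>
     uniform_limit (cball x d) (\<lambda>N s. \<Sum>n<N. log_zeta_term s n) log_zeta sequentially"
    using d by blast
qed

text \<open>Two continuous logarithms of the same function differ by a continuous function whose
  values are multiples of \<open>2 * pi * \<i>\<close>; distinct values are at least
  \<open>2 * pi\<close> apart, so on a connected set the difference is constant.\<close>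

lemma exp_eq_imp_eq_on_connected:
  fixes g h :: "complex \<Rightarrow> complex"
  assumes S: "connected S" and g: "continuous_on S g" and h: "continuous_on S h"
    and exp: "\<And>w. w \<in> S \<Longrightarrow> exp (g w) = exp (h w)"
    and a: "a \<in> S" "g a = h a" and w: "w \<in> S"
  shows "g w = h w"
proof -
  define f where "f w = g w - h w" for w
  have ef: "exp (f w) = 1" if "w \<in> S" for w using exp[OF that] by (simp add: f_def exp_diff)
  have "f constant_on S"
  proof (rule continuous_discrete_range_constant[OF S])
    show "continuous_on S f" unfolding f_def by (intro continuous_intros g h)
    fix x assume x: "x \<in> S"
    have "2 * pi \<le> norm (f y - f x)" if y: "y \<in> S" "f y \<noteq> f x" for y
    proof -
      have "exp (f y - f x) = 1" using ef x y by (simp add: exp_diff)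
      then obtain n :: int where n: "Re (f y - f x) = 0" "Im (f y - f x) = of_int (2 * n) * pi"
        unfolding exp_eq_1 by blast
      have "n \<noteq> 0" using n y(2) by (auto simp: complex_eq_iff)
      hence "1 \<le> \<bar>real_of_int n\<bar>" by linarith
      hence "2 * pi * 1 \<le> 2 * pi * \<bar>real_of_int n\<bar>" by (intro mult_left_mono) auto
      also have "\<dots> = \<bar>Im (f y - f x)\<bar>" unfolding n(2) by (simp add: abs_mult)
      also have "\<dots> \<le> norm (f y - f x)" by (rule abs_Im_le_cmod)
      finally show ?thesis by simp
    qed
    thus "\<exists>e>0. \<forall>y. y \<in> S \<and> f y \<noteq> f x \<longrightarrow> e \<le> norm (f y - f x)"
      by (intro exI[of _ "2 * pi"]) auto
  qed
  hence "f w = f a" using a w unfolding constant_on_def by metis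
  thus ?thesis using a by (simp add: f_def)
qed

definition omega_transform :: "complex \<Rightarrow> complex \<Rightarrow> complex" where
  "omega_transform z s = omega_series z s / s"

lemma omega_transform_eq:
  assumes "norm z = 1" "Re s > 1"
  shows "omega_transform z s = exp (z * log_zeta s) * euler_G z s / s"
  using omega_series_eq[OF assms] by (simp add: omega_transform_def)

lemma holomorphic_omega_transform:
  assumes "norm z = 1"
  shows "omega_transform z holomorphic_on {s. Re s > 1}"
proof -
  have "(\<lambda>s. exp (z * log_zeta s) * euler_G z s / s) holomorphic_on {s. Re s > 1}"
    by (intro holomorphic_intros holomorphic_log_zeta holomorphic_on_subset[OF holomorphic_euler_G[OF assms]]) auto
  thus ?thesis by (rule holomorphic_transform) (use omega_transform_eq[OF assms] in auto)
qed

text \<open>At height at least \<tau>, \<open>log_zeta\<close> continues across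
  \<open>Re s = 1\<close> to the zero-free disc and varies there by at most 1. Hence the modulus of
  the power of zeta is at most \<open>exp 1\<close> times zeta at the real point
  \<open>Re s\<close>, and this is the source of \<open>1 / (Re s - 1)\<close>. Cauchy's estimate
  for 20 derivatives with a radius of order \<open>y powr (-20)\<close> costs
  \<open>y ^ 400\<close>, which is \<open>\<bar>Im s\<bar> + 5\<close>.\<close>

lemma omega_transform_deriv_tail:
  assumes \<tau>: "\<tau> > 0"
  shows "\<exists>K>0. \<forall>z s. norm z = 1 \<and> 1 < Re s \<and> Re s \<le> 3/2 \<and> \<bar>Im s\<bar> \<ge> \<tau> \<longrightarrow>
           norm ((deriv ^^ 20) (omega_transform z) s) \<le> K * (\<bar>Im s\<bar> + 5) / (Re s - 1)"
proof -
  obtain c where c: "c > 0" "c \<le> 1/400" and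
    disc: "\<And>s w. 1 < Re s \<Longrightarrow> Re s \<le> 3/2 \<Longrightarrow> \<bar>Im s\<bar> \<ge> \<tau> \<Longrightarrow> w \<in> cball s (c / im_height (Im s) ^ 20) \<Longrightarrow>
           Re w > 399/400 \<and> w \<noteq> 1 \<and> zeta w \<noteq> 0 \<and> norm (deriv zeta w / zeta w) \<le> im_height (Im s) ^ 20 / c"
    using zeta_log_deriv_disc[OF \<tau>] by blast
  obtain A where A: "A > 0" "\<And>\<sigma>. 1 < \<sigma> \<Longrightarrow> \<sigma> \<le> 3 \<Longrightarrow> norm (zeta (of_real \<sigma>)) \<le> A / (\<sigma> - 1)"
    using zeta_real_upper by auto
  define K where "K = fact 20 * (exp 1 * A * euler_bound * 2) * (2 / c) ^ 20"
  have E0: "euler_bound > 0" by (simp add: euler_bound_def)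
  show ?thesis
  proof (rule exI[of _ K], intro conjI allI impI)
    show "K > 0" unfolding K_def using A c E0 by simp
    fix z s :: complex assume zs: "norm z = 1 \<and> 1 < Re s \<and> Re s \<le> 3/2 \<and> \<bar>Im s\<bar> \<ge> \<tau>"
    hence z: "norm z = 1" and s: "1 < Re s" "Re s \<le> 3/2" "\<bar>Im s\<bar> \<ge> \<tau>" by auto
    define y where "y = im_height (Im s)"
    have y: "y \<ge> 1" by (simp add: y_def im_height_ge_1)
    define r where "r = c / y ^ 20"
    have r: "r > 0" using c y by (simp add: r_def)
    note disc = disc[OF s, folded y_def, folded r_def]
    have sub: "ball s r \<subseteq> {s. Re s > 199/200} - {1}"
    proof
      fix w assume "w \<in> ball s r"
      hence "w \<in> cball s r" by simp
      from disc[OF this] show "w \<in> {s. Re s > 199/200} - {1}" by auto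
    qed
    have hz: "zeta holomorphic_on ball s r" by (rule holomorphic_on_subset[OF holomorphic_zeta sub])
    obtain g0 where g0: "g0 holomorphic_on ball s r" "\<And>w. w \<in> ball s r \<Longrightarrow> zeta w = exp (g0 w)"
      by (rule contractible_imp_holomorphic_log[OF hz convex_imp_contractible[OF convex_ball]])
         (use disc in auto)
    \<comment> \<open>Normalized to agree with \<open>log_zeta\<close> at the centre: with another
      branch the power of zeta would be off by a constant factor.\<close>
    define g where "g w = g0 w - g0 s + log_zeta s" for w
    have g: "g holomorphic_on ball s r" unfolding g_def by (intro holomorphic_intros g0)
    have eg: "exp (g w) = zeta w" if "w \<in> ball s r" for w
    proof -
      have "exp (g w) = exp (g0 w) / exp (g0 s) * exp (log_zeta s)" by (simp add: g_def exp_diff exp_add)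
      also have "\<dots> = zeta w / zeta s * zeta s"
        using g0(2)[OF that] g0(2)[of s] r zeta_eq_exp[of s] s by simp
      also have "\<dots> = zeta w" using disc[of s] r by simp
      finally show ?thesis .
    qed
    have gl: "g w = log_zeta w" if w: "w \<in> ball s r \<inter> {s. Re s > 1}" for w
    proof (rule exp_eq_imp_eq_on_connected[where S = "ball s r \<inter> {s. Re s > 1}" and a = s and g = g and h = log_zeta and w = w])
      show "connected (ball s r \<inter> {s. Re s > 1})"
        by (intro convex_connected convex_Int convex_ball convex_halfspace_Re_gt)
      show "continuous_on (ball s r \<inter> {s. Re s > 1}) g"
        by (rule continuous_on_subset[OF holomorphic_on_imp_continuous_on[OF g]]) auto
      show "continuous_on (ball s r \<inter> {s. Re s > 1}) log_zeta"
        by (rule continuous_on_subset[OF holomorphic_on_imp_continuous_on[OF holomorphic_log_zeta]]) auto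
      show "exp (g w) = exp (log_zeta w)" if "w \<in> ball s r \<inter> {s. Re s > 1}" for w
        using eg[of w] zeta_eq_exp[of w] that by simp
    qed (use w r s in \<open>auto simp: g_def\<close>)
    have g': "(g has_field_derivative (deriv zeta w / zeta w)) (at w)" if w: "w \<in> ball s r" for w
    proof -
      have "(g has_field_derivative deriv g w) (at w)"
        using g w by (simp add: holomorphic_derivI)
      moreover from this have "((\<lambda>w. exp (g w)) has_field_derivative (exp (g w) * deriv g w)) (at w)"
        by (auto intro!: derivative_eq_intros)
      moreover have "((\<lambda>w. exp (g w)) has_field_derivative deriv zeta w) (at w)"
      proof (rule has_field_derivative_transform_within_open[OF _ open_ball w])
        show "(zeta has_field_derivative deriv zeta w) (at w)" using hz w by (simp add: holomorphic_derivI)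
      qed (use eg in auto)
      ultimately have "exp (g w) * deriv g w = deriv zeta w" using DERIV_unique by blast
      hence "deriv g w = deriv zeta w / zeta w" using eg[OF w] by (metis exp_not_eq_zero nonzero_mult_div_cancel_left)
      with \<open>(g has_field_derivative deriv g w) (at w)\<close> show ?thesis by simp
    qed
    have gb: "norm (g w - g s) \<le> 1" if w: "w \<in> ball s r" for w
    proof -
      have "norm (g w - g s) \<le> (1 / r) * norm (w - s)"
      proof (rule field_differentiable_bound[OF convex_ball])
        fix x assume x: "x \<in> ball s r"
        show "(g has_field_derivative (deriv zeta x / zeta x)) (at x within ball s r)"
          using g'[OF x] by (rule has_field_derivative_at_within)
        show "norm (deriv zeta x / zeta x) \<le> 1 / r" using disc[of x] x by (simp add: r_def)
      qed (use w r in auto)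
      also have "\<dots> \<le> (1 / r) * r" using w r by (intro mult_left_mono) (auto simp: dist_norm norm_minus_commute)
      finally show ?thesis using r by simp
    qed
    \<comment> \<open>This continues \<open>omega_transform z\<close> across the line
      \<open>Re s = 1\<close>.\<close>
    define f where "f w = exp (z * g w) * euler_G z w / w" for w
    have f: "f holomorphic_on ball s r" unfolding f_def
    proof (intro holomorphic_intros g holomorphic_on_subset[OF holomorphic_euler_G[OF z]])
      show "ball s r \<subseteq> {s. 3/4 < Re s}" using sub by (rule order_trans) auto
      show "w \<noteq> 0" if "w \<in> ball s r" for w using subsetD[OF sub that] by auto
    qed
    define B where "B = exp 1 * (A / (Re s - 1)) * euler_bound * 2"
    have fB: "norm (f w) \<le> B" if w: "w \<in> ball s r" for w
    proof -
      have "norm (g w) \<le> norm (g s) + norm (g w - g s)" by (rule norm_triangle_sub)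
      also have "\<dots> \<le> Re (log_zeta (of_real (Re s))) + 1"
        using norm_log_zeta_le[of s] s gb[OF w] by (intro add_mono) (auto simp: g_def)
      finally have gw: "norm (g w) \<le> Re (log_zeta (of_real (Re s))) + 1" .
      have "norm (exp (z * g w)) \<le> exp (norm (z * g w))" by (rule norm_exp)
      also have "\<dots> \<le> exp (Re (log_zeta (of_real (Re s))) + 1)" using gw z by (simp add: norm_mult)
      also have "\<dots> = exp 1 * norm (exp (log_zeta (of_real (Re s))))" by (simp add: exp_add)
      also have "\<dots> = exp 1 * norm (zeta (of_real (Re s)))" using s by (simp add: zeta_eq_exp)
      also have "\<dots> \<le> exp 1 * (A / (Re s - 1))" by (intro mult_left_mono A(2)) (use s in auto)
      finally have 1: "norm (exp (z * g w)) \<le> exp 1 * (A / (Re s - 1))" .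
      have Rw: "Re w > 399/400" using disc[of w] w by simp
      have 2: "norm (euler_G z w) \<le> euler_bound" using norm_euler_G_le z Rw by simp
      have "1/2 \<le> norm w" using Rw complex_Re_le_cmod[of w] by linarith
      hence 3: "1 / norm w \<le> 2" using frac_le[of 1 1 "1/2" "norm w"] by simp
      have "norm (f w) = norm (exp (z * g w)) * norm (euler_G z w) * (1 / norm w)"
        by (simp add: f_def norm_mult norm_divide)
      also have "\<dots> \<le> B" unfolding B_def using E0 A s by (intro mult_mono 1 2 3 mult_nonneg_nonneg) auto
      finally show ?thesis .
    qed
    have "(deriv ^^ 20) (omega_transform z) s = (deriv ^^ 20) f s"
    proof (rule higher_deriv_transform_within_open[where S = "ball s r \<inter> {s. Re s > 1}"])
      show "omega_transform z holomorphic_on ball s r \<inter> {s. Re s > 1}"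
        by (rule holomorphic_on_subset[OF holomorphic_omega_transform[OF z]]) auto
      show "f holomorphic_on ball s r \<inter> {s. Re s > 1}" by (rule holomorphic_on_subset[OF f]) auto
      show "open (ball s r \<inter> {s. Re s > 1})" by (intro open_Int open_ball open_halfspace_Re_gt)
      show "s \<in> ball s r \<inter> {s. Re s > 1}" using r s by simp
      show "omega_transform z w = f w" if "w \<in> ball s r \<inter> {s. Re s > 1}" for w
        using omega_transform_eq[OF z, of w] gl[OF that] that by (simp add: f_def)
    qed
    \<comment> \<open>Half the radius is used because \<open>f\<close> is controlled on the open
      ball only.\<close>
    moreover have "norm ((deriv ^^ 20) f s) \<le> fact 20 * B / (r / 2) ^ 20"
    proof (rule Cauchy_inequality)
      show "f holomorphic_on ball s (r / 2)" by (rule holomorphic_on_subset[OF f]) (use r in auto)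
      show "continuous_on (cball s (r / 2)) f"
        by (rule continuous_on_subset[OF holomorphic_on_imp_continuous_on[OF f]]) (use r in auto)
      fix w assume "norm (s - w) = r / 2"
      thus "norm (f w) \<le> B" using r by (intro fB) (simp add: dist_norm)
    qed (use r in auto)
    moreover have "fact 20 * B / (r / 2) ^ 20 = K * (\<bar>Im s\<bar> + 5) / (Re s - 1)"
    proof -
      have y400: "y ^ 400 = \<bar>Im s\<bar> + 5" unfolding y_def im_height_power by simp
      have "(r / 2) ^ 20 = (c / 2) ^ 20 / y ^ 400"
        by (simp add: r_def power_divide power_mult[symmetric] del: power_numeral)
      moreover have "a / (x ^ 20 / v) = a * v * (1 / x) ^ 20" for a x v :: real
        by (simp add: power_divide)
      ultimately have "fact 20 * B / (r / 2) ^ 20 = fact 20 * B * y ^ 400 * (2 / c) ^ 20" by simp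
      thus ?thesis unfolding y400 K_def B_def by (simp only: times_divide_eq_right times_divide_eq_left mult_ac)
    qed
    ultimately show "norm ((deriv ^^ 20) (omega_transform z) s) \<le> K * (\<bar>Im s\<bar> + 5) / (Re s - 1)" by simp
  qed
qed

section \<open>The Dirichlet series near s = 1\<close>

lemma higher_deriv_shifted_powr:
  fixes z s :: complex
  assumes "s - 1 \<notin> \<real>\<^sub>\<le>\<^sub>0"
  shows "(deriv ^^ n) (\<lambda>w. (w - 1) powr (-z)) s = (-1) ^ n * pochhammer z n * (s - 1) powr (- z - of_nat n)"
  using assms
proof (induction n arbitrary: s)
  case (Suc n)
  let ?S = "{s :: complex. s - 1 \<notin> \<real>\<^sub>\<le>\<^sub>0}"
  have "?S = (\<lambda>s. s - 1) -` (- \<real>\<^sub>\<le>\<^sub>0)" by auto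
  moreover have "open \<dots>" by (intro open_vimage continuous_intros) (auto simp: closed_nonpos_Reals_complex)
  ultimately have op: "open ?S" by simp
  have "((\<lambda>s. (-1) ^ n * pochhammer z n * (s - 1) powr (- z - of_nat n)) has_field_derivative
     ((-1) ^ n * pochhammer z n * ((- z - of_nat n) * (s - 1) powr (- z - of_nat n - 1)))) (at s)"
    using Suc.prems by (auto intro!: derivative_eq_intros)
  hence "((deriv ^^ n) (\<lambda>w. (w - 1) powr (-z)) has_field_derivative
     ((-1) ^ n * pochhammer z n * ((- z - of_nat n) * (s - 1) powr (- z - of_nat n - 1)))) (at s)"
    by (rule has_field_derivative_transform_within_open[OF _ op]) (use Suc in auto)
  hence "(deriv ^^ Suc n) (\<lambda>w. (w - 1) powr (-z)) s =
     (-1) ^ n * pochhammer z n * ((- z - of_nat n) * (s - 1) powr (- z - of_nat n - 1))"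
    by (simp add: DERIV_imp_deriv)
  thus ?case by (simp add: pochhammer_rec' algebra_simps)
qed auto

lemma zeta_reg_1 [simp]: "zeta_reg 1 = 1"
proof -
  have "zeta_term n 1 = 0" for n using zeta_term_bounds(1)[of 1 n] by simp
  thus ?thesis by (simp add: zeta_reg_def)
qed

text \<open>The imaginary part of the exponent meets only the argument of \<open>w\<close>, which is
  at most \<open>pi\<close> in modulus; this makes the constant uniform in \<open>z\<close>.\<close>

lemma norm_powr_le:
  assumes "w \<noteq> 0" "norm z = 1"
  shows "norm (w powr (-z)) \<le> exp pi * norm w powr (- Re z)"
proof -
  have *: "norm (w powr (-z)) = norm w powr (- Re z) * exp (Im z * Arg w)"
    by (simp add: norm_powr_complex)
  have "Im z * Arg w \<le> \<bar>Im z * Arg w\<bar>" by simp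
  also have "\<bar>Im z * Arg w\<bar> = \<bar>Im z\<bar> * \<bar>Arg w\<bar>" by (rule abs_mult)
  also have "\<dots> \<le> 1 * pi"
    using abs_Im_le_cmod[of z] Arg_bounded[of w] assms(2) by (intro mult_mono) auto
  finally have "exp (Im z * Arg w) \<le> exp pi" by simp
  hence "norm w powr (- Re z) * exp (Im z * Arg w) \<le> norm w powr (- Re z) * exp pi" by (intro mult_left_mono) auto
  with * show ?thesis by (simp add: mult.commute)
qed

text \<open>Provides a ball on which the principal logarithm of \<open>zeta_reg\<close> is
  holomorphic: 1/200 keeps it in the half plane of \<open>zeta_reg_bound\<close>, and
  \<open>1 / (4 * zeta_const)\<close> makes that bound at most 1/2.\<close>

lemma zeta_reg_near_one:
  "\<exists>r0>0. r0 \<le> 1/200 \<and> (\<forall>s\<in>ball 1 r0. norm (zeta_reg s - 1) \<le> 1/2)"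
proof -
  define r0 where "r0 = min (1/200) (1 / (4 * zeta_const))"
  have r0: "r0 > 0" "r0 \<le> 1/200" "r0 \<le> 1 / (4 * zeta_const)" using zeta_const_pos by (auto simp: r0_def)
  have "norm (zeta_reg s - 1) \<le> 1/2" if s: "s \<in> ball 1 r0" for s
  proof -
    have n: "norm (s - 1) \<le> r0" using s by (simp add: dist_norm norm_minus_commute)
    have "Re (1 - s) \<le> norm (1 - s)" by (rule complex_Re_le_cmod)
    hence Re: "Re s \<ge> 199/200" using n r0 by (simp add: norm_minus_commute)
    have ns: "norm s \<le> 2" using norm_triangle_sub[of s 1] n r0 by simp
    have "norm s powr (1/100) \<le> 2 powr (1/100)" using ns by (intro powr_mono2) auto
    also have "\<dots> \<le> 2 powr 1" by (intro powr_mono) auto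
    finally have p: "norm s powr (1/100) \<le> 2" by simp
    have "norm (zeta_reg s - 1) \<le> zeta_const * norm (s - 1) * norm s powr (1/100)"
      by (rule zeta_reg_bound) fact
    also have "\<dots> \<le> zeta_const * (1 / (4 * zeta_const)) * 2"
      using p n r0 zeta_const_pos by (intro mult_mono) auto
    also have "\<dots> = 1/2" using zeta_const_pos by simp
    finally show ?thesis .
  qed
  thus ?thesis using r0 by blast
qed

text \<open>The quotient of \<open>omega_transform z\<close> by \<open>(s - 1) powr (-z)\<close>. It
  is holomorphic near \<open>s = 1\<close> and takes the value \<open>euler_G z 1\<close>
  there.\<close>

definition regular_factor :: "complex \<Rightarrow> complex \<Rightarrow> complex" where
  "regular_factor z s = exp (z * Ln (zeta_reg s)) * euler_G z s / s"

context
  fixes r0 :: real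
  assumes r0: "r0 > 0" "r0 \<le> 1/200" and zr: "\<And>s. s \<in> ball 1 r0 \<Longrightarrow> norm (zeta_reg s - 1) \<le> 1/2"
begin

lemma ball_Re: "s \<in> ball 1 r0 \<Longrightarrow> Re s > 199/200"
  using complex_Re_le_cmod[of "1 - s"] r0 by (simp add: dist_norm)

lemma zeta_reg_nonpos: "s \<in> ball 1 r0 \<Longrightarrow> zeta_reg s \<notin> \<real>\<^sub>\<le>\<^sub>0"
  using complex_Re_le_cmod[of "1 - zeta_reg s"] zr[of s] by (auto simp: complex_nonpos_Reals_iff norm_minus_commute)

lemma holomorphic_regular_factor:
  assumes z: "norm z = 1"
  shows "regular_factor z holomorphic_on ball 1 r0"
  unfolding regular_factor_def[abs_def]
  by (intro holomorphic_intros holomorphic_on_subset[OF holomorphic_zeta_reg] holomorphic_on_subset[OF holomorphic_euler_G[OF z]])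
     (use zeta_reg_nonpos ball_Re in force)+

lemma norm_regular_factor_le:
  assumes z: "norm z = 1" and s: "s \<in> ball 1 r0"
  shows "norm (regular_factor z s) \<le> exp 2 * euler_bound * 2"
proof -
  define w where "w = 1 - zeta_reg s"
  have w: "norm w \<le> 1/2" using zr[OF s] by (simp add: w_def norm_minus_commute)
  have "norm (Ln (1 - w)) \<le> norm (Ln (1 - w) + w) + norm w" by (metis add_diff_cancel_right' norm_triangle_ineq4)
  also have "norm (Ln (1 - w) + w) \<le> 5/2 * norm w ^ 2" by (rule norm_Ln_1_minus_diff_le) (use w in auto)
  also have "norm w ^ 2 \<le> (1/2) ^ 2" using w by (intro power_mono) auto
  finally have "norm (Ln (1 - w)) \<le> 2" using w by (simp add: power2_eq_square)
  hence L: "norm (Ln (zeta_reg s)) \<le> 2" by (simp add: w_def)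
  have "norm (exp (z * Ln (zeta_reg s))) \<le> exp (norm (z * Ln (zeta_reg s)))" by (rule norm_exp)
  also have "\<dots> \<le> exp 2" using L z by (simp add: norm_mult)
  finally have 1: "norm (exp (z * Ln (zeta_reg s))) \<le> exp 2" .
  have 2: "norm (euler_G z s) \<le> euler_bound" using norm_euler_G_le z ball_Re[OF s] by simp
  have "1/2 \<le> norm s" using ball_Re[OF s] complex_Re_le_cmod[of s] by linarith
  hence 3: "1 / norm s \<le> 2" using frac_le[of 1 1 "1/2" "norm s"] by simp
  have "norm (regular_factor z s) = norm (exp (z * Ln (zeta_reg s))) * norm (euler_G z s) * (1 / norm s)"
    by (simp add: regular_factor_def norm_mult norm_divide)
  also have "\<dots> \<le> exp 2 * euler_bound * 2"
    by (intro mult_mono 1 2 3) (auto simp: euler_bound_def)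
  finally show ?thesis .
qed

text \<open>The value at 1 is \<open>euler_G z 1\<close> because \<open>zeta_reg 1 = 1\<close>.
  Discs of radius \<open>r0 / 4\<close> about points of the half ball stay in the full ball, and
  Cauchy's estimate on them turns the constant 2 into 8.\<close>

lemma norm_regular_factor_diff_le:
  assumes z: "norm z = 1" and s: "s \<in> ball 1 (r0 / 2)"
  shows "norm (regular_factor z s - euler_G z 1) \<le> (exp 2 * euler_bound * 8 / r0) * norm (s - 1)"
proof -
  have "norm (regular_factor z s - regular_factor z 1) \<le> (exp 2 * euler_bound * 8 / r0) * norm (s - 1)"
  proof (rule field_differentiable_bound[where S = "ball 1 (r0 / 2)" and f = "regular_factor z" and f' = "deriv (regular_factor z)"])
    fix w :: complex assume w: "w \<in> ball 1 (r0 / 2)"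
    have w': "w \<in> ball 1 r0" using w r0 by simp
    show "(regular_factor z has_field_derivative deriv (regular_factor z) w) (at w within ball 1 (r0 / 2))"
      by (rule has_field_derivative_at_within[OF holomorphic_derivI[OF holomorphic_regular_factor[OF z] open_ball w']])
    have sub: "cball w (r0 / 4) \<subseteq> ball 1 r0"
    proof
      fix v assume "v \<in> cball w (r0 / 4)"
      thus "v \<in> ball 1 r0" using w r0 dist_triangle[of 1 v w] by (simp add: dist_commute)
    qed
    have "norm ((deriv ^^ 1) (regular_factor z) w) \<le> fact 1 * (exp 2 * euler_bound * 2) / (r0 / 4) ^ 1"
    proof (rule Cauchy_inequality)
      show "regular_factor z holomorphic_on ball w (r0 / 4)"
        by (rule holomorphic_on_subset[OF holomorphic_regular_factor[OF z]]) (use sub ball_subset_cball in blast)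
      show "continuous_on (cball w (r0 / 4)) (regular_factor z)"
        by (rule continuous_on_subset[OF holomorphic_on_imp_continuous_on[OF holomorphic_regular_factor[OF z]] sub])
      fix x assume "norm (w - x) = r0 / 4"
      hence "x \<in> ball 1 r0" using sub by (auto simp: dist_norm)
      thus "norm (regular_factor z x) \<le> exp 2 * euler_bound * 2" by (rule norm_regular_factor_le[OF z])
    qed (use r0 in auto)
    thus "norm (deriv (regular_factor z) w) \<le> exp 2 * euler_bound * 8 / r0" by (simp add: mult_ac)
  qed (use s r0 in auto)
  thus ?thesis by (simp add: regular_factor_def)
qed

text \<open>For \<open>Re s > 1\<close> in the ball, \<open>log_zeta s\<close> and
  \<open>- Ln (s - 1) + Ln (zeta_reg s)\<close> have the same exponential, so they agree throughout
  once they agree at one real point, where both are real.\<close>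

lemma omega_transform_near:
  assumes z: "norm z = 1" and s: "s \<in> ball 1 r0" "Re s > 1"
  shows "omega_transform z s = (s - 1) powr (-z) * regular_factor z s"
proof -
  define S where "S = ball 1 r0 \<inter> {s. Re s > 1}"
  have np: "w - 1 \<notin> \<real>\<^sub>\<le>\<^sub>0" "w \<noteq> 1" if "w \<in> S" for w
    using that by (auto simp: S_def complex_nonpos_Reals_iff)
  have nz: "zeta_reg w \<noteq> 0" if "w \<in> S" for w using zeta_reg_nonpos[of w] that by (auto simp: S_def)
  define a where "a = complex_of_real (1 + r0 / 2)"
  have a: "a \<in> S" using r0 by (auto simp: S_def a_def dist_norm norm_minus_commute)
  have a1: "a - 1 = of_real (r0 / 2)" by (simp add: a_def)
  have ex: "exp (log_zeta w) = exp (- Ln (w - 1) + Ln (zeta_reg w))" if "w \<in> S" for w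
  proof -
    have "exp (- Ln (w - 1) + Ln (zeta_reg w)) = zeta_reg w / (w - 1)"
      using nz[OF that] np[OF that] by (simp add: exp_diff)
    thus ?thesis using zeta_reg_log_zeta[of w] that np[OF that] by (simp add: S_def)
  qed
  have "log_zeta s = - Ln (s - 1) + Ln (zeta_reg s)"
  proof (rule exp_eq_imp_eq_on_connected[where S = S and a = a and g = log_zeta
      and h = "\<lambda>s. - Ln (s - 1) + Ln (zeta_reg s)" and w = s])
    show "connected S" unfolding S_def by (intro convex_connected convex_Int convex_ball convex_halfspace_Re_gt)
    show "continuous_on S log_zeta"
      by (rule continuous_on_subset[OF holomorphic_on_imp_continuous_on[OF holomorphic_log_zeta]]) (auto simp: S_def)
    have "continuous_on S zeta_reg"
      by (rule continuous_on_subset[OF holomorphic_on_imp_continuous_on[OF holomorphic_zeta_reg]])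
         (use ball_Re in \<open>auto simp: S_def\<close>)
    thus "continuous_on S (\<lambda>s. - Ln (s - 1) + Ln (zeta_reg s))"
      by (intro continuous_intros) (use np zeta_reg_nonpos in \<open>auto simp: S_def\<close>)
    \<comment> \<open>A complex number whose modulus is at most its real part is real.\<close>
    have "norm (log_zeta a) \<le> Re (log_zeta a)"
      using norm_log_zeta_le[of a] r0 by (simp add: a_def)
    hence l: "log_zeta a = of_real (Re (log_zeta a))"
      using complex_Re_le_cmod[of "log_zeta a"] cmod_eq_Re[of "log_zeta a"]
      by (smt (verit, best) cmod_power2 complex_eq_iff complex.sel Im_complex_of_real Re_complex_of_real norm_ge_zero power2_eq_iff_nonneg zero_eq_power2)
    have La: "Ln (a - 1) = of_real (ln (r0 / 2))" unfolding a1 using r0 by (intro Ln_of_real) auto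
    have "zeta_reg a = of_real (r0 / 2 * exp (Re (log_zeta a)))"
    proof -
      have "exp (log_zeta a) = of_real (exp (Re (log_zeta a)))" using l by (metis exp_of_real)
      thus ?thesis using zeta_reg_log_zeta[of a] a by (simp add: S_def a1)
    qed
    moreover have "Ln (of_real (r0 / 2 * exp (Re (log_zeta a)))) = of_real (ln (r0 / 2 * exp (Re (log_zeta a))))"
      using r0 by (intro Ln_of_real) auto
    moreover have "ln (r0 / 2 * exp (Re (log_zeta a))) = ln (r0 / 2) + Re (log_zeta a)"
      using r0 by (subst ln_mult) auto
    ultimately have "- Ln (a - 1) + Ln (zeta_reg a) = of_real (Re (log_zeta a))"
      unfolding La by (simp only: of_real_add) simp
    thus "log_zeta a = - Ln (a - 1) + Ln (zeta_reg a)" using l by simp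
  qed (use a ex s in \<open>auto simp: S_def\<close>)
  hence "z * log_zeta s = - z * Ln (s - 1) + z * Ln (zeta_reg s)" by (simp only: distrib_left) simp
  hence "exp (z * log_zeta s) = exp (- z * Ln (s - 1)) * exp (z * Ln (zeta_reg s))"
    by (simp only: exp_add)
  moreover have "(s - 1) powr (-z) = exp (- z * Ln (s - 1))"
    using s by (auto simp: powr_def)
  ultimately show ?thesis
    using omega_transform_eq[OF z s(2)] by (simp add: regular_factor_def)
qed

text \<open>The error \<open>E\<close> is smaller than the singular term by a factor of order
  \<open>norm (s - 1)\<close>. Cauchy's estimate on the disc of radius
  \<open>norm (s - 1) / 2\<close> loses one factor of that order per derivative, just as
  differentiating a power does, so the gain survives.\<close>

lemma omega_transform_deriv_near:
  assumes z: "norm z = 1" and s: "s \<in> ball 1 (r0 / 3)" "Re s > 1" and n: "n > 0"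
  shows "norm ((deriv ^^ n) (omega_transform z) s - (-1) ^ n * pochhammer z n * euler_G z 1 * (s - 1) powr (- z - of_nat n))
     \<le> fact n * (exp pi * (9/4) * (exp 2 * euler_bound * 8 / r0)) * 2 ^ n * norm (s - 1) powr (1 - Re z - n)"
proof -
  define K where "K = exp 2 * euler_bound * 8 / r0"
  have K: "K > 0" using r0 by (simp add: K_def euler_bound_def)
  define x where "x = norm (s - 1)"
  have x: "x > 0" "x < r0 / 3" using s by (auto simp: x_def dist_norm norm_minus_commute)
  define E where "E w = (w - 1) powr (-z) * (regular_factor z w - euler_G z 1)" for w
  have close: "norm (w - 1) \<le> 3/2 * x \<and> norm (w - 1) \<ge> x / 2 \<and> w - 1 \<notin> \<real>\<^sub>\<le>\<^sub>0" if w: "w \<in> cball s (x / 2)" for w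
  proof (intro conjI)
    have d: "norm (w - s) \<le> x / 2" using w by (simp add: dist_norm norm_minus_commute)
    show "norm (w - 1) \<le> 3/2 * x" using norm_triangle_ineq[of "w - s" "s - 1"] d by (simp add: x_def)
    show "norm (w - 1) \<ge> x / 2" using norm_triangle_ineq4[of "w - 1" "w - s"] d by (simp add: x_def)
    show "w - 1 \<notin> \<real>\<^sub>\<le>\<^sub>0"
    proof
      assume "w - 1 \<in> \<real>\<^sub>\<le>\<^sub>0"
      hence 1: "Re (w - 1) \<le> 0" "Im (w - 1) = 0" by (auto simp: complex_nonpos_Reals_iff)
      \<comment> \<open>As \<open>Re s > 1\<close>, the point of the cut nearest to \<open>s\<close>
        is 1, at distance \<open>x\<close>, twice the radius of the disc.\<close>
      have "x ^ 2 = (Re s - 1) ^ 2 + (Im s) ^ 2" by (simp add: x_def cmod_power2)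
      also have "\<dots> \<le> (Re (s - w)) ^ 2 + (Im (s - w)) ^ 2" using 1 s by (intro add_mono) (auto intro: power_mono)
      also have "\<dots> = norm (w - s) ^ 2" by (simp add: cmod_power2 power2_commute)
      finally have "x \<le> norm (w - s)" by (rule power2_le_imp_le) simp
      thus False using d x by linarith
    qed
  qed
  have sub: "cball s (x / 2) \<subseteq> ball 1 (r0 / 2)"
  proof
    fix w assume "w \<in> cball s (x / 2)"
    from close[OF this] x show "w \<in> ball 1 (r0 / 2)" by (simp add: dist_norm norm_minus_commute)
  qed
  have holp: "(\<lambda>w. (w - 1) powr (-z)) holomorphic_on cball s (x / 2)"
  proof -
    have np: "w - 1 \<notin> \<real>\<^sub>\<le>\<^sub>0" if "w \<in> cball s (x / 2)" for w using close[OF that] by blast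
    show ?thesis by (intro holomorphic_intros np)
  qed
  have holpS: "(\<lambda>w. (w - 1) powr (-z)) holomorphic_on ball s (x / 2) \<inter> {s. Re s > 1}"
    by (rule holomorphic_on_subset[OF holp]) auto
  have holE: "E holomorphic_on cball s (x / 2)" unfolding E_def
  proof (intro holomorphic_on_mult holomorphic_on_diff holomorphic_on_const holp holomorphic_on_subset[OF holomorphic_regular_factor[OF z]])
    show "cball s (x / 2) \<subseteq> ball 1 r0" by (rule order_trans[OF sub subset_ball]) (use r0 in auto)
  qed
  have bE: "norm (E w) \<le> exp pi * (9/4) * K * x powr (1 - Re z)" if w: "w \<in> cball s (x / 2)" for w
  proof -
    have pos: "norm (w - 1) > 0" using close[OF w] x by linarith
    have "norm (E w) \<le> (exp pi * norm (w - 1) powr (- Re z)) * (K * norm (w - 1))"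
      unfolding E_def norm_mult K_def
      by (intro mult_mono norm_powr_le z norm_regular_factor_diff_le) (use pos sub w in auto)
    also have "\<dots> = exp pi * K * norm (w - 1) powr (1 - Re z)"
      using pos by (simp add: powr_diff powr_minus field_simps)
    also have "norm (w - 1) powr (1 - Re z) \<le> (3/2 * x) powr (1 - Re z)"
      using close[OF w] pos complex_Re_le_cmod[of z] z by (intro powr_mono2) auto
    also have "(3/2 * x) powr (1 - Re z) = (3/2) powr (1 - Re z) * x powr (1 - Re z)" by (rule powr_mult)
    also have "(3/2 :: real) powr (1 - Re z) \<le> (3/2) powr 2"
      using abs_Re_le_cmod[of z] z by (intro powr_mono) auto
    also have "(3/2 :: real) powr 2 = 9/4" by (simp add: power2_eq_square)
    finally show ?thesis using K by (simp add: mult_left_mono mult_right_mono mult_ac)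
  qed
  let ?S = "ball s (x / 2) \<inter> {s. Re s > 1}"
  have opS: "open ?S" by (intro open_Int open_ball open_halfspace_Re_gt)
  have sS: "s \<in> ?S" using s x by simp
  have "(deriv ^^ n) (omega_transform z) s = (deriv ^^ n) (\<lambda>w. E w + euler_G z 1 * (w - 1) powr (-z)) s"
  proof (rule higher_deriv_transform_within_open[where S = ?S])
    show "omega_transform z holomorphic_on ?S" by (rule holomorphic_on_subset[OF holomorphic_omega_transform[OF z]]) auto
    show "(\<lambda>w. E w + euler_G z 1 * (w - 1) powr (-z)) holomorphic_on ?S"
      by (intro holomorphic_on_add holomorphic_on_mult holomorphic_on_const holpS holomorphic_on_subset[OF holE]) auto
    show "omega_transform z w = E w + euler_G z 1 * (w - 1) powr (-z)" if w: "w \<in> ?S" for w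
    proof -
      have "w \<in> cball s (x / 2)" using w by simp
      hence "w \<in> ball 1 r0" using sub r0 by (auto dest!: subsetD)
      thus ?thesis using omega_transform_near[OF z, of w] w by (simp add: E_def algebra_simps)
    qed
  qed (use opS sS in auto)
  also have "\<dots> = (deriv ^^ n) E s + (deriv ^^ n) (\<lambda>w. euler_G z 1 * (w - 1) powr (-z)) s"
    by (rule higher_deriv_add[OF holomorphic_on_subset[OF holE] _ opS sS])
       (auto intro!: holomorphic_on_mult holomorphic_on_const holpS)
  also have "(deriv ^^ n) (\<lambda>w. euler_G z 1 * (w - 1) powr (-z)) s = euler_G z 1 * (deriv ^^ n) (\<lambda>w. (w - 1) powr (-z)) s"
    by (rule higher_deriv_cmult[OF holpS sS opS])
  also have "(deriv ^^ n) (\<lambda>w. (w - 1) powr (-z)) s = (-1) ^ n * pochhammer z n * (s - 1) powr (- z - of_nat n)"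
    by (rule higher_deriv_shifted_powr) (use s in \<open>auto simp: complex_nonpos_Reals_iff\<close>)
  finally have "(deriv ^^ n) (omega_transform z) s - (-1) ^ n * pochhammer z n * euler_G z 1 * (s - 1) powr (- z - of_nat n) = (deriv ^^ n) E s"
    by (simp add: mult_ac)
  also have "norm \<dots> \<le> fact n * (exp pi * (9/4) * K * x powr (1 - Re z)) / (x / 2) ^ n"
  proof (rule Cauchy_inequality)
    show "E holomorphic_on ball s (x / 2)" by (rule holomorphic_on_subset[OF holE]) auto
    show "continuous_on (cball s (x / 2)) E" by (rule holomorphic_on_imp_continuous_on[OF holE])
    fix w assume "norm (s - w) = x / 2"
    thus "norm (E w) \<le> exp pi * (9/4) * K * x powr (1 - Re z)" by (intro bE) (simp add: dist_norm)
  qed (use x in auto)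
  also have "\<dots> = fact n * (exp pi * (9/4) * K) * 2 ^ n * x powr (1 - Re z - n)"
    using x by (simp add: power_divide powr_diff powr_realpow mult_ac)
  finally show ?thesis by (simp add: K_def x_def)
qed

end

section \<open>Laplace transforms\<close>

definition laplace :: "(real \<Rightarrow> complex) \<Rightarrow> complex \<Rightarrow> complex" where
  "laplace g s = (\<integral>v. g v * exp (- (s * of_real v)) \<partial>lborel)"

text \<open>Support on the half line and absolute convergence for every real part above
  \<open>a\<close>. As \<open>a\<close> itself is excluded, a polynomial factor can be absorbed by
  lowering the exponent a little.\<close>

definition laplace_ok :: "real \<Rightarrow> (real \<Rightarrow> complex) \<Rightarrow> bool" where
  "laplace_ok a g \<longleftrightarrow> g \<in> borel_measurable borel \<and> (\<forall>v<0. g v = 0) \<and>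
     (\<forall>c>a. integrable lborel (\<lambda>v. norm (g v) * exp (- (c * v))))"

lemma power_le_exp:
  fixes x c :: real assumes "c > 0" "x \<ge> 0"
  shows "x ^ n \<le> fact n / c ^ n * exp (c * x)"
proof -
  have "(c * x) ^ n / fact n \<le> exp (c * x)"
  proof -
    have "(\<lambda>k. (c * x) ^ k / fact k) sums exp (c * x)" using exp_converges[of "c * x"] by (simp add: field_simps)
    thus ?thesis using sum_le_suminf[of "\<lambda>k. (c * x) ^ k / fact k" "{n}"] assms by (simp add: sums_iff)
  qed
  thus ?thesis using assms by (simp add: field_simps power_mult_distrib)
qed

lemma laplace_okD:
  assumes "laplace_ok a g"
  shows "g \<in> borel_measurable borel" "v < 0 \<Longrightarrow> g v = 0" "c > a \<Longrightarrow> integrable lborel (\<lambda>v. norm (g v) * exp (- (c * v)))"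
  using assms by (auto simp: laplace_ok_def)

lemma laplace_ok_power:
  assumes g: "laplace_ok a g"
  shows "laplace_ok a (\<lambda>v. of_real v ^ n * g v)"
  unfolding laplace_ok_def
proof (intro conjI allI impI)
  note [measurable] = laplace_okD(1)[OF g]
  show "(\<lambda>v. of_real v ^ n * g v) \<in> borel_measurable borel" by measurable
  show "of_real v ^ n * g v = 0" if "v < 0" for v using laplace_okD(2)[OF g that] by simp
  fix c assume c: "c > a"
  \<comment> \<open>Half of the gap to \<open>a\<close> pays for \<open>v ^ n\<close>, the other
    half keeps the integral convergent.\<close>
  define e where "e = (c - a) / 2"
  have e: "e > 0" "c - e > a" using c by (auto simp: e_def field_simps)
  show "integrable lborel (\<lambda>v. norm (of_real v ^ n * g v) * exp (- (c * v)))"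
  proof (rule Bochner_Integration.integrable_bound)
    show "integrable lborel (\<lambda>v. fact n / e ^ n * (norm (g v) * exp (- ((c - e) * v))))"
      using laplace_okD(3)[OF g e(2)] by simp
    show "AE v in lborel. norm (norm (of_real v ^ n * g v) * exp (- (c * v))) \<le> norm (fact n / e ^ n * (norm (g v) * exp (- ((c - e) * v))))"
    proof (rule AE_I2)
      fix v :: real
      show "norm (norm (of_real v ^ n * g v) * exp (- (c * v))) \<le> norm (fact n / e ^ n * (norm (g v) * exp (- ((c - e) * v))))"
      proof (cases "v < 0")
        case True thus ?thesis using laplace_okD(2)[OF g] by simp
      next
        case False
        hence "v ^ n \<le> fact n / e ^ n * exp (e * v)" by (intro power_le_exp e) auto
        hence "v ^ n * (norm (g v) * exp (- (c * v))) \<le> fact n / e ^ n * exp (e * v) * (norm (g v) * exp (- (c * v)))"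
          by (intro mult_right_mono) auto
        also have "\<dots> = fact n / e ^ n * (norm (g v) * (exp (e * v) * exp (- (c * v))))" by simp
        also have "exp (e * v) * exp (- (c * v)) = exp (- ((c - e) * v))"
          by (simp add: exp_add[symmetric] algebra_simps)
        finally show ?thesis using False e by (simp add: norm_mult norm_power mult_ac abs_mult)
      qed
    qed
  qed measurable
qed

lemma laplace_integrable:
  assumes g: "laplace_ok a g" and s: "Re s > a"
  shows "integrable lborel (\<lambda>v. g v * exp (- (s * of_real v)))"
proof (rule Bochner_Integration.integrable_bound)
  note [measurable] = laplace_okD(1)[OF g]
  show "integrable lborel (\<lambda>v. norm (g v) * exp (- (Re s * v)))" by (rule laplace_okD(3)[OF g s])
  show "(\<lambda>v. g v * exp (- (s * of_real v))) \<in> borel_measurable lborel" by measurable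
  show "AE v in lborel. norm (g v * exp (- (s * of_real v))) \<le> norm (norm (g v) * exp (- (Re s * v)))"
    by (intro AE_I2) (simp add: norm_mult)
qed

text \<open>Differentiation under the integral with an explicit rate: Taylor's formula for the
  exponential bounds the error of the difference quotient by \<open>norm h\<close> times a fixed
  integrable function involving \<open>v ^ 2\<close>.\<close>

lemma laplace_deriv:
  assumes g: "laplace_ok a g" and s: "Re s > a"
  shows "(laplace g has_field_derivative - laplace (\<lambda>v. of_real v * g v) s) (at s)"
proof -
  note [measurable] = laplace_okD(1)[OF g]
  have g1: "laplace_ok a (\<lambda>v. of_real v * g v)" using laplace_ok_power[OF g, of 1] by simp
  have g2: "laplace_ok a (\<lambda>v. of_real v ^ 2 * g v)" by (rule laplace_ok_power[OF g])
  define e where "e = (Re s - a) / 2"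
  have e: "e > 0" "Re s - e > a" using s by (auto simp: e_def field_simps)
  define K where "K = (\<integral>v. norm (of_real v ^ 2 * g v) * exp (- ((Re s - e) * v)) \<partial>lborel)"
  have int2: "integrable lborel (\<lambda>v. norm (of_real v ^ 2 * g v) * exp (- ((Re s - e) * v)))"
    by (rule laplace_okD(3)[OF g2 e(2)])
  have bnd: "norm ((laplace g (s + h) - laplace g s) / h - (- laplace (\<lambda>v. of_real v * g v) s)) \<le> K * norm h"
    if h: "h \<noteq> 0" "norm h < e" for h
  proof -
    have sh: "Re (s + h) > a" using abs_Re_le_cmod[of h] h e by simp
    have "(laplace g (s + h) - laplace g s) / h - (- laplace (\<lambda>v. of_real v * g v) s) =
      (\<integral>v. (g v * exp (- ((s + h) * of_real v)) - g v * exp (- (s * of_real v))) / h + of_real v * g v * exp (- (s * of_real v)) \<partial>lborel)"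
      unfolding laplace_def using laplace_integrable[OF g sh] laplace_integrable[OF g s] laplace_integrable[OF g1 s]
      by simp
    also have "norm \<dots> \<le> (\<integral>v. norm h * (norm (of_real v ^ 2 * g v) * exp (- ((Re s - e) * v))) \<partial>lborel)"
    proof (rule Bochner_Integration.integral_norm_bound_integral)
      show "integrable lborel (\<lambda>v. (g v * exp (- ((s + h) * of_real v)) - g v * exp (- (s * of_real v))) / h + of_real v * g v * exp (- (s * of_real v)))"
        using laplace_integrable[OF g sh] laplace_integrable[OF g s] laplace_integrable[OF g1 s] by simp
      show "integrable lborel (\<lambda>v. norm h * (norm (of_real v ^ 2 * g v) * exp (- ((Re s - e) * v))))"
        using int2 by simp
      fix v :: real
      show "norm ((g v * exp (- ((s + h) * of_real v)) - g v * exp (- (s * of_real v))) / h + of_real v * g v * exp (- (s * of_real v)))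
         \<le> norm h * (norm (of_real v ^ 2 * g v) * exp (- ((Re s - e) * v)))"
      proof (cases "v < 0")
        case True thus ?thesis using laplace_okD(2)[OF g] by simp
      next
        case False
        define w where "w = - (h * of_real v)"
        have "norm (exp w - (\<Sum>i\<le>1. w ^ i / fact i)) \<le> exp \<bar>Re w\<bar> * norm w ^ Suc 1 / fact 1"
          by (rule Taylor_exp)
        also have "(\<Sum>i\<le>1. w ^ i / fact i) = 1 + w" by simp
        also have "exp \<bar>Re w\<bar> * norm w ^ Suc 1 / fact 1 \<le> exp (e * v) * (norm h * v) ^ 2"
        proof -
          have "\<bar>Re w\<bar> \<le> norm w" by (rule abs_Re_le_cmod)
          also have "\<dots> = norm h * v" using False by (simp add: w_def norm_mult)
          also have "\<dots> \<le> e * v" using False h by (intro mult_right_mono) auto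
          finally have "exp \<bar>Re w\<bar> \<le> exp (e * v)" by simp
          moreover have "norm w = norm h * v" using False by (simp add: w_def norm_mult)
          ultimately show ?thesis by (simp add: power2_eq_square mult_right_mono)
        qed
        finally have T: "norm (exp w - (1 + w)) \<le> exp (e * v) * (norm h * v) ^ 2" .
        have "(g v * exp (- ((s + h) * of_real v)) - g v * exp (- (s * of_real v))) / h + of_real v * g v * exp (- (s * of_real v))
           = g v * exp (- (s * of_real v)) * (exp w - (1 + w)) / h"
          using h by (simp add: w_def exp_add[symmetric] exp_diff exp_minus field_simps)
        also have "norm \<dots> = norm (g v) * exp (- (Re s * v)) * norm (exp w - (1 + w)) / norm h"
          by (simp add: norm_mult norm_divide)
        also have "\<dots> \<le> norm (g v) * exp (- (Re s * v)) * (exp (e * v) * (norm h * v) ^ 2) / norm h"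
          using T by (intro divide_right_mono mult_left_mono) auto
        also have "\<dots> = norm h * (v ^ 2 * norm (g v) * (exp (- (Re s * v)) * exp (e * v)))"
          using h by (simp add: power2_eq_square)
        also have "exp (- (Re s * v)) * exp (e * v) = exp (- ((Re s - e) * v))"
          by (simp add: exp_add[symmetric] algebra_simps)
        finally show ?thesis by (simp add: norm_mult norm_power)
      qed
    qed
    finally show ?thesis by (simp add: K_def mult.commute)
  qed
  have "((\<lambda>h. (laplace g (s + h) - laplace g s) / h - (- laplace (\<lambda>v. of_real v * g v) s)) \<longlongrightarrow> 0) (at 0)"
  proof (rule Lim_null_comparison)
    show "\<forall>\<^sub>F h in at 0. norm ((laplace g (s + h) - laplace g s) / h - (- laplace (\<lambda>v. of_real v * g v) s)) \<le> K * norm h"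
      unfolding eventually_at using e bnd by (intro exI[of _ e]) (auto simp: dist_norm)
    have "((\<lambda>h::complex. K * norm h) \<longlongrightarrow> K * norm (0::complex)) (at 0)" by (intro tendsto_intros)
    thus "((\<lambda>h::complex. K * norm h) \<longlongrightarrow> 0) (at 0)" by simp
  qed
  hence "((\<lambda>h. (laplace g (s + h) - laplace g s) / h) \<longlongrightarrow> - laplace (\<lambda>v. of_real v * g v) s) (at 0)"
    by (rule LIM_zero_cancel)
  thus ?thesis by (simp add: DERIV_def)
qed

lemma holomorphic_laplace:
  assumes "laplace_ok a g" shows "laplace g holomorphic_on {s. Re s > a}"
  unfolding holomorphic_on_def field_differentiable_def
  using laplace_deriv[OF assms] has_field_derivative_at_within by blast

lemma higher_deriv_laplace:
  assumes g: "laplace_ok a g" and s: "Re s > a"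
  shows "(deriv ^^ n) (laplace g) s = (-1) ^ n * laplace (\<lambda>v. of_real v ^ n * g v) s"
  using s
proof (induction n arbitrary: s)
  case (Suc n)
  have "((\<lambda>s. (-1) ^ n * laplace (\<lambda>v. of_real v ^ n * g v) s) has_field_derivative
     (-1) ^ n * (- laplace (\<lambda>v. of_real v * (of_real v ^ n * g v)) s)) (at s)"
    by (intro DERIV_cmult laplace_deriv[OF laplace_ok_power[OF g]] Suc.prems)
  hence "((deriv ^^ n) (laplace g) has_field_derivative
     (-1) ^ n * (- laplace (\<lambda>v. of_real v * (of_real v ^ n * g v)) s)) (at s)"
    by (rule has_field_derivative_transform_within_open[OF _ open_halfspace_Re_gt[of a]]) (use Suc in auto)
  thus ?case by (simp add: DERIV_imp_deriv mult.assoc)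
qed auto

text \<open>The identity theorem, since real points accumulate in the half plane. It allows each
  Laplace transform to be computed at real arguments only.\<close>

lemma eq_on_halfplane_if_eq_on_reals:
  assumes f: "f holomorphic_on {s. Re s > a}" and h: "h holomorphic_on {s. Re s > a}"
    and eq: "\<And>x. x > a \<Longrightarrow> f (of_real x) = h (of_real x)" and s: "Re s > a"
  shows "f s = h s"
proof -
  have op: "open {s :: complex. Re s > a}" by (rule open_halfspace_Re_gt)
  have "f s - h s = 0"
  proof (rule analytic_continuation[where S = "{s. Re s > a}" and U = "of_real ` {a<..<a + 2}" and \<xi> = "of_real (a + 1)" and f = "\<lambda>s. f s - h s"])
    show "(\<lambda>s. f s - h s) holomorphic_on {s. Re s > a}" by (intro holomorphic_intros f h)
    show "connected {s. Re s > a}" by (intro convex_connected convex_halfspace_Re_gt)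
    have "(of_real (a + 1) :: complex) islimpt of_real ` {a<..<a + 2}"
    proof (rule islimpt_isCont_image)
      show "(a + 1) islimpt {a<..<a + 2}" by (rule interior_limit_point) simp
      show "\<forall>\<^sub>F z in at (a + 1). complex_of_real z \<noteq> of_real (a + 1)"
        by (subst eventually_at_filter) (intro always_eventually, simp add: complex_eq_iff)
    qed auto
    thus "(of_real (a + 1) :: complex) islimpt of_real ` {a<..<a + 2}" .
  qed (use op s eq in auto)
  thus ?thesis by simp
qed

section \<open>Gaussian smoothing\<close>

text \<open>On the line \<open>Re s = 1 + e\<close> the denominator is
  \<open>norm (s - 1) ^ 2\<close>; \<open>pi / e\<close> is the price of integrating the singular
  part of the transform.\<close>

lemma integrable_inverse_square_sum:
  fixes e :: real assumes e: "e > 0"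
  shows "integrable lborel (\<lambda>t. 1 / (e ^ 2 + t ^ 2))" "(\<integral>t. 1 / (e ^ 2 + t ^ 2) \<partial>lborel) = pi / e"
proof -
  have i: "integrable lborel (\<lambda>x::real. inverse (1 + x ^ 2))" and v: "(\<integral>x. inverse (1 + x ^ 2) \<partial>lborel) = pi"
    using integrable_inverse_1_plus_square LBINT_inverse_1_plus_square
    by (simp_all add: set_integrable_def interval_lebesgue_integral_def set_lebesgue_integral_def)
  have eq: "1 / (e ^ 2 + t ^ 2) = inverse (e ^ 2) * inverse (1 + (0 + (1 / e) * t) ^ 2)" for t
  proof -
    have "e ^ 2 + t ^ 2 = e ^ 2 * (1 + (0 + (1 / e) * t) ^ 2)"
      using e by (simp add: field_simps power2_eq_square)
    thus ?thesis by (simp add: divide_inverse)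
  qed
  have i2: "integrable lborel (\<lambda>t. inverse (1 + (0 + (1 / e) * t) ^ 2))"
    by (rule lborel_integrable_real_affine[OF i]) (use e in auto)
  thus "integrable lborel (\<lambda>t. 1 / (e ^ 2 + t ^ 2))" unfolding eq by (rule integrable_mult_right)
  have "pi = \<bar>1 / e\<bar> *\<^sub>R (\<integral>t. inverse (1 + (0 + (1 / e) * t) ^ 2) \<partial>lborel)"
    unfolding v[symmetric] by (rule lborel_integral_real_affine) (use e in auto)
  hence "(\<integral>t. inverse (1 + (0 + (1 / e) * t) ^ 2) \<partial>lborel) = pi * e" using e by (simp add: field_simps)
  moreover have "(\<integral>t. 1 / (e ^ 2 + t ^ 2) \<partial>lborel) = inverse (e ^ 2) * (\<integral>t. inverse (1 + (0 + (1 / e) * t) ^ 2) \<partial>lborel)"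
    by (simp only: eq integral_mult_right_zero)
  ultimately have "(\<integral>t. 1 / (e ^ 2 + t ^ 2) \<partial>lborel) = inverse (e ^ 2) * (pi * e)" by simp
  also have "\<dots> = pi / e" using e by (simp add: power2_eq_square field_simps)
  finally show "(\<integral>t. 1 / (e ^ 2 + t ^ 2) \<partial>lborel) = pi / e" .
qed

abbreviation gaussian :: "real measure" where
  "gaussian \<equiv> std_normal_distribution"

abbreviation fourier :: "(real \<Rightarrow> complex) \<Rightarrow> real \<Rightarrow> complex" where
  "fourier Q t \<equiv> (\<integral>v. Q v * exp (- (\<i> * of_real (t * v))) \<partial>lborel)"

text \<open>Follows from \<open>\<bar>x\<bar> \<le> (1 + x ^ 2) / 2\<close>, because the second
  moment is 1.\<close>

lemma std_normal_abs_moment: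
  "integrable gaussian (\<lambda>x. \<bar>x\<bar>)" "(\<integral>x. \<bar>x\<bar> \<partial>gaussian) \<le> 1"
proof -
  interpret real_distribution gaussian by (rule real_dist_normal_dist)
  have i2: "integrable gaussian (\<lambda>x. x ^ 2)" by (rule integrable_std_normal_distribution_moment)
  have m2: "(\<integral>x. x ^ 2 \<partial>gaussian) = 1"
    using std_normal_distribution_even_moments[of 1] by simp
  have le: "\<bar>x\<bar> \<le> (1 + x ^ 2) / 2" for x :: real
    using zero_le_power2[of "\<bar>x\<bar> - 1"] by (simp add: power2_eq_square algebra_simps abs_mult_self_eq)
  have "integrable gaussian (\<lambda>x. \<bar>x ^ 1\<bar>)"
    by (intro integrable_abs integrable_std_normal_distribution_moment)
  thus i1: "integrable gaussian (\<lambda>x. \<bar>x\<bar>)" by simp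
  have "(\<integral>x. \<bar>x\<bar> \<partial>gaussian) \<le> (\<integral>x. (1 + x ^ 2) / 2 \<partial>gaussian)"
    by (rule integral_mono[OF i1]) (use i2 le in auto)
  also have "\<dots> = 1" using i2 m2 prob_space by (simp add: add_divide_distrib)
  finally show "(\<integral>x. \<bar>x\<bar> \<partial>gaussian) \<le> 1" .
qed

text \<open>Averaging \<open>Q\<close> at scale \<open>d\<close> against a Gaussian corresponds to damping its Fourier transform at
  height \<open>1/d\<close>.\<close>

lemma gaussian_smoothing_identity:
  fixes Q :: "real \<Rightarrow> complex"
  assumes Q: "integrable lborel Q" and d: "d > 0"
  defines "Qh \<equiv> fourier Q"
  shows "integrable gaussian (\<lambda>x. Qh (x / d) * exp (\<i> * of_real (x / d * l)))"
    and "(\<integral>x. Qh (x / d) * exp (\<i> * of_real (x / d * l)) \<partial>gaussian) =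
       of_real (d * sqrt (2 * pi)) * (\<integral>x. Q (l + d * x) \<partial>gaussian)"
proof -
  interpret N: real_distribution gaussian by (rule real_dist_normal_dist)
  interpret P: pair_sigma_finite gaussian lborel ..
  note [measurable] = borel_measurable_integrable[OF Q]
  \<comment> \<open>Integrating this kernel over \<open>v\<close> first gives the Fourier transform,
    over \<open>x\<close> first the Gaussian weight.\<close>
  let ?F = "\<lambda>x v. Q v * exp (\<i> * of_real (x / d * (l - v)))"
  have "integrable (gaussian \<Otimes>\<^sub>M lborel) (\<lambda>(x, v). ?F x v)"
  proof (rule P.Fubini_integrable)
    show "(\<lambda>(x, v). ?F x v) \<in> borel_measurable (gaussian \<Otimes>\<^sub>M lborel)"
      unfolding split_beta' by measurable
    show "integrable gaussian (\<lambda>x. \<integral>v. norm ((\<lambda>(x, v). ?F x v) (x, v)) \<partial>lborel)"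
      by (simp add: norm_mult)
    show "AE x in gaussian. integrable lborel (\<lambda>v. (\<lambda>(x, v). ?F x v) (x, v))"
    proof (rule AE_I2)
      fix x
      have "integrable lborel (\<lambda>v. ?F x v)"
        by (rule Bochner_Integration.integrable_bound[OF Q]) (auto simp: norm_mult)
      thus "integrable lborel (\<lambda>v. (\<lambda>(x, v). ?F x v) (x, v))" by simp
    qed
  qed
  note int = this
  have split: "(\<integral>v. ?F x v \<partial>lborel) = Qh (x / d) * exp (\<i> * of_real (x / d * l))" for x
  proof -
    have "\<i> * of_real (x / d * (l - v)) = - (\<i> * of_real (x / d * v)) + \<i> * of_real (x / d * l)" for v
      by (simp add: algebra_simps diff_divide_distrib)
    hence "?F x v = Q v * exp (- (\<i> * of_real (x / d * v))) * exp (\<i> * of_real (x / d * l))" for v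
      by (simp only: exp_add mult.assoc)
    hence "?F x = (\<lambda>v. Q v * exp (- (\<i> * of_real (x / d * v))) * exp (\<i> * of_real (x / d * l)))" by (rule ext)
    thus ?thesis by (simp only: Qh_def integral_mult_left_zero)
  qed
  show "integrable gaussian (\<lambda>x. Qh (x / d) * exp (\<i> * of_real (x / d * l)))"
    using P.integrable_fst'[OF int] by (simp only: split prod.case)
  have ch: "(\<integral>x. exp (\<i> * of_real (x * u)) \<partial>gaussian) = of_real (exp (- (u ^ 2) / 2))" for u
  proof -
    have "char gaussian u = of_real (exp (- (u ^ 2) / 2))" by (simp add: char_std_normal_distribution)
    thus ?thesis by (simp add: char_def mult.commute)
  qed
  have "(\<integral>x. Qh (x / d) * exp (\<i> * of_real (x / d * l)) \<partial>gaussian) =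
     (\<integral>v. (\<integral>x. ?F x v \<partial>gaussian) \<partial>lborel)"
    using P.Fubini_integral[OF int] by (simp only: split)
  also have "\<dots> = (\<integral>v. Q v * of_real (exp (- (((l - v) / d) ^ 2) / 2)) \<partial>lborel)"
  proof (intro Bochner_Integration.integral_cong refl)
    fix v
    have "(\<integral>x. ?F x v \<partial>gaussian) = Q v * (\<integral>x. exp (\<i> * of_real (x * ((l - v) / d))) \<partial>gaussian)"
      by simp
    thus "(\<integral>x. ?F x v \<partial>gaussian) = Q v * of_real (exp (- (((l - v) / d) ^ 2) / 2))"
      by (simp only: ch)
  qed
  \<comment> \<open>The substitution \<open>v = l + d * x\<close> turns the characteristic function
    back into a Gaussian density, short of the factor \<open>1 / sqrt (2 * pi)\<close>.\<close>
  also have "\<dots> = \<bar>d\<bar> *\<^sub>R (\<integral>x. Q (l + d * x) * of_real (exp (- (((l - (l + d * x)) / d) ^ 2) / 2)) \<partial>lborel)"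
    by (rule lborel_integral_real_affine) (use d in auto)
  also have "(\<integral>x. Q (l + d * x) * of_real (exp (- (((l - (l + d * x)) / d) ^ 2) / 2)) \<partial>lborel) =
     (\<integral>x. of_real (sqrt (2 * pi)) * (normal_density 0 1 x *\<^sub>R Q (l + d * x)) \<partial>lborel)"
    using d by (intro Bochner_Integration.integral_cong refl) (simp add: normal_density_def scaleR_conv_of_real)
  also have "\<dots> = of_real (sqrt (2 * pi)) * (\<integral>x. Q (l + d * x) \<partial>gaussian)"
  proof -
    have "(\<integral>x. Q (l + d * x) \<partial>gaussian) = (\<integral>x. normal_density 0 1 x *\<^sub>R Q (l + d * x) \<partial>lborel)"
      by (subst integral_density) (auto simp: normal_density_nonneg)
    thus ?thesis by (simp only: integral_mult_right_zero)
  qed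
  finally show "(\<integral>x. Qh (x / d) * exp (\<i> * of_real (x / d * l)) \<partial>gaussian) =
       of_real (d * sqrt (2 * pi)) * (\<integral>x. Q (l + d * x) \<partial>gaussian)"
    using d by (simp add: scaleR_conv_of_real)
qed

text \<open>The three summands stem from the singular part of the transform, integrated against a
  density that is at most 1; from the linearly growing part, controlled by the first absolute moment
  at scale \<open>1 / d\<close>; and from the oscillation of \<open>Q\<close> at distance about
  \<open>d\<close> from \<open>l\<close>. The term \<open>e'\<close> in the Lipschitz condition
  admits functions with small jumps.\<close>

lemma gaussian_smoothing_bound:
  fixes Q :: "real \<Rightarrow> complex"
  assumes Q: "integrable lborel Q" and d: "d > 0" and e: "e > 0" and B: "B1 \<ge> 0" "B2 \<ge> 0" and K: "K \<ge> 0" "e' \<ge> 0"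
    and lip: "\<And>v. norm (Q v - Q l) \<le> K * (\<bar>v - l\<bar> + e')"
    and Qh: "\<And>t. norm (fourier Q t) \<le> B1 / (e ^ 2 + t ^ 2) + B2 * (\<bar>t\<bar> + 5)"
  shows "norm (Q l) \<le> B1 * pi / e + B2 * (1 / d ^ 2 + 5 / d) + K * (d + e')"
proof -
  interpret N: real_distribution gaussian by (rule real_dist_normal_dist)
  note [measurable] = borel_measurable_integrable[OF Q]
  define h where "h t = (fourier Q t)" for t
  note id = gaussian_smoothing_identity[OF Q d, of l, folded h_def]
  have i1: "integrable lborel (\<lambda>x. normal_density 0 1 x * (1 / (e ^ 2 + (x / d) ^ 2)))"
    and v1: "(\<integral>x. normal_density 0 1 x * (1 / (e ^ 2 + (x / d) ^ 2)) \<partial>lborel) \<le> d * (pi / e)"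
  proof -
    have dens: "normal_density 0 1 x \<le> 1" for x
    proof -
      have "normal_density 0 1 x = exp (- (x ^ 2 / 2)) / sqrt (2 * pi)" by (simp add: normal_density_def)
      also have "\<dots> \<le> 1 / 1" using pi_gt3 by (intro frac_le) auto
      finally show ?thesis by simp
    qed
    have i: "integrable lborel (\<lambda>x. 1 / (e ^ 2 + (0 + (1 / d) * x) ^ 2))"
      by (rule lborel_integrable_real_affine[OF integrable_inverse_square_sum(1)[OF e]]) (use d in auto)
    have "pi / e = \<bar>1 / d\<bar> *\<^sub>R (\<integral>x. 1 / (e ^ 2 + (0 + (1 / d) * x) ^ 2) \<partial>lborel)"
      unfolding integrable_inverse_square_sum(2)[OF e, symmetric]
      by (rule lborel_integral_real_affine) (use d in auto)
    hence v: "(\<integral>x. 1 / (e ^ 2 + (0 + (1 / d) * x) ^ 2) \<partial>lborel) = d * (pi / e)" using d by simp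
    show i1: "integrable lborel (\<lambda>x. normal_density 0 1 x * (1 / (e ^ 2 + (x / d) ^ 2)))"
      by (rule Bochner_Integration.integrable_bound[OF i])
         (auto simp: normal_density_nonneg dens abs_mult intro!: AE_I2 divide_right_mono)
    have "(\<integral>x. normal_density 0 1 x * (1 / (e ^ 2 + (x / d) ^ 2)) \<partial>lborel) \<le> (\<integral>x. 1 / (e ^ 2 + (0 + (1 / d) * x) ^ 2) \<partial>lborel)"
      by (rule integral_mono[OF i1 i]) (auto simp: dens intro!: divide_right_mono)
    thus "(\<integral>x. normal_density 0 1 x * (1 / (e ^ 2 + (x / d) ^ 2)) \<partial>lborel) \<le> d * (pi / e)" unfolding v by simp
  qed
  have i1': "integrable gaussian (\<lambda>x. 1 / (e ^ 2 + (x / d) ^ 2))"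
    by (subst integrable_density) (use i1 in \<open>auto simp: normal_density_nonneg\<close>)
  have v1': "(\<integral>x. 1 / (e ^ 2 + (x / d) ^ 2) \<partial>gaussian) \<le> d * (pi / e)"
    by (subst integral_density) (use v1 in \<open>auto simp: normal_density_nonneg\<close>)
  note m = std_normal_abs_moment
  have ib: "integrable gaussian (\<lambda>x. B1 * (1 / (e ^ 2 + (x / d) ^ 2)) + B2 * (\<bar>x\<bar> / d + 5))"
    using i1' m(1) by (intro Bochner_Integration.integrable_add integrable_mult_right) auto
  have "norm (\<integral>x. h (x / d) * exp (\<i> * of_real (x / d * l)) \<partial>gaussian) \<le>
     (\<integral>x. B1 * (1 / (e ^ 2 + (x / d) ^ 2)) + B2 * (\<bar>x\<bar> / d + 5) \<partial>gaussian)"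
  proof (rule Bochner_Integration.integral_norm_bound_integral[OF id(1) ib])
    fix x
    have "norm (h (x / d) * exp (\<i> * of_real (x / d * l))) = norm (h (x / d))"
      by (simp add: norm_mult)
    also have "\<dots> \<le> B1 / (e ^ 2 + (x / d) ^ 2) + B2 * (\<bar>x / d\<bar> + 5)" unfolding h_def by (rule Qh)
    finally show "norm (h (x / d) * exp (\<i> * of_real (x / d * l))) \<le> B1 * (1 / (e ^ 2 + (x / d) ^ 2)) + B2 * (\<bar>x\<bar> / d + 5)"
      using d by simp
  qed
  also have "\<dots> = B1 * (\<integral>x. 1 / (e ^ 2 + (x / d) ^ 2) \<partial>gaussian) + B2 * ((\<integral>x. \<bar>x\<bar> \<partial>gaussian) / d + 5)"
  proof -
    have ia: "integrable gaussian (\<lambda>x. \<bar>x\<bar> / d)" using m(1) by (rule integrable_divide)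
    have "(\<integral>x. \<bar>x\<bar> / d + 5 \<partial>gaussian) = (\<integral>x. \<bar>x\<bar> / d \<partial>gaussian) + (\<integral>x. 5 \<partial>gaussian)"
      by (rule Bochner_Integration.integral_add[OF ia]) simp
    also have "\<dots> = (\<integral>x. \<bar>x\<bar> \<partial>gaussian) / d + 5" using N.prob_space by simp
    finally have 5: "(\<integral>x. \<bar>x\<bar> / d + 5 \<partial>gaussian) = (\<integral>x. \<bar>x\<bar> \<partial>gaussian) / d + 5" .
    have ia5: "integrable gaussian (\<lambda>x. \<bar>x\<bar> / d + 5)" by (rule Bochner_Integration.integrable_add[OF ia]) simp
    show ?thesis
      by (subst Bochner_Integration.integral_add[OF integrable_mult_right[OF i1'] integrable_mult_right[OF ia5]])
         (simp only: integral_mult_right_zero 5)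
  qed
  also have "\<dots> \<le> B1 * (d * (pi / e)) + B2 * (1 / d + 5)"
    using v1' m(2) B d by (intro add_mono mult_left_mono divide_right_mono) auto
  finally have main: "norm (\<integral>x. h (x / d) * exp (\<i> * of_real (x / d * l)) \<partial>gaussian) \<le> B1 * (d * (pi / e)) + B2 * (1 / d + 5)" .
  define A where "A = (\<integral>x. Q (l + d * x) \<partial>gaussian)"
  \<comment> \<open>The factor \<open>sqrt (2 * pi)\<close> exceeds 1 and is given away.\<close>
  have "d * 1 \<le> d * sqrt (2 * pi)" using d pi_gt3 by (intro mult_left_mono) auto
  hence "d * norm A \<le> d * sqrt (2 * pi) * norm A" by (intro mult_right_mono) auto
  also have "\<dots> = norm (of_real (d * sqrt (2 * pi)) * A)" using d by (simp add: norm_mult)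
  also have "\<dots> \<le> B1 * (d * (pi / e)) + B2 * (1 / d + 5)" using main unfolding id(2) A_def .
  also have "\<dots> = d * (B1 * pi / e + B2 * (1 / d ^ 2 + 5 / d))"
    using d by (simp add: field_simps power2_eq_square)
  finally have nA: "norm A \<le> B1 * pi / e + B2 * (1 / d ^ 2 + 5 / d)" using d by simp
  have iK: "integrable gaussian (\<lambda>x. K * (d * \<bar>x\<bar> + e'))"
    using m(1) by (intro integrable_mult_right Bochner_Integration.integrable_add) auto
  have bd: "norm (Q (l + d * x) - Q l) \<le> K * (d * \<bar>x\<bar> + e')" for x
    using lip[of "l + d * x"] d by (simp add: abs_mult)
  have iD: "integrable gaussian (\<lambda>x. Q (l + d * x) - Q l)"
    by (rule Bochner_Integration.integrable_bound[OF iK])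
       (use bd in \<open>auto intro!: AE_I2 order_trans[OF bd abs_ge_self]\<close>)
  have "A - Q l = (\<integral>x. Q (l + d * x) - Q l \<partial>gaussian)"
  proof -
    have "integrable gaussian (\<lambda>x. (Q (l + d * x) - Q l) + Q l)"
      using iD by (intro Bochner_Integration.integrable_add) auto
    hence "integrable gaussian (\<lambda>x. Q (l + d * x))" by simp
    thus ?thesis unfolding A_def using N.prob_space by simp
  qed
  also have "norm \<dots> \<le> (\<integral>x. K * (d * \<bar>x\<bar> + e') \<partial>gaussian)"
    by (rule Bochner_Integration.integral_norm_bound_integral[OF iD iK]) (rule bd)
  also have "\<dots> = K * (d * (\<integral>x. \<bar>x\<bar> \<partial>gaussian) + e')"
    using m(1) N.prob_space by simp
  also have "\<dots> \<le> K * (d * 1 + e')" using K d m(2) by (intro mult_left_mono add_right_mono) auto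
  finally have "norm (A - Q l) \<le> K * (d + e')" by simp
  moreover have "norm (Q l) \<le> norm A + norm (A - Q l)" by (metis norm_minus_commute norm_triangle_sub)
  ultimately show ?thesis using nA by linarith
qed

section \<open>The summatory function and the model\<close>

text \<open>The variable is the logarithm of the cut-off, which makes partial summation a Laplace
  transform; negative \<open>v\<close> give the empty sum.\<close>

definition omega_sum :: "complex \<Rightarrow> real \<Rightarrow> complex" where
  "omega_sum z v = (\<Sum>n = 1..nat \<lfloor>exp v\<rfloor>. z ^ omega n)"

lemma omega_sum_neg: "v < 0 \<Longrightarrow> omega_sum z v = 0"
proof -
  assume "v < 0"
  hence "\<lfloor>exp v\<rfloor> = 0" by (intro floor_eq_iff[THEN iffD2]) auto
  thus ?thesis by (simp add: omega_sum_def)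
qed

lemma nat_floor_exp: "real (nat \<lfloor>exp v\<rfloor>) \<le> exp v" "exp v < real (nat \<lfloor>exp v\<rfloor>) + 1"
proof -
  have "(0::int) \<le> \<lfloor>exp v\<rfloor>" by simp
  thus "real (nat \<lfloor>exp v\<rfloor>) \<le> exp v" "exp v < real (nat \<lfloor>exp v\<rfloor>) + 1" by linarith+
qed

lemma norm_omega_sum_diff_le:
  assumes z: "norm z = 1" and vw: "v \<le> w"
  shows "norm (omega_sum z w - omega_sum z v) \<le> exp w - exp v + 1"
proof -
  define m n where "m = nat \<lfloor>exp v\<rfloor>" and "n = nat \<lfloor>exp w\<rfloor>"
  have mn: "m \<le> n" unfolding m_def n_def using vw by (intro nat_mono floor_mono) auto
  have "omega_sum z w - omega_sum z v = (\<Sum>i\<in>{1..n} - {1..m}. z ^ omega i)"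
    unfolding omega_sum_def m_def[symmetric] n_def[symmetric] using mn by (subst sum_diff) auto
  also have "norm \<dots> \<le> (\<Sum>i\<in>{1..n} - {1..m}. norm (z ^ omega i))" by (rule norm_sum)
  also have "\<dots> = real (card ({1..n} - {1..m}))" using z by (simp add: norm_power)
  also have "card ({1..n} - {1..m}) = n - m" using mn by (subst card_Diff_subset) auto
  also have "real (n - m) \<le> exp w - exp v + 1"
    unfolding of_nat_diff[OF mn]
    using nat_floor_exp[of v, folded m_def] nat_floor_exp[of w, folded n_def] by linarith
  finally show ?thesis .
qed

lemma norm_omega_sum_le:
  assumes z: "norm z = 1"
  shows "norm (omega_sum z v) \<le> exp v"
proof -
  have "norm (omega_sum z v) \<le> (\<Sum>i=1..nat \<lfloor>exp v\<rfloor>. norm (z ^ omega i))" unfolding omega_sum_def by (rule norm_sum)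
  also have "\<dots> = real (nat \<lfloor>exp v\<rfloor>)" using z by (simp add: norm_power)
  also have "\<dots> \<le> exp v" by (rule nat_floor_exp)
  finally show ?thesis .
qed

lemma measurable_omega_sum [measurable]: "omega_sum z \<in> borel_measurable borel"
proof -
  have "omega_sum z = (\<lambda>m. \<Sum>n = 1..nat m. z ^ omega n) \<circ> (\<lambda>v. \<lfloor>exp v\<rfloor>)"
    by (simp add: fun_eq_iff omega_sum_def)
  moreover have "(\<lambda>v::real. \<lfloor>exp v\<rfloor>) \<in> measurable borel (count_space UNIV)" by measurable
  moreover have "(\<lambda>m. \<Sum>n = 1..nat m. z ^ omega n) \<in> measurable (count_space UNIV) borel" by simp
  ultimately show ?thesis by (simp only: measurable_comp)
qed

lemma has_bochner_integral_exp_tail: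
  fixes x a :: real assumes x: "x > 0"
  shows "has_bochner_integral lborel (\<lambda>v. indicator {a..} v * exp (- (x * v))) (exp (- (x * a)) / x)"
proof (rule has_bochner_integral_nn_integral)
  have "(\<integral>\<^sup>+v. ennreal (exp (- (x * v))) * indicator {a..} v \<partial>lborel) = ennreal (0 - (- (exp (- (x * a)) / x)))"
  proof (rule nn_integral_FTC_atLeast)
    show "((\<lambda>v. - (exp (- (x * v)) / x)) \<longlongrightarrow> 0) at_top"
      using x by real_asymp
    show "DERIV (\<lambda>v. - (exp (- (x * v)) / x)) v :> exp (- (x * v))" if "a \<le> v" for v
      using x by (auto intro!: derivative_eq_intros)
  qed auto
  thus "(\<integral>\<^sup>+v. ennreal (indicator {a..} v * exp (- (x * v))) \<partial>lborel) = ennreal (exp (- (x * a)) / x)"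
    by (simp add: ennreal_mult' ennreal_indicator mult.commute)
qed (use x in auto)

lemma laplace_ok_omega_sum:
  assumes z: "norm z = 1"
  shows "laplace_ok 1 (omega_sum z)"
  unfolding laplace_ok_def
proof (intro conjI allI impI measurable_omega_sum)
  show "omega_sum z v = 0" if "v < 0" for v using that by (rule omega_sum_neg)
  fix c :: real assume c: "c > 1"
  show "integrable lborel (\<lambda>v. norm (omega_sum z v) * exp (- (c * v)))"
  proof (rule Bochner_Integration.integrable_bound)
    show "integrable lborel (\<lambda>v. indicator {0..} v * exp (- ((c - 1) * v)))"
      using has_bochner_integral_exp_tail[of "c - 1" 0] c by (auto simp: has_bochner_integral_iff)
    show "AE v in lborel. norm (norm (omega_sum z v) * exp (- (c * v))) \<le> norm (indicator {0..} v * exp (- ((c - 1) * v)))"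
    proof (rule AE_I2)
      fix v :: real
      show "norm (norm (omega_sum z v) * exp (- (c * v))) \<le> norm (indicator {0..} v * exp (- ((c - 1) * v)))"
      proof (cases "v < 0")
        case False
        have "norm (omega_sum z v) * exp (- (c * v)) \<le> exp v * exp (- (c * v))"
          by (intro mult_right_mono norm_omega_sum_le z) auto
        also have "\<dots> = exp (- ((c - 1) * v))" by (simp add: exp_add[symmetric] algebra_simps)
        finally show ?thesis using False by simp
      qed (simp add: omega_sum_neg)
    qed
  qed measurable
qed

text \<open>The summatory function is a weighted sum of unit steps at the points
  \<open>ln n\<close>, and such a step has transform \<open>n powr (-x) / x\<close>. Absolute
  convergence of the Dirichlet series justifies the interchange.\<close>

lemma laplace_omega_sum_real:
  assumes z: "norm z = 1" and x: "x > 1"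
  shows "laplace (omega_sum z) (of_real x) = omega_transform z (of_real x)"
proof -
  define a where "a n = z ^ omega (Suc n)" for n
  define f where "f n v = a n * of_real (indicator {ln (real (Suc n))..} v * exp (- (x * v)))" for n v
  have na: "norm (a n) = 1" for n using z by (simp add: a_def norm_power)
  have pw: "exp (- (x * ln (real (Suc n)))) = real (Suc n) powr (-x)" for n by (simp add: powr_def)
  have int: "has_bochner_integral lborel (\<lambda>v. indicator {ln (real (Suc n))..} v * exp (- (x * v))) (real (Suc n) powr (-x) / x)" for n
    using has_bochner_integral_exp_tail[of x "ln (real (Suc n))"] x unfolding pw by simp
  \<comment> \<open>Only steps located at or before \<open>v\<close> contribute, so the sum is
    finite for each \<open>v\<close>; the index \<open>n\<close> stands for the integer
    \<open>Suc n\<close>.\<close>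
  have ev: "f n v = 0" if "n \<ge> nat \<lfloor>exp v\<rfloor>" for n v
  proof -
    have "exp v < real (Suc n)" using nat_floor_exp(2)[of v] of_nat_mono[OF that, where 'a = real] by linarith
    hence "v < ln (real (Suc n))" by (metis exp_gt_zero ln_exp ln_less_cancel_iff order_less_trans)
    thus ?thesis by (simp add: f_def)
  qed
  have sumf: "(\<Sum>n. f n v) = omega_sum z v * exp (- (of_real x * of_real v))" for v
  proof -
    have "(\<Sum>n. f n v) = (\<Sum>n<nat \<lfloor>exp v\<rfloor>. f n v)"
      by (rule suminf_finite) (use ev in auto)
    also have "\<dots> = (\<Sum>n<nat \<lfloor>exp v\<rfloor>. a n * exp (- (of_real x * of_real v)))"
    proof (intro sum.cong refl)
      fix n assume "n \<in> {..<nat \<lfloor>exp v\<rfloor>}"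
      hence "real (Suc n) \<le> exp v" using nat_floor_exp(1)[of v] by (simp add: less_eq_Suc_le) linarith
      hence "ln (real (Suc n)) \<le> v" by (metis ln_exp ln_mono of_nat_0_less_iff zero_less_Suc)
      thus "f n v = a n * exp (- (of_real x * of_real v))" by (simp add: f_def exp_of_real[symmetric])
    qed
    also have "\<dots> = (\<Sum>n<nat \<lfloor>exp v\<rfloor>. a n) * exp (- (of_real x * of_real v))" by (simp add: sum_distrib_right)
    also have "(\<Sum>n<nat \<lfloor>exp v\<rfloor>. a n) = omega_sum z v"
      unfolding omega_sum_def a_def by (rule sum.reindex_bij_witness[of _ "\<lambda>n. n - 1" Suc]) auto
    finally show ?thesis .
  qed
  have fi: "integrable lborel (f n)" for n unfolding f_def
    using int[of n] by (intro integrable_mult_right integrable_of_real) (auto simp: has_bochner_integral_iff)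
  have fv: "(\<integral>v. f n v \<partial>lborel) = a n * of_nat (Suc n) powr (- of_real x) / of_real x" for n
  proof -
    have "(\<integral>v. f n v \<partial>lborel) = a n * of_real (real (Suc n) powr (-x) / x)"
      by (simp only: f_def integral_mult_right_zero integral_complex_of_real has_bochner_integral_integral_eq[OF int])
    thus ?thesis using powr_of_real[of "real (Suc n)" "-x"] by simp
  qed
  have fn: "(\<integral>v. norm (f n v) \<partial>lborel) = real (Suc n) powr (-x) / x" for n
  proof -
    have "norm (f n v) = indicator {ln (real (Suc n))..} v * exp (- (x * v))" for v
      unfolding f_def norm_mult na norm_of_real by (simp add: abs_mult indicator_def)
    thus ?thesis using int[of n] by (simp add: has_bochner_integral_iff)
  qed
  have "(\<integral>v. (\<Sum>n. f n v) \<partial>lborel) = (\<Sum>n. \<integral>v. f n v \<partial>lborel)"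
  proof (rule integral_suminf[OF fi])
    show "AE v in lborel. summable (\<lambda>n. norm (f n v))"
      using ev by (intro AE_I2 summable_finite[of "{..<nat \<lfloor>exp v\<rfloor>}" for v]) (auto simp: not_less)
    show "summable (\<lambda>n. \<integral>v. norm (f n v) \<partial>lborel)"
      unfolding fn by (intro summable_divide summable_Suc_powr) (use x in auto)
  qed
  also have "\<dots> = (\<Sum>n. a n * of_nat (Suc n) powr (- of_real x)) / of_real x"
    unfolding fv
    by (rule suminf_divide) (use summable_norm_cancel[OF summable_omega_series[OF z, of "of_real x"]] x in \<open>simp add: a_def\<close>)
  finally show ?thesis unfolding laplace_def sumf omega_transform_def omega_series_def a_def by simp
qed

lemma laplace_omega_sum:
  assumes "norm z = 1" "Re s > 1"
  shows "laplace (omega_sum z) s = omega_transform z s"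
  by (rule eq_on_halfplane_if_eq_on_reals[OF holomorphic_laplace[OF laplace_ok_omega_sum] holomorphic_omega_transform])
     (use assms laplace_omega_sum_real in auto)

text \<open>The exponent is \<open>a - 1\<close> so that the transform is
  \<open>Gamma a * s powr (-a)\<close>.\<close>

definition pow_plus :: "complex \<Rightarrow> real \<Rightarrow> complex" where
  "pow_plus a v = (if v > 0 then of_real v powr (a - 1) else 0)"

lemma measurable_pow_plus [measurable]: "pow_plus a \<in> borel_measurable borel"
proof -
  have "(\<lambda>v. indicator {0<..} v *\<^sub>R exp ((a - 1) * of_real (ln v))) \<in> borel_measurable borel" by measurable
  also have "(\<lambda>v. indicator {0<..} v *\<^sub>R exp ((a - 1) * of_real (ln v))) = pow_plus a"
    by (auto simp: pow_plus_def fun_eq_iff powr_def Ln_of_real)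
  finally show ?thesis .
qed

lemma pow_plus_integrable:
  assumes "Re a > 0" "c > 0"
  shows "integrable lborel (\<lambda>v. pow_plus a v * of_real (exp (- (c * v))))"
proof -
  have "set_integrable lebesgue {0<..} (\<lambda>t. complex_of_real t powr (a - 1) / of_real (exp (c * t)))"
    by (rule absolutely_integrable_Gamma_integral) fact+
  hence "integrable lebesgue (\<lambda>t. indicator {0<..} t *\<^sub>R (complex_of_real t powr (a - 1) / of_real (exp (c * t))))"
    by (simp add: set_integrable_def)
  also have "(\<lambda>t. indicator {0<..} t *\<^sub>R (complex_of_real t powr (a - 1) / of_real (exp (c * t)))) =
     (\<lambda>v. pow_plus a v * of_real (exp (- (c * v))))"
    by (auto simp: pow_plus_def fun_eq_iff exp_minus field_simps)
  finally show ?thesis by (subst (asm) integrable_completion) measurable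
qed

lemma laplace_ok_pow_plus:
  assumes "Re a > 0"
  shows "laplace_ok 0 (pow_plus a)"
  unfolding laplace_ok_def
proof (intro conjI allI impI measurable_pow_plus)
  fix c :: real assume "c > 0"
  from integrable_norm[OF pow_plus_integrable[OF assms this]]
  show "integrable lborel (\<lambda>v. norm (pow_plus a v) * exp (- (c * v)))" by (simp add: norm_mult)
qed (simp add: pow_plus_def)

lemma laplace_pow_plus_real:
  assumes a: "Re a > 0" and x: "x > 0"
  shows "laplace (pow_plus a) (of_real x) = Gamma a * of_real x powr (-a)"
proof -
  have "(\<integral>v. pow_plus a v * of_real (exp (- (1 * v))) \<partial>lborel) = Gamma a"
  proof -
    have "((\<lambda>t. of_real t powr (a - 1) / of_real (exp t)) has_integral Gamma a) {0<..}"
      by (rule Gamma_integral_complex') fact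
    hence "((\<lambda>t. if t \<in> {0<..} then of_real t powr (a - 1) / of_real (exp t) else 0) has_integral Gamma a) UNIV"
      by (subst has_integral_restrict_UNIV)
    also have "(\<lambda>t. if t \<in> {0<..} then of_real t powr (a - 1) / of_real (exp t) else 0) =
       (\<lambda>v. pow_plus a v * of_real (exp (- (1 * v))))"
      by (auto simp: pow_plus_def fun_eq_iff exp_minus field_simps)
    finally have "((\<lambda>v. pow_plus a v * of_real (exp (- (1 * v)))) has_integral Gamma a) UNIV" .
    moreover have "((\<lambda>v. pow_plus a v * of_real (exp (- (1 * v)))) has_integral
        (\<integral>v. pow_plus a v * of_real (exp (- (1 * v))) \<partial>lborel)) UNIV"
      by (rule has_integral_integral_lborel[OF pow_plus_integrable[OF a]]) simp
    ultimately show ?thesis using has_integral_unique by blast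
  qed
  hence "Gamma a = \<bar>x\<bar> *\<^sub>R (\<integral>v. pow_plus a (0 + x * v) * of_real (exp (- (1 * (0 + x * v)))) \<partial>lborel)"
    using lborel_integral_real_affine[of x "\<lambda>v. pow_plus a v * of_real (exp (- (1 * v)))" 0] x by simp
  also have "(\<lambda>v. pow_plus a (0 + x * v) * of_real (exp (- (1 * (0 + x * v))))) =
     (\<lambda>v. of_real x powr (a - 1) * (pow_plus a v * exp (- (of_real x * of_real v))))"
  proof
    fix v
    have "of_real (exp (- (1 * (0 + x * v)))) = exp (- (of_real x * complex_of_real v))"
      by (simp add: exp_of_real[symmetric])
    moreover have "pow_plus a (0 + x * v) = of_real x powr (a - 1) * pow_plus a v"
      using x powr_times_real[of "of_real x" "of_real v :: complex" "a - 1"]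
      by (auto simp: pow_plus_def zero_less_mult_iff)
    ultimately show "pow_plus a (0 + x * v) * of_real (exp (- (1 * (0 + x * v)))) =
      of_real x powr (a - 1) * (pow_plus a v * exp (- (of_real x * of_real v)))" by simp
  qed
  also have "(\<integral>v. of_real x powr (a - 1) * (pow_plus a v * exp (- (of_real x * of_real v))) \<partial>lborel) =
     of_real x powr (a - 1) * laplace (pow_plus a) (of_real x)"
    by (simp add: laplace_def)
  finally have "Gamma a = of_real x powr 1 * of_real x powr (a - 1) * laplace (pow_plus a) (of_real x)"
    using x by (simp add: scaleR_conv_of_real)
  also have "of_real x powr 1 * of_real x powr (a - 1) = of_real x powr a"
    by (simp only: powr_add[symmetric]) simp
  finally show ?thesis using x by (simp add: powr_minus field_simps)
qed

lemma laplace_pow_plus: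
  assumes a: "Re a > 0" and s: "Re s > 0"
  shows "laplace (pow_plus a) s = Gamma a * s powr (-a)"
proof (rule eq_on_halfplane_if_eq_on_reals[OF holomorphic_laplace[OF laplace_ok_pow_plus[OF a]]])
  show "(\<lambda>s. Gamma a * s powr (-a)) holomorphic_on {s. Re s > 0}"
    by (intro holomorphic_intros) (auto simp: complex_nonpos_Reals_iff)
qed (use s laplace_pow_plus_real[OF a] in auto)

section \<open>Comparison of the summatory function with the model\<close>

definition leading_coeff :: "complex \<Rightarrow> complex" where
  "leading_coeff z = rGamma z * euler_G z 1"

text \<open>The factor \<open>v ^ 20\<close> of the model is merged into
  \<open>pow_plus (z + 20)\<close>, because \<open>v powr (z - 1)\<close> by itself is not
  absolutely integrable at 0 when \<open>Re z \<le> 0\<close>, whereas \<open>Re (z + 20)\<close> is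
  always positive.\<close>

definition weighted_diff :: "complex \<Rightarrow> real \<Rightarrow> real \<Rightarrow> complex" where
  "weighted_diff z l v = of_real (exp (- (v / l))) *
     (of_real v ^ 20 * (of_real (exp (- v)) * omega_sum z v) - leading_coeff z * pow_plus (z + 20) v)"

lemma leading_coeff_bound: "\<exists>C>0. \<forall>z. norm z = 1 \<longrightarrow> norm (leading_coeff z) \<le> C"
proof -
  have "bounded (rGamma ` sphere (0::complex) 1)"
    by (intro compact_imp_bounded compact_continuous_image compact_sphere continuous_on_rGamma)
  then obtain C where C: "C > 0" "\<And>z :: complex. norm z = 1 \<Longrightarrow> norm (rGamma z) \<le> C"
    unfolding bounded_pos by force
  have "norm (leading_coeff z) \<le> C * euler_bound" if "norm z = 1" for z
    unfolding leading_coeff_def norm_mult using C that norm_euler_G_le[OF that, of 1] by (intro mult_mono) auto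
  thus ?thesis using C by (intro exI[of _ "C * euler_bound"]) (simp add: euler_bound_def)
qed

lemma norm_pochhammer_le:
  assumes "norm (z :: complex) = 1"
  shows "norm (pochhammer z n) \<le> fact n"
proof (induction n)
  case (Suc n)
  have "norm (z + of_nat n) \<le> 1 + real n" using norm_triangle_ineq[of z "of_nat n"] assms by simp
  hence "norm (pochhammer z n) * norm (z + of_nat n) \<le> fact n * (1 + real n)" using Suc by (intro mult_mono) auto
  thus ?case by (simp add: pochhammer_Suc norm_mult mult.commute)
qed auto

text \<open>\<open>rGamma z * Gamma (z + 20)\<close> is the polynomial
  \<open>pochhammer z 20\<close>, so the model transforms exactly into the 20th derivative of
  \<open>euler_G z 1 * (s - 1) powr (-z)\<close>. This includes \<open>z = -1\<close>, where both
  coefficients are 0.\<close>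

lemma weighted_diff_transform:
  fixes t l :: real
  assumes z: "norm z = 1" and l: "l > 0"
  defines "s \<equiv> 1 + of_real (1 / l) + \<i> * of_real t"
  shows "integrable lborel (\<lambda>v. weighted_diff z l v * exp (- (\<i> * of_real (t * v))))"
    and "(fourier (weighted_diff z l) t) =
       (deriv ^^ 20) (omega_transform z) s - pochhammer z 20 * euler_G z 1 * (s - 1) powr (- z - 20)"
proof -
  have Rz: "Re (z + 20) > 0" using abs_Re_le_cmod[of z] z by simp
  have s: "Re s > 1" "Re (s - 1) > 0" using l by (auto simp: s_def)
  have eq: "weighted_diff z l v * exp (- (\<i> * of_real (t * v))) =
     of_real v ^ 20 * omega_sum z v * exp (- (s * of_real v)) - leading_coeff z * (pow_plus (z + 20) v * exp (- ((s - 1) * of_real v)))" for v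
  proof -
    have 1: "exp (- ((s - 1) * of_real v)) = of_real (exp (- (v / l))) * exp (- (\<i> * of_real (t * v)))"
      by (simp add: s_def exp_of_real[symmetric] exp_add[symmetric] algebra_simps)
    have 2: "exp (- (s * of_real v)) = of_real (exp (- (v / l))) * exp (- (\<i> * of_real (t * v))) * of_real (exp (- v))"
      by (simp add: s_def exp_of_real[symmetric] exp_add[symmetric] algebra_simps)
    show ?thesis unfolding 1 2 weighted_diff_def by (simp only: algebra_simps)
  qed
  have ok: "laplace_ok 1 (\<lambda>v. of_real v ^ 20 * omega_sum z v)"
    by (rule laplace_ok_power[OF laplace_ok_omega_sum[OF z]])
  have i1: "integrable lborel (\<lambda>v. of_real v ^ 20 * omega_sum z v * exp (- (s * of_real v)))"
    by (rule laplace_integrable[OF ok s(1)])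
  have i2: "integrable lborel (\<lambda>v. leading_coeff z * (pow_plus (z + 20) v * exp (- ((s - 1) * of_real v))))"
    by (rule integrable_mult_right[OF laplace_integrable[OF laplace_ok_pow_plus[OF Rz] s(2)]])
  show "integrable lborel (\<lambda>v. weighted_diff z l v * exp (- (\<i> * of_real (t * v))))"
    unfolding eq by (rule Bochner_Integration.integrable_diff[OF i1 i2])
  have "(fourier (weighted_diff z l) t) =
    laplace (\<lambda>v. of_real v ^ 20 * omega_sum z v) s - leading_coeff z * laplace (pow_plus (z + 20)) (s - 1)"
    unfolding eq Bochner_Integration.integral_diff[OF i1 i2] laplace_def integral_mult_right_zero ..
  also have "laplace (\<lambda>v. of_real v ^ 20 * omega_sum z v) s = (deriv ^^ 20) (laplace (omega_sum z)) s"
    unfolding higher_deriv_laplace[OF laplace_ok_omega_sum[OF z] s(1)] by simp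
  also have "\<dots> = (deriv ^^ 20) (omega_transform z) s"
    by (rule higher_deriv_transform_within_open[OF holomorphic_laplace[OF laplace_ok_omega_sum[OF z]] holomorphic_omega_transform[OF z] open_halfspace_Re_gt])
       (use s laplace_omega_sum[OF z] in auto)
  also have "laplace (pow_plus (z + 20)) (s - 1) = Gamma (z + 20) * (s - 1) powr (- (z + 20))"
    by (rule laplace_pow_plus[OF Rz s(2)])
  also have "leading_coeff z * (Gamma (z + 20) * (s - 1) powr (- (z + 20))) =
     pochhammer z 20 * euler_G z 1 * (s - 1) powr (- z - 20)"
  proof -
    have "z + 20 \<notin> \<int>\<^sub>\<le>\<^sub>0"
    proof
      assume "z + 20 \<in> \<int>\<^sub>\<le>\<^sub>0"
      then obtain n :: int where n: "z + 20 = of_int n" "n \<le> 0" by (elim nonpos_Ints_cases)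
      have "Re (z + 20) = of_int n" unfolding n(1) by simp
      thus False using Rz n(2) by simp
    qed
    hence "rGamma (z + 20) * Gamma (z + 20) = 1" by (simp add: rGamma_inverse_Gamma Gamma_eq_zero_iff)
    moreover have "rGamma z = pochhammer z 20 * rGamma (z + 20)" using pochhammer_rGamma[of z 20] by simp
    ultimately have "rGamma z * Gamma (z + 20) = pochhammer z 20" by (simp add: mult.assoc)
    moreover have "leading_coeff z * (Gamma (z + 20) * (s - 1) powr (- (z + 20))) =
       (rGamma z * Gamma (z + 20)) * euler_G z 1 * (s - 1) powr (- (z + 20))"
      by (simp only: leading_coeff_def mult_ac)
    moreover have "- (z + 20) = - z - 20" by simp
    ultimately show ?thesis by simp
  qed
  finally show "(fourier (weighted_diff z l) t) =
       (deriv ^^ 20) (omega_transform z) s - pochhammer z 20 * euler_G z 1 * (s - 1) powr (- z - 20)" .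
qed

text \<open>Near \<open>s = 1\<close> the error \<open>norm (s - 1) powr (1 - Re z - 20)\<close> is
  split into an integrable inverse square and a power with exponent \<open>- (Re z + 17)\<close>,
  which is at most \<open>l powr (Re z + 17)\<close> because
  \<open>norm (s - 1) \<ge> 1 / l\<close>. Away from 1 the transform and the model are bounded
  separately.\<close>

lemma weighted_diff_transform_bound:
  "\<exists>L0\<ge>2. \<exists>K1\<ge>0. \<exists>K2\<ge>0. \<forall>z l t. norm z = 1 \<and> l \<ge> L0 \<longrightarrow>
     norm (fourier (weighted_diff z l) t) \<le>
       K1 * l powr (Re z + 17) / ((1 / l) ^ 2 + t ^ 2) + K2 * l * (\<bar>t\<bar> + 5)"
proof -
  obtain r0 where r0: "r0 > 0" "r0 \<le> 1/200" "\<And>s. s \<in> ball 1 r0 \<Longrightarrow> norm (zeta_reg s - 1) \<le> 1/2"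
    using zeta_reg_near_one by auto
  \<comment> \<open>With \<open>l \<ge> 7 / r0\<close> and \<open>\<bar>t\<bar> < r0 / 6\<close> the
    point \<open>s\<close> lies in the ball of radius \<open>r0 / 3\<close> in which
    \<open>omega_transform_deriv_near\<close> applies.\<close>
  define \<tau> where "\<tau> = r0 / 6"
  have \<tau>: "\<tau> > 0" "\<tau> < 1" using r0 by (auto simp: \<tau>_def)
  obtain T where T: "T > 0" "\<And>z s. norm z = 1 \<Longrightarrow> 1 < Re s \<Longrightarrow> Re s \<le> 3/2 \<Longrightarrow> \<bar>Im s\<bar> \<ge> \<tau> \<Longrightarrow>
           norm ((deriv ^^ 20) (omega_transform z) s) \<le> T * (\<bar>Im s\<bar> + 5) / (Re s - 1)"
    using omega_transform_deriv_tail[OF \<tau>(1)] by auto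
  define K1 where "K1 = fact 20 * (exp pi * (9/4) * (exp 2 * euler_bound * 8 / r0)) * 2 ^ 20"
  \<comment> \<open>The exponent 21 is the largest value of \<open>Re z + 20\<close>, and \<tau> is
    below 1.\<close>
  define K3 where "K3 = fact 20 * euler_bound * (exp pi * (1 / \<tau>) ^ 21)"
  define L0 where "L0 = max 2 (7 / r0)"
  have K1: "K1 \<ge> 0" using r0 by (simp add: K1_def euler_bound_def)
  have K3: "K3 \<ge> 0" using \<tau> by (simp add: K3_def euler_bound_def)
  have "\<forall>z l t. norm z = 1 \<and> l \<ge> L0 \<longrightarrow>
     norm (fourier (weighted_diff z l) t) \<le>
       K1 * l powr (Re z + 17) / ((1 / l) ^ 2 + t ^ 2) + (T + K3) * l * (\<bar>t\<bar> + 5)"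
  proof (intro allI impI)
    fix z :: complex and l t :: real assume zl: "norm z = 1 \<and> l \<ge> L0"
    hence z: "norm z = 1" and l: "l \<ge> 2" "l \<ge> 7 / r0" by (auto simp: L0_def)
    have Rz: "\<bar>Re z\<bar> \<le> 1" using abs_Re_le_cmod[of z] z by simp
    have l0: "1 / l < r0 / 6" "1 / l \<le> 1/2"
    proof -
      have "7 \<le> r0 * l" using l r0 by (simp add: field_simps)
      hence "6 < r0 * l" by simp
      thus "1 / l < r0 / 6" using l by (simp add: field_simps)
      show "1 / l \<le> 1/2" using l by (simp add: field_simps)
    qed
    define s where "s = 1 + of_real (1 / l) + \<i> * of_real t"
    have s1: "s - 1 = Complex (1 / l) t" by (simp add: s_def complex_eq_iff)
    have Re_s: "Re s = 1 + 1 / l" "Im s = t" by (auto simp: s_def)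
    have ns: "norm (s - 1) ^ 2 = (1 / l) ^ 2 + t ^ 2" unfolding s1 by (simp add: cmod_power2)
    have ns1: "norm (s - 1) \<ge> 1 / l" "norm (s - 1) \<ge> \<bar>t\<bar>"
      using abs_Re_le_cmod[of "s - 1"] abs_Im_le_cmod[of "s - 1"] l by (auto simp: s1)
    have ns0: "norm (s - 1) > 0" using ns1(1) l by (smt (verit) divide_pos_pos)
    have sumpos: "(1 / l) ^ 2 + t ^ 2 > 0" using l by (intro add_pos_nonneg) auto
    have "norm ((deriv ^^ 20) (omega_transform z) s - pochhammer z 20 * euler_G z 1 * (s - 1) powr (- z - 20)) \<le>
       K1 * l powr (Re z + 17) / ((1 / l) ^ 2 + t ^ 2) + (T + K3) * l * (\<bar>t\<bar> + 5)"
    proof (cases "\<bar>t\<bar> < \<tau>")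
      case True
      have "norm (s - 1) \<le> \<bar>1 / l\<bar> + \<bar>t\<bar>" unfolding s1 using cmod_le[of "Complex (1 / l) t"] by simp
      hence "norm (s - 1) < r0 / 3" using True l0 l by (simp add: \<tau>_def)
      hence sb: "s \<in> ball 1 (r0 / 3)" by (simp add: dist_norm norm_minus_commute)
      have "norm ((deriv ^^ 20) (omega_transform z) s - (-1) ^ 20 * pochhammer z 20 * euler_G z 1 * (s - 1) powr (- z - of_nat 20))
        \<le> K1 * norm (s - 1) powr (1 - Re z - real 20)"
        unfolding K1_def by (rule omega_transform_deriv_near[OF r0]) (use z sb Re_s l in auto)
      hence "norm ((deriv ^^ 20) (omega_transform z) s - pochhammer z 20 * euler_G z 1 * (s - 1) powr (- z - 20))
        \<le> K1 * norm (s - 1) powr (1 - Re z - 20)" by simp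
      also have "norm (s - 1) powr (1 - Re z - 20) = norm (s - 1) powr (- (Re z + 17)) * norm (s - 1) powr (- 2)"
        unfolding powr_add[symmetric] by (rule arg_cong[where f = "\<lambda>x. _ powr x"]) simp
      also have "norm (s - 1) powr (- 2) = 1 / ((1 / l) ^ 2 + t ^ 2)"
        unfolding ns[symmetric] using ns0 by (simp add: powr_minus_divide)
      also have "norm (s - 1) powr (- (Re z + 17)) \<le> (1 / l) powr (- (Re z + 17))"
        using ns1 l Rz by (intro powr_mono2') auto
      also have "(1 / l) powr (- (Re z + 17)) = l powr (Re z + 17)"
        
        proof -
          have "(1 / l) powr (- x) = l powr x" for x using l by (simp add: powr_divide powr_minus_divide)
          thus ?thesis .
        qed
      finally have "norm ((deriv ^^ 20) (omega_transform z) s - pochhammer z 20 * euler_G z 1 * (s - 1) powr (- z - 20))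
        \<le> K1 * (l powr (Re z + 17) * (1 / ((1 / l) ^ 2 + t ^ 2)))"
        using K1 sumpos by (simp add: mult_left_mono mult_right_mono divide_right_mono)
      moreover have "(T + K3) * l * (\<bar>t\<bar> + 5) \<ge> 0" using T K3 l by (intro mult_nonneg_nonneg) auto
      ultimately show ?thesis by simp
    next
      case False
      have 1: "norm ((deriv ^^ 20) (omega_transform z) s) \<le> T * (\<bar>t\<bar> + 5) / (1 / l)"
        using T(2)[of z s] z Re_s l l0 False by simp
      have a: "norm (s - 1) \<ge> \<tau>" using ns1(2) False by linarith
      have "norm ((s - 1) powr (- z - 20)) = norm ((s - 1) powr (-z)) * norm ((s - 1) powr (- 20))"
        by (simp only: norm_mult[symmetric] powr_add[symmetric]) simp
      also have "\<dots> \<le> (exp pi * norm (s - 1) powr (- Re z)) * norm (s - 1) powr (- 20)"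
        using norm_powr_le[of "s - 1" z] ns0 z by (intro mult_mono) (auto simp: norm_powr_complex)
      also have "\<dots> = exp pi * norm (s - 1) powr (- (Re z + 20))"
        by (simp add: powr_add[symmetric] mult.assoc algebra_simps)
      also have "norm (s - 1) powr (- (Re z + 20)) \<le> \<tau> powr (- (Re z + 20))"
        using a \<tau> Rz by (intro powr_mono2') auto
      also have "\<tau> powr (- (Re z + 20)) \<le> \<tau> powr (- 21)" using \<tau> Rz by (intro powr_mono') auto
      also have "\<tau> powr (- 21) = (1 / \<tau>) ^ 21" using \<tau> by (simp add: powr_minus_divide power_divide)
      finally have p: "norm ((s - 1) powr (- z - 20)) \<le> exp pi * (1 / \<tau>) ^ 21" by simp
      have "norm (pochhammer z 20 * euler_G z 1 * (s - 1) powr (- z - 20)) \<le> K3"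
        unfolding norm_mult K3_def
        by (intro mult_mono norm_pochhammer_le norm_euler_G_le p z) (auto simp: euler_bound_def)
      also have "K3 \<le> K3 * l * (\<bar>t\<bar> + 5)"
      proof -
        have "1 * 1 \<le> l * (\<bar>t\<bar> + 5)" using l by (intro mult_mono) auto
        thus ?thesis using K3 mult_left_mono[of 1 "l * (\<bar>t\<bar> + 5)" K3] by (simp add: mult.assoc)
      qed
      finally have 2: "norm (pochhammer z 20 * euler_G z 1 * (s - 1) powr (- z - 20)) \<le> K3 * l * (\<bar>t\<bar> + 5)" .
      have "norm ((deriv ^^ 20) (omega_transform z) s - pochhammer z 20 * euler_G z 1 * (s - 1) powr (- z - 20)) \<le>
         T * (\<bar>t\<bar> + 5) / (1 / l) + K3 * l * (\<bar>t\<bar> + 5)"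
        by (rule order_trans[OF norm_triangle_ineq4 add_mono[OF 1 2]])
      also have "\<dots> = (T + K3) * l * (\<bar>t\<bar> + 5)" by (simp add: algebra_simps)
      also have "\<dots> \<le> K1 * l powr (Re z + 17) / ((1 / l) ^ 2 + t ^ 2) + (T + K3) * l * (\<bar>t\<bar> + 5)"
        using K1 sumpos by simp
      finally show ?thesis .
    qed
    moreover have "l > 0" using l by simp
    ultimately show "norm (fourier (weighted_diff z l) t) \<le>
       K1 * l powr (Re z + 17) / ((1 / l) ^ 2 + t ^ 2) + (T + K3) * l * (\<bar>t\<bar> + 5)"
      using weighted_diff_transform(2)[OF z, of l t] by (simp add: s_def)
  qed
  note main = this
  have h: "2 \<le> L0" "0 \<le> T + K3" using T K3 by (auto simp: L0_def)
  show ?thesis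
    by (rule exI[of _ L0], rule conjI[OF h(1)], rule exI[of _ K1], rule conjI[OF K1], rule exI[of _ "T + K3"],
        rule conjI[OF h(2)], rule main)
qed

section \<open>Slow variation of the weighted difference\<close>

definition weight_const :: real where "weight_const = 1 + fact 21"

text \<open>With \<open>y = v / l\<close>, both \<open>y powr b \<le> 1 + y ^ 21\<close> and
  \<open>y ^ 21 \<le> fact 21 * exp y\<close> hold; this is the origin of
  \<open>weight_const\<close>, which serves all exponents from 0 to 21.\<close>

lemma powr_exp_decay_bound:
  fixes b l v :: real
  assumes l: "l > 0" and v: "v \<ge> 0" and b: "0 \<le> b" "b \<le> 21"
  shows "v powr b * exp (- (v / l)) \<le> weight_const * l powr b"
proof -
  define y where "y = v / l"
  have y: "y \<ge> 0" using v l by (simp add: y_def)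
  have "y powr b \<le> 1 + y ^ 21"
  proof (cases "y \<le> 1")
    case True
    have "y powr b \<le> 1 powr b" using True y b by (intro powr_mono2) auto
    thus ?thesis using y by (simp add: add_increasing2)
  next
    case False
    have "y powr b \<le> y powr (real 21)" using False b by (intro powr_mono) auto
    also have "\<dots> = y ^ 21" using False by (intro powr_realpow) auto
    finally show ?thesis by simp
  qed
  also have "y ^ 21 \<le> fact 21 / 1 ^ 21 * exp (1 * y)" using y by (intro power_le_exp) auto
  also have "1 + fact 21 / 1 ^ 21 * exp (1 * y) \<le> weight_const * exp y"
    using y by (simp add: weight_const_def distrib_right)
  finally have "y powr b * exp (- y) \<le> weight_const * exp y * exp (- y)" by (intro mult_right_mono) auto
  hence "y powr b * exp (- y) \<le> weight_const" by (simp add: mult.assoc flip: exp_add)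
  moreover have "v powr b = l powr b * y powr b" using v l by (simp add: y_def powr_mult[symmetric])
  ultimately show ?thesis using mult_left_mono[of "y powr b * exp (- y)" weight_const "l powr b"]
    by (simp add: y_def mult_ac)
qed

text \<open>The condition \<open>1 \<le> Re \<beta>\<close> keeps the derivative bounded down to
  \<open>v = 0\<close>. The factor 41 bounds \<open>norm \<beta> + 1 / l\<close>. The exponents of
  interest are 20, for the sum, and \<open>z + 19\<close>, for the model.\<close>

lemma powr_exp_decay_lipschitz:
  fixes \<beta> :: complex and l :: real
  assumes l: "l \<ge> 1" and \<beta>: "1 \<le> Re \<beta>" "Re \<beta> \<le> 20" "norm \<beta> \<le> 40"
  defines "\<phi> \<equiv> \<lambda>v. of_real v powr \<beta> * of_real (exp (- (v / l))) :: complex"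
  shows "v > 0 \<Longrightarrow> norm (\<phi> v) \<le> weight_const * l ^ 20"
    and "v > 0 \<Longrightarrow> w > 0 \<Longrightarrow> norm (\<phi> v - \<phi> w) \<le> 41 * weight_const * l ^ 20 * \<bar>v - w\<bar>"
proof -
  have W: "weight_const \<ge> 0" by (simp add: weight_const_def)
  have bd: "norm (of_real v powr \<gamma> * of_real (exp (- (v / l))) :: complex) \<le> weight_const * l ^ 20"
    if v: "v > 0" and \<gamma>: "0 \<le> Re \<gamma>" "Re \<gamma> \<le> 20" for v \<gamma>
  proof -
    have "norm (of_real v powr \<gamma> * of_real (exp (- (v / l))) :: complex) = v powr Re \<gamma> * exp (- (v / l))"
      using v by (simp add: norm_mult norm_powr_real_powr)
    also have "\<dots> \<le> weight_const * l powr Re \<gamma>" using l v \<gamma> by (intro powr_exp_decay_bound) auto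
    also have "\<dots> \<le> weight_const * l powr real 20" using l \<gamma> W by (intro mult_left_mono powr_mono) auto
    also have "l powr real 20 = l ^ 20" using l by (intro powr_realpow) auto
    finally show ?thesis .
  qed
  show "v > 0 \<Longrightarrow> norm (\<phi> v) \<le> weight_const * l ^ 20" unfolding \<phi>_def by (rule bd) (use \<beta> in auto)
  assume v: "v > 0" and w: "w > 0"
  let ?d = "\<lambda>t. \<beta> * (of_real t powr (\<beta> - 1) * of_real (exp (- (t / l)))) - of_real (1 / l) * (of_real t powr \<beta> * of_real (exp (- (t / l)))) :: complex"
  have "norm (\<phi> v - \<phi> w) \<le> 41 * weight_const * l ^ 20 * norm (v - w)"
  proof (rule differentiable_bound[where S = "{0<..}" and f' = "\<lambda>t h. h *\<^sub>R ?d t"])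
    fix t :: real assume t: "t \<in> {0<..}"
    have "((\<lambda>x. x powr \<beta> * exp (- (x / of_real l))) has_field_derivative ?d t) (at (of_real t :: complex))"
      using t l by (auto intro!: derivative_eq_intros simp: complex_nonpos_Reals_iff exp_of_real[symmetric] field_simps)
    hence "((\<lambda>x. of_real x powr \<beta> * exp (- (of_real x / of_real l))) has_vector_derivative ?d t) (at t within {0<..})"
      by (rule has_vector_derivative_real_field)
    moreover have "(\<lambda>x. of_real x powr \<beta> * exp (- (of_real x / of_real l))) = \<phi>"
      by (simp add: \<phi>_def fun_eq_iff exp_of_real[symmetric])
    ultimately show "(\<phi> has_derivative (\<lambda>h. h *\<^sub>R ?d t)) (at t within {0<..})"
      by (simp add: has_vector_derivative_def)
    have "norm (?d t) \<le> norm \<beta> * (weight_const * l ^ 20) + 1 * (weight_const * l ^ 20)"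
    proof (rule order_trans[OF norm_triangle_ineq4], unfold norm_mult[of \<beta>] norm_mult[of "of_real (1 / l)"], intro add_mono mult_mono)
      show "norm (complex_of_real (1 / l)) \<le> 1" using l by (simp add: norm_divide)
    qed (use t \<beta> W l in \<open>auto intro!: bd\<close>)
    also have "\<dots> \<le> 40 * (weight_const * l ^ 20) + 1 * (weight_const * l ^ 20)"
      using \<beta> W l by (intro add_mono mult_right_mono) auto
    finally have "norm (?d t) \<le> 41 * weight_const * l ^ 20" by simp
    thus "onorm (\<lambda>h. h *\<^sub>R ?d t) \<le> 41 * weight_const * l ^ 20"
      by (intro onorm_le) (simp only: norm_scaleR real_norm_def mult.commute mult_left_mono abs_ge_zero)
  qed (use v w in auto)
  thus "norm (\<phi> v - \<phi> w) \<le> 41 * weight_const * l ^ 20 * \<bar>v - w\<bar>" by simp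
qed

text \<open>The number of integers between \<open>exp v\<close> and \<open>exp w\<close> and the
  change of the normalizing exponential contribute slope 1 each; rounding to integers adds one
  summand, of weight \<open>exp (- w)\<close> at most.\<close>

lemma normalized_omega_sum_lipschitz:
  assumes z: "norm z = 1"
  defines "\<rho> \<equiv> \<lambda>v. of_real (exp (- v)) * omega_sum z v"
  shows "norm (\<rho> v) \<le> 1" "norm (\<rho> v - \<rho> w) \<le> 2 * \<bar>v - w\<bar> + exp (- w)"
proof -
  have "norm (\<rho> v) \<le> exp (- v) * exp v"
    unfolding \<rho>_def norm_mult using norm_omega_sum_le[OF z] by (intro mult_mono) auto
  thus "norm (\<rho> v) \<le> 1" by (simp add: exp_minus)
  \<comment> \<open>The additive term sits at the larger endpoint \<open>b\<close>, so it is at most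
    \<open>exp (- w)\<close> whichever of \<open>v\<close> and \<open>w\<close> is larger.\<close>
  have *: "norm (\<rho> b - \<rho> a) \<le> 2 * (b - a) + exp (- b)" if "a \<le> b" for a b
  proof -
    have "\<rho> b - \<rho> a = of_real (exp (- b)) * (omega_sum z b - omega_sum z a) - of_real (exp (- a) - exp (- b)) * omega_sum z a"
      by (simp add: \<rho>_def algebra_simps)
    also have "norm \<dots> \<le> exp (- b) * norm (omega_sum z b - omega_sum z a) + \<bar>exp (- a) - exp (- b)\<bar> * norm (omega_sum z a)"
      by (rule order_trans[OF norm_triangle_ineq4]) (simp only: norm_mult norm_of_real abs_exp_cancel order_refl)
    also have "\<dots> \<le> exp (- b) * (exp b - exp a + 1) + (exp (- a) - exp (- b)) * exp a"
      using that norm_omega_sum_diff_le[OF z that] norm_omega_sum_le[OF z, of a]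
      by (intro add_mono mult_mono) auto
    also have "\<dots> = 2 * (1 - exp (a - b)) + exp (- b)"
      by (simp add: algebra_simps exp_minus exp_diff divide_inverse)
    also have "1 - exp (a - b) \<le> b - a" using exp_ge_add_one_self[of "a - b"] by linarith
    finally show ?thesis by simp
  qed
  show "norm (\<rho> v - \<rho> w) \<le> 2 * \<bar>v - w\<bar> + exp (- w)"
  proof (cases "v \<le> w")
    case True
    thus ?thesis using *[of v w] by (simp add: norm_minus_commute)
  next
    case False
    hence "exp (- v) \<le> exp (- w)" by simp
    moreover have "norm (\<rho> v - \<rho> w) \<le> 2 * (v - w) + exp (- v)" by (rule *) (use False in simp)
    moreover have "\<bar>v - w\<bar> = v - w" using False by simp
    ultimately show ?thesis by linarith
  qed
qed

text \<open>A product rule: 43 is 41 for the weight of \<open>omega_sum\<close> plus 2 for the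
  normalized sum itself, and \<open>41 * C\<close> comes from the model.\<close>

lemma weighted_diff_lipschitz:
  assumes z: "norm z = 1" and l: "l \<ge> 1" and C: "norm (leading_coeff z) \<le> C"
  shows "norm (weighted_diff z l v - weighted_diff z l l) \<le>
     (43 + 41 * C) * weight_const * l ^ 20 * (\<bar>v - l\<bar> + exp (- l))"
proof -
  have Rz: "\<bar>Re z\<bar> \<le> 1" using abs_Re_le_cmod[of z] z by simp
  have C0: "C \<ge> 0" using C norm_ge_zero order_trans by blast
  have W: "weight_const \<ge> 0" by (simp add: weight_const_def)
  define A where "A = weight_const * l ^ 20"
  have A: "A \<ge> 0" using W l by (simp add: A_def)
  define \<phi> where "\<phi> \<beta> v = (of_real v powr \<beta> * of_real (exp (- (v / l))) :: complex)" for \<beta> v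
  define \<rho> where "\<rho> v = of_real (exp (- v)) * omega_sum z v" for v
  note \<rho> = normalized_omega_sum_lipschitz[OF z, folded \<rho>_def]
  have nz: "norm (z + 19) \<le> 40" using norm_triangle_ineq[of z 19] z by simp
  note \<phi>1 = powr_exp_decay_lipschitz[OF l, of 20, folded \<phi>_def A_def, simplified]
  note \<phi>2 = powr_exp_decay_lipschitz[OF l, of "z + 19", folded \<phi>_def A_def, OF _ _ nz]
  have eq: "weighted_diff z l v = \<phi> 20 v * \<rho> v - leading_coeff z * \<phi> (z + 19) v" if "v > 0" for v
  proof -
    have "of_real v powr 20 = (of_real v ^ 20 :: complex)" using that powr_nat'[of "of_real v :: complex" 20] by simp
    thus ?thesis using that by (simp add: weighted_diff_def \<phi>_def \<rho>_def pow_plus_def algebra_simps)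
  qed
  show ?thesis
  proof (cases "v > 0")
    case True
    have l0: "l > 0" using l by simp
    have "weighted_diff z l v - weighted_diff z l l =
       (\<phi> 20 v - \<phi> 20 l) * \<rho> v + \<phi> 20 l * (\<rho> v - \<rho> l) - leading_coeff z * (\<phi> (z + 19) v - \<phi> (z + 19) l)"
      unfolding eq[OF True] eq[OF l0] by (simp add: algebra_simps)
    also have "norm \<dots> \<le> norm (\<phi> 20 v - \<phi> 20 l) * norm (\<rho> v) + norm (\<phi> 20 l) * norm (\<rho> v - \<rho> l)
        + norm (leading_coeff z) * norm (\<phi> (z + 19) v - \<phi> (z + 19) l)"
      by (rule order_trans[OF norm_triangle_ineq4 add_mono[OF norm_triangle_mono]]) (auto simp: norm_mult)
    also have "\<dots> \<le> (41 * A * \<bar>v - l\<bar>) * 1 + A * (2 * \<bar>v - l\<bar> + exp (- l)) + C * (41 * A * \<bar>v - l\<bar>)"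
    proof -
      have p1: "norm (\<phi> 20 v - \<phi> 20 l) \<le> 41 * A * \<bar>v - l\<bar>"
        using \<phi>1(2)[of v l] True l0 by (simp add: A_def mult_ac)
      have p2: "norm (\<phi> 20 l) \<le> A" using \<phi>1(1)[of l] l0 by (simp add: A_def)
      have p3: "norm (\<phi> (z + 19) v - \<phi> (z + 19) l) \<le> 41 * A * \<bar>v - l\<bar>"
        using \<phi>2(2)[of v l] True l0 Rz by (simp add: A_def mult_ac)
      show ?thesis by (intro add_mono mult_mono p1 p2 p3 \<rho> C) (use A C0 in auto)
    qed
    also have "\<dots> = A * ((43 + 41 * C) * \<bar>v - l\<bar> + exp (- l))" by (simp add: algebra_simps)
    also have "\<dots> \<le> A * ((43 + 41 * C) * (\<bar>v - l\<bar> + exp (- l)))"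
      using A C0 by (intro mult_left_mono) (auto simp: algebra_simps intro!: add_increasing)
    finally show ?thesis by (simp add: A_def mult_ac)
  next
    case False
    \<comment> \<open>At \<open>v \<le> 0\<close> everything vanishes, at \<open>v = 0\<close>
      because of \<open>v ^ 20\<close>. As \<open>\<bar>v - l\<bar> \<ge> 1\<close> here, a bound
      for the single value at \<open>l\<close> suffices.\<close>
    hence "weighted_diff z l v = 0"
      by (cases "v = 0") (auto simp: weighted_diff_def pow_plus_def omega_sum_neg)
    hence "norm (weighted_diff z l v - weighted_diff z l l) = norm (\<phi> 20 l * \<rho> l - leading_coeff z * \<phi> (z + 19) l)"
      using eq[of l] l by (simp add: norm_minus_commute)
    also have "\<dots> \<le> norm (\<phi> 20 l) * norm (\<rho> l) + norm (leading_coeff z) * norm (\<phi> (z + 19) l)"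
      by (rule order_trans[OF norm_triangle_ineq4]) (simp add: norm_mult)
    also have "\<dots> \<le> A * 1 + C * A"
      using \<phi>1(1)[of l] \<phi>2(1)[of l] \<rho>(1)[of l] C C0 A l Rz by (intro add_mono mult_mono) (auto simp: A_def)
    also have "\<dots> = (1 + C) * A * 1" by (simp add: algebra_simps)
    also have "\<dots> \<le> (43 + 41 * C) * A * (\<bar>v - l\<bar> + exp (- l))"
      using C0 A False l by (intro mult_mono) (auto intro!: add_increasing2)
    finally show ?thesis by (simp add: A_def mult_ac)
  qed
qed

section \<open>Asymptotics and the main theorem\<close>

text \<open>Smoothing with \<open>e = 1 / l\<close> and \<open>d = 1 / l ^ 3\<close>, measured
  against \<open>Y = l powr (Re z + 19) \<ge> l ^ 18\<close>. The singular part has order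
  \<open>l powr (Re z + 18)\<close>, large heights give \<open>l ^ 7\<close>, and the oscillation
  \<open>l ^ 20 * d\<close> gives \<open>l ^ 17\<close>; each saves at least one factor
  \<open>l\<close>, and the last one dictates the choice of \<open>d\<close>.\<close>

lemma omega_sum_asymptotic:
  "\<exists>C L0. \<forall>z l. norm z = 1 \<and> l \<ge> L0 \<longrightarrow>
     norm (of_real l powr (1 - z) * of_real (exp (- l)) * omega_sum z l - leading_coeff z) \<le> C / l"
proof -
  obtain C where C: "C > 0" "\<And>z. norm z = 1 \<Longrightarrow> norm (leading_coeff z) \<le> C"
    using leading_coeff_bound by auto
  obtain L0 K1 K2 where L0: "L0 \<ge> 2" and K: "K1 \<ge> 0" "K2 \<ge> 0" and
    tr: "\<And>z l t. norm z = 1 \<Longrightarrow> l \<ge> L0 \<Longrightarrow>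
     norm (fourier (weighted_diff z l) t) \<le>
       K1 * l powr (Re z + 17) / ((1 / l) ^ 2 + t ^ 2) + K2 * l * (\<bar>t\<bar> + 5)"
    using weighted_diff_transform_bound by blast
  define K3 where "K3 = (43 + 41 * C) * weight_const"
  have K3: "K3 \<ge> 0" using C by (simp add: K3_def weight_const_def)
  have "norm (of_real l powr (1 - z) * of_real (exp (- l)) * omega_sum z l - leading_coeff z) \<le>
      exp 1 * (K1 * pi + 6 * K2 + 7 * K3) / l"
    if z: "norm z = 1" and l: "l \<ge> L0" for z l
  proof -
    have l2: "l \<ge> 2" using l L0 by simp
    have Rz: "\<bar>Re z\<bar> \<le> 1" using abs_Re_le_cmod[of z] z by simp
    define Y where "Y = l powr (Re z + 19)"
    have Y: "Y \<ge> l ^ 18"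
    proof -
      have "l ^ 18 = l powr (real 18)" using l2 by (intro powr_realpow[symmetric]) auto
      also have "\<dots> \<le> Y" unfolding Y_def using l2 Rz by (intro powr_mono) auto
      finally show ?thesis .
    qed
    have Y0: "Y > 0" using l2 by (simp add: Y_def)
    have expl: "exp (- l) \<le> 6 * (1 / l ^ 3)"
    proof -
      have "l ^ 3 \<le> fact 3 / 1 ^ 3 * exp (1 * l)" using l2 by (intro power_le_exp) auto
      thus ?thesis using l2 by (simp add: exp_minus field_simps fact_numeral)
    qed
    have int: "integrable lborel (weighted_diff z l)"
      using weighted_diff_transform(1)[OF z, of l 0] l2 by simp
    have "norm (weighted_diff z l l) \<le> (K1 * l powr (Re z + 17)) * pi / (1 / l) +
       (K2 * l) * (1 / (1 / l ^ 3) ^ 2 + 5 / (1 / l ^ 3)) + (K3 * l ^ 20) * (1 / l ^ 3 + exp (- l))"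
    proof (rule gaussian_smoothing_bound[OF int])
      show "norm (weighted_diff z l v - weighted_diff z l l) \<le> K3 * l ^ 20 * (\<bar>v - l\<bar> + exp (- l))" for v
        unfolding K3_def by (rule weighted_diff_lipschitz[OF z _ C(2)[OF z]]) (use l2 in auto)
    qed (use tr[OF z l] l2 K K3 in auto)
    also have "\<dots> \<le> Y * ((K1 * pi + 6 * K2 + 7 * K3) / l)"
    proof -
      have 1: "(K1 * l powr (Re z + 17)) * pi / (1 / l) = Y * (K1 * pi / l)"
      proof -
        have "Y = l powr (Re z + 17) * l powr 2" unfolding Y_def powr_add[symmetric]
          by (rule arg_cong[where f = "\<lambda>x. _ powr x"]) simp
        hence "Y = l powr (Re z + 17) * (l * l)" using l2 by (simp add: power2_eq_square)
        thus ?thesis using l2 by (simp add: field_simps)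
      qed
      have "(K2 * l) * (1 / (1 / l ^ 3) ^ 2 + 5 / (1 / l ^ 3)) = K2 * (l ^ 7 + 5 * l ^ 4)"
        by (simp add: power_divide algebra_simps flip: power_mult power_add power_Suc)
      also have "\<dots> \<le> K2 * (l ^ 17 + 5 * l ^ 17)"
        using l2 K by (intro mult_left_mono add_mono power_increasing) auto
      also have "\<dots> = l ^ 18 * (6 * K2 / l)" using l2 by (simp add: power_eq_if)
      also have "\<dots> \<le> Y * (6 * K2 / l)" using Y K l2 by (intro mult_right_mono) auto
      finally have 2: "(K2 * l) * (1 / (1 / l ^ 3) ^ 2 + 5 / (1 / l ^ 3)) \<le> Y * (6 * K2 / l)" .
      have "(K3 * l ^ 20) * (1 / l ^ 3 + exp (- l)) \<le> (K3 * l ^ 20) * (1 / l ^ 3 + 6 * (1 / l ^ 3))"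
        using K3 expl l2 by (intro mult_left_mono add_left_mono) auto
      also have "\<dots> = l ^ 18 * (7 * K3 / l)" using l2 by (simp add: power_eq_if field_simps)
      also have "\<dots> \<le> Y * (7 * K3 / l)" using Y K3 l2 by (intro mult_right_mono) auto
      finally have 3: "(K3 * l ^ 20) * (1 / l ^ 3 + exp (- l)) \<le> Y * (7 * K3 / l)" .
      show ?thesis using 1 2 3 by (simp add: add_divide_distrib distrib_left)
    qed
    finally have bnd: "norm (weighted_diff z l l) \<le> Y * ((K1 * pi + 6 * K2 + 7 * K3) / l)" .
    define R where "R = of_real l powr (1 - z) * of_real (exp (- l)) * omega_sum z l - leading_coeff z"
    have l20: "of_real l ^ 20 = (of_real l powr (z + 19) * of_real l powr (1 - z) :: complex)"
    proof -
      have "of_real l powr (z + 19) * of_real l powr (1 - z) = (of_real l powr of_nat 20 :: complex)"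
        unfolding powr_add[symmetric] by (rule arg_cong[where f = "\<lambda>x. _ powr x"]) simp
      also have "\<dots> = of_real l ^ 20" using l2 by (subst powr_nat') auto
      finally show ?thesis ..
    qed
    \<comment> \<open>At \<open>v = l\<close> the damping factor is the constant
      \<open>exp (- 1)\<close>, which is why its rate is tied to \<open>l\<close>.\<close>
    have "weighted_diff z l l = of_real (exp (- 1)) * (of_real l powr (z + 19) * R)"
      using l2 unfolding weighted_diff_def l20 R_def
      by (simp add: pow_plus_def algebra_simps)
    hence "norm (weighted_diff z l l) = exp (- 1) * (Y * norm R)"
      using l2 by (simp add: norm_mult norm_powr_real_powr Y_def)
    hence "Y * (exp (- 1) * norm R) \<le> Y * ((K1 * pi + 6 * K2 + 7 * K3) / l)" using bnd by (simp add: mult_ac)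
    hence "exp (- 1) * norm R \<le> (K1 * pi + 6 * K2 + 7 * K3) / l"
      by (rule mult_left_le_imp_le[OF _ Y0])
    hence "exp 1 * (exp (- 1) * norm R) \<le> exp 1 * ((K1 * pi + 6 * K2 + 7 * K3) / l)" by (intro mult_left_mono) auto
    thus ?thesis by (simp add: R_def mult.assoc[symmetric] exp_minus)
  qed
  thus ?thesis by blast
qed

section \<open>Translation to the functions of \<open>u\<close> in the statement\<close>

lemma euler_factor_eq:
  "euler_factor p u = (if prime p then local_factor (exp (\<i> * of_real u)) (of_nat p powr (-1)) else 1)"
proof (cases "prime p")
  case True
  hence p: "real p > 1" using prime_gt_1_nat by simp
  let ?z = "exp (\<i> * of_real u)"
  have w: "of_nat p powr (-1) = (1 / of_nat p :: complex)" using p by (simp add: powr_minus_divide)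
  have a: "complex_of_real (1 - 1 / real p) = 1 - 1 / of_nat p" by simp
  have "1 - 1 / of_nat p \<noteq> (0 :: complex)"
  proof
    assume "1 - 1 / of_nat p = (0 :: complex)"
    hence "of_nat p = (1 :: complex)" using p by (simp add: field_simps)
    thus False using p by simp
  qed
  hence "complex_of_real (1 - 1 / real p) powr ?z = exp (?z * Ln (1 - 1 / of_nat p))"
    by (simp add: powr_def)
  moreover have "?z * (1 / of_nat p) / (1 - 1 / of_nat p) = ?z / (of_nat p - 1)"
    using p by (simp add: field_simps)
  ultimately show ?thesis using True by (simp add: euler_factor_def local_factor_def w mult.commute)
qed (simp add: euler_factor_def)

lemma prodinf_euler_factor: "(\<Prod>p. euler_factor p u) = euler_G (exp (\<i> * of_real u)) 1"
  by (simp add: euler_factor_eq[abs_def] euler_G_def)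

lemma abs_convergent_prod_euler_factor: "abs_convergent_prod (\<lambda>p. euler_factor p u)"
proof (rule summable_imp_abs_convergent_prod, rule summable_comparison_test'[OF summable_local_factor_bound, of 0])
  fix p
  show "norm (norm (euler_factor p u - 1)) \<le> 200 * real p powr (-(3/2))"
    using norm_local_factor_bound[of "exp (\<i> * of_real u)" 1 p] by (simp add: euler_factor_eq)
qed

lemma uniform_limit_euler_factor:
  "uniform_limit UNIV (\<lambda>N u. \<Prod>p\<le>N. euler_factor p u) (\<lambda>u. \<Prod>p. euler_factor p u) sequentially"
proof (rule uniform_limitI)
  fix e :: real assume "e > 0"
  from uniform_limitD[OF uniform_limit_euler_G this]
  have "\<forall>\<^sub>F N in sequentially. \<forall>u. dist (\<Prod>p<N. euler_factor p u) (\<Prod>p. euler_factor p u) < e"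
  proof eventually_elim
    case (elim N)
    show ?case
    proof
      fix u
      from elim[rule_format, of "(exp (\<i> * of_real u), 1)"]
      show "dist (\<Prod>p<N. euler_factor p u) (\<Prod>p. euler_factor p u) < e"
        by (simp add: prodinf_euler_factor) (simp add: euler_factor_eq)
    qed
  qed
  hence "\<forall>\<^sub>F N in sequentially. \<forall>u. dist (\<Prod>p<Suc N. euler_factor p u) (\<Prod>p. euler_factor p u) < e"
    by (rule eventually_sequentially_Suc[THEN iffD2])
  thus "\<forall>\<^sub>F N in sequentially. \<forall>u\<in>UNIV. dist (\<Prod>p\<le>N. euler_factor p u) (\<Prod>p. euler_factor p u) < e"
    unfolding lessThan_Suc_atMost by simp
qed

text \<open>The functional equation of Gamma moves the argument from \<open>z + 1\<close> to
  \<open>z\<close>; the resulting division by \<open>z\<close> matches the passage from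
  \<open>omega\<close> to \<open>omega'\<close>.\<close>

lemma Phi_eq: "Phi u = leading_coeff (exp (\<i> * of_real u)) / exp (\<i> * of_real u)"
proof -
  let ?z = "exp (\<i> * of_real u)"
  have "?z * rGamma (?z + 1) = rGamma ?z" by (rule rGamma_plus1)
  hence "rGamma (?z + 1) = rGamma ?z / ?z" by (simp add: field_simps)
  thus ?thesis by (simp add: Phi_def prodinf_euler_factor leading_coeff_def)
qed

text \<open>The subtracted 1 is the term \<open>n = 1\<close>, which the sum from 2 leaves out and
  for which \<open>omega 1 = 0\<close>; the division by \<open>z u\<close> comes from the shift in
  \<open>omega'\<close>.\<close>

lemma normalized_sum_eq:
  assumes N: "N \<ge> 2"
  defines "z \<equiv> \<lambda>u. exp (\<i> * of_real u)" and "l \<equiv> ln (real N)"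
  shows "normalized_sum N u = of_real l powr (1 - z u) * of_real (exp (- l)) * (omega_sum (z u) l - 1) / z u"
proof -
  have el: "exp l = real N" using N by (simp add: l_def)
  have summand: "exp (\<i> * of_real u * of_int (omega' n)) = z u ^ omega n / z u" for n
  proof -
    have "\<i> * of_real u * of_int (omega' n) = of_nat (omega n) * (\<i> * of_real u) - \<i> * of_real u"
      by (simp add: omega'_def algebra_simps)
    thus ?thesis unfolding z_def by (simp only: exp_diff exp_of_nat_mult)
  qed
  have "omega_sum (z u) l = (\<Sum>n = 1..N. z u ^ omega n)"
    using el by (simp add: omega_sum_def)
  also have "\<dots> = z u ^ omega 1 + (\<Sum>n = 2..N. z u ^ omega n)"
    using N sum.atLeast_Suc_atMost[of 1 N "\<lambda>n. z u ^ omega n"] by (simp add: numeral_2_eq_2)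
  finally have "(\<Sum>n = 2..N. z u ^ omega n) = omega_sum (z u) l - 1" by simp
  moreover have "(\<Sum>n = 2..N. exp (\<i> * of_real u * of_int (omega' n))) = (\<Sum>n = 2..N. z u ^ omega n) / z u"
    by (simp only: summand sum_divide_distrib)
  moreover have "complex_of_real (exp (- l)) = 1 / of_nat N" by (simp add: exp_minus el divide_inverse)
  moreover have "exp (\<i> * of_real u) = z u" by (simp add: z_def)
  ultimately show ?thesis by (simp add: normalized_sum_def l_def[symmetric])
qed

text \<open>The omitted term \<open>n = 1\<close> contributes
  \<open>l powr (1 - Re z) * exp (- l)\<close>, which is at most \<open>6 / l\<close> because the
  power has exponent at most 2.\<close>

lemma normalized_sum_bound:
  "\<exists>C L0. \<forall>N u. N \<ge> 3 \<and> ln (real N) \<ge> L0 \<longrightarrow> norm (normalized_sum N u - Phi u) \<le> C / ln (real N)"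
proof -
  obtain C L0 where C: "\<And>z l. norm z = 1 \<Longrightarrow> l \<ge> L0 \<Longrightarrow>
     norm (of_real l powr (1 - z) * of_real (exp (- l)) * omega_sum z l - leading_coeff z) \<le> C / l"
    using omega_sum_asymptotic by blast
  have "norm (normalized_sum N u - Phi u) \<le> (C + 6) / ln (real N)" if N: "N \<ge> 3" "ln (real N) \<ge> L0" for N u
  proof -
    define l where "l = ln (real N)"
    define z where "z = exp (\<i> * of_real u)"
    have z: "norm z = 1" by (simp add: z_def)
    have Rz: "\<bar>Re z\<bar> \<le> 1" using abs_Re_le_cmod[of z] z by simp
    \<comment> \<open>The condition \<open>N \<ge> 3\<close> ensures \<open>l \<ge> 1\<close>, since
      \<open>ln 3\<close> exceeds 1.\<close>
    have "ln 3 \<le> ln (real N)" using N by (subst ln_le_cancel_iff) auto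
    hence l: "l \<ge> 1" using ln3_gt_1 by (simp add: l_def)
    have "normalized_sum N u - Phi u =
       ((of_real l powr (1 - z) * of_real (exp (- l)) * omega_sum z l - leading_coeff z) - of_real l powr (1 - z) * of_real (exp (- l))) / z"
      using normalized_sum_eq[of N u] N
      by (simp add: Phi_eq l_def[symmetric] z_def[symmetric] diff_divide_distrib add_divide_distrib algebra_simps)
    hence "norm (normalized_sum N u - Phi u) =
       norm ((of_real l powr (1 - z) * of_real (exp (- l)) * omega_sum z l - leading_coeff z) - of_real l powr (1 - z) * of_real (exp (- l)))"
      using z by (simp only: norm_divide div_by_1)
    also have "\<dots> \<le> C / l + norm (of_real l powr (1 - z) * of_real (exp (- l)))"
      by (rule order_trans[OF norm_triangle_ineq4 add_right_mono[OF C]]) (use z N in \<open>auto simp: l_def\<close>)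
    also have "norm (of_real l powr (1 - z) * of_real (exp (- l))) = l powr (1 - Re z) * exp (- l)"
      using l by (simp add: norm_mult norm_powr_real_powr)
    also have "\<dots> \<le> l powr 2 * (6 / l ^ 3)"
    proof (intro mult_mono powr_mono)
      have "l ^ 3 \<le> fact 3 / 1 ^ 3 * exp (1 * l)" using l by (intro power_le_exp) auto
      thus "exp (- l) \<le> 6 / l ^ 3" using l by (simp add: exp_minus field_simps fact_numeral)
    qed (use l Rz in auto)
    also have "\<dots> = 6 / l" using l by (simp add: power2_eq_square power3_eq_cube)
    finally show ?thesis by (simp add: l_def add_divide_distrib)
  qed
  thus ?thesis by blast
qed

lemma uniform_limit_normalized_sum: "uniform_limit UNIV normalized_sum Phi sequentially"
proof (rule uniform_limitI)
  fix e :: real assume e: "e > 0"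
  obtain C L0 where C: "\<And>N u. N \<ge> 3 \<Longrightarrow> ln (real N) \<ge> L0 \<Longrightarrow> norm (normalized_sum N u - Phi u) \<le> C / ln (real N)"
    using normalized_sum_bound by blast
  have ln: "filterlim (\<lambda>N. ln (real N)) at_top sequentially"
    by (rule filterlim_compose[OF ln_at_top filterlim_real_sequentially])
  have "(\<lambda>N. C / ln (real N)) \<longlonglongrightarrow> 0"
    by (rule real_tendsto_divide_at_top[OF tendsto_const ln])
  hence "\<forall>\<^sub>F N in sequentially. C / ln (real N) < e" using e by (rule order_tendstoD(2))
  moreover have "\<forall>\<^sub>F N in sequentially. ln (real N) \<ge> L0" using ln by (simp add: filterlim_at_top)
  moreover have "\<forall>\<^sub>F N in sequentially. N \<ge> (3::nat)" by (rule eventually_ge_at_top)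
  ultimately show "\<forall>\<^sub>F N in sequentially. \<forall>u\<in>UNIV. dist (normalized_sum N u) (Phi u) < e"
  proof eventually_elim
    case (elim N)
    show ?case
    proof
      fix u
      have "dist (normalized_sum N u) (Phi u) \<le> C / ln (real N)" unfolding dist_norm by (rule C) (use elim in auto)
      thus "dist (normalized_sum N u) (Phi u) < e" using elim by simp
    qed
  qed
qed

theorem proposition4p14:
  shows "(\<forall>u. abs_convergent_prod (\<lambda>p. euler_factor p u))
    \<and> locally_uniform_limit (\<lambda>N u. \<Prod>p\<le>N. euler_factor p u) (\<lambda>u. \<Prod>p. euler_factor p u) sequentially
    \<and> (\<forall>u. (\<lambda>N. normalized_sum N u) \<longlonglongrightarrow> Phi u)
    \<and> locally_uniform_limit normalized_sum Phi sequentially"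
proof (intro conjI allI)
  show "abs_convergent_prod (\<lambda>p. euler_factor p u)" for u by (rule abs_convergent_prod_euler_factor)
  \<comment> \<open>Both limits are uniform on the whole line, so \<open>UNIV\<close> serves as the
    neighbourhood of every point.\<close>
  show "locally_uniform_limit (\<lambda>N u. \<Prod>p\<le>N. euler_factor p u) (\<lambda>u. \<Prod>p. euler_factor p u) sequentially"
    unfolding locally_uniform_limit_def using uniform_limit_euler_factor open_UNIV UNIV_I by blast
  show "(\<lambda>N. normalized_sum N u) \<longlonglongrightarrow> Phi u" for u
    by (rule tendsto_uniform_limitI[OF uniform_limit_normalized_sum]) simp
  show "locally_uniform_limit normalized_sum Phi sequentially"
    unfolding locally_uniform_limit_def using uniform_limit_normalized_sum open_UNIV UNIV_I by blast
qed

end
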